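(* Let $G$ be a unicyclic graph and let $\ell\geq 3$ be the length of the unique cycle of $G$. (i) If $\ell\geq 8$, then $G$ does not enjoy the strong exchange property. (ii) If $\ell\in\{5,6,7\}$, then $G$ enjoys the strong exchange property if and only if the independence number of $G$ is at most three. (iii) If $\ell=4$, then $G$ enjoys the strong exchange property if and only if one of the following holds: (1) $G$ is obtained from $C_4$ by attaching at most one pendant edge to each of its vertices; or (2) $G$ is the graph on the vertex set $\{x_1,\ldots,x_7\}$ with edge set $E(C_4)\cup\{\{x_1,x_5\},\{x_5,x_6\},\{x_3,x_7\}\}$, where $C_4$ is the cycle on $\{x_1,x_2,x_3,x_4\}$ with edges $\{x_1,x_2\},\{x_2,x_3\},\{x_3,x_4\},\{x_4,x_1\}$; or (3) $G$ is obtained from $C_4$ by attaching a path of length two to one of its vertices. (iv) If $\ell=3$, then $G$ enjoys the strong exchange property if and only if one of the following holds: (1) $G$ is obtained from $C_3$ by attaching at most one path of length at most two to each of its vertices; or (2) $G$ is obtained from $C_3$ by attaching a path of length three to one of its vertices; or (3) $G$ is obtained from $C_3$ by attaching a finite number of paths of length at most two to one of its vertices.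
   Context: All graphs are finite with no loop, no multiple edge and no isolated vertex. Let $G$ be such a graph on $V(G)=\{x_1,\ldots,x_n\}$ with edge set $E(G)$, and let $S=K[x_1,\ldots,x_n]$ be the polynomial ring over a field $K$. The edge ideal $I(G)\subset S$ is generated by the monomials $x_ix_j$ with $\{x_i,x_j\}\in E(G)$. For a monomial ideal $I\subset S$ and $\mathfrak{c}=(c_1,\ldots,c_n)\in\mathbb{Z}_{>0}^n$, $I_{\mathfrak{c}}$ is the ideal generated by the monomials $x_1^{a_1}\cdots x_n^{a_n}\in I$ with $a_i\le c_i$ for all $i$, and $\delta_{\mathfrak{c}}(I)$ is the largest integer $q$ with $(I^q)_{\mathfrak{c}}\neq 0$. Let $\mathcal{W}(\mathfrak{c},G)$ be the minimal set of monomial generators of $(I(G)^{\delta})_{\mathfrak{c}}$, where $\delta=\delta_{\mathfrak{c}}(I(G))$. $\mathcal{W}(\mathfrak{c},G)$ enjoys the strong exchange property if for all $w=x_1^{a_1}\cdots x_n^{a_n}$ and $w'=x_1^{b_1}\cdots x_n^{b_n}$ in $\mathcal{W}(\mathfrak{c},G)$ and all $\xi,\rho$ with $a_\xi>b_\xi$ and $a_\rho<b_\rho$, one has $x_\rho(w/x_\xi)\in\mathcal{W}(\mathfrak{c},G)$. The graph $G$ enjoys the strong exchange property if $\mathcal{W}(\mathfrak{c},G)$ does for every $\mathfrak{c}\in\mathbb{Z}_{>0}^n$. A unicyclic graph is a finite connected graph having a unique cycle. $C_n$ denotes the cycle of length $n$. The independence number is the largest cardinality of an independent set of vertices. Attaching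 a path of length $r$ to a vertex $v$ means adding new vertices $y_1,\ldots,y_r$ and edges $\{v,y_1\},\{y_1,y_2\},\ldots,\{y_{r-1},y_r\}$; attaching a pendant edge is the case $r=1$. "At most one" and "a finite number" include zero. Descriptions of graphs are up to isomorphism. *)

theory Defs
  imports "HOL-Algebra.Ideal_Product" "HOL-Library.Poly_Mapping"
begin

section \<open>The polynomial ring \<open>K[x\<^sub>v : v \<in> V]\<close> and its monomial ideals\<close>

text \<open>
  Monomials are identified with their exponent vectors, of type \<open>'a \<Rightarrow>\<^sub>0 nat\<close>; a polynomial is a
  finitely supported function from monomials to coefficients.  The coefficient field \<open>K\<close> is the
  type \<open>'k\<close>, passed as a type token where it cannot be inferred.
\<close>

definition monomials :: "'a set \<Rightarrow> ('a \<Rightarrow>\<^sub>0 nat) set" where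
  "monomials V = {a. Poly_Mapping.keys a \<subseteq> V}"

definition mpoly_ring :: "'k::field itself \<Rightarrow> 'a set \<Rightarrow> (('a \<Rightarrow>\<^sub>0 nat) \<Rightarrow>\<^sub>0 'k) ring" where
  "mpoly_ring K V =
    \<lparr> carrier = {p. Poly_Mapping.keys p \<subseteq> monomials V}, mult = (*), one = 1, zero = 0, add = (+) \<rparr>"

definition mon :: "('a \<Rightarrow>\<^sub>0 nat) \<Rightarrow> (('a \<Rightarrow>\<^sub>0 nat) \<Rightarrow>\<^sub>0 'k::field)" where
  "mon a = Poly_Mapping.single a 1"

definition var :: "'a \<Rightarrow> (('a \<Rightarrow>\<^sub>0 nat) \<Rightarrow>\<^sub>0 'k::field)" where
  "var v = mon (Poly_Mapping.single v 1)"

definition bounded_ideal ::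
  "'k::field itself \<Rightarrow> 'a set \<Rightarrow> ('a \<Rightarrow> nat) \<Rightarrow> (('a \<Rightarrow>\<^sub>0 nat) \<Rightarrow>\<^sub>0 'k) set
    \<Rightarrow> (('a \<Rightarrow>\<^sub>0 nat) \<Rightarrow>\<^sub>0 'k) set" where
  "bounded_ideal K V c I = Idl\<^bsub>mpoly_ring K V\<^esub>
    {mon a | a. a \<in> monomials V \<and> mon a \<in> I \<and> (\<forall>v\<in>V. Poly_Mapping.lookup a v \<le> c v)}"

definition ideal_power ::
  "'k::field itself \<Rightarrow> 'a set \<Rightarrow> (('a \<Rightarrow>\<^sub>0 nat) \<Rightarrow>\<^sub>0 'k) set \<Rightarrow> nat
    \<Rightarrow> (('a \<Rightarrow>\<^sub>0 nat) \<Rightarrow>\<^sub>0 'k) set" where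
  "ideal_power K V I q = I [^]\<^bsub>ideals_set (mpoly_ring K V)\<^esub> q"

definition delta_bound ::
  "'k::field itself \<Rightarrow> 'a set \<Rightarrow> ('a \<Rightarrow> nat) \<Rightarrow> (('a \<Rightarrow>\<^sub>0 nat) \<Rightarrow>\<^sub>0 'k) set \<Rightarrow> nat" where
  "delta_bound K V c I = (GREATEST q. bounded_ideal K V c (ideal_power K V I q) \<noteq> {0})"

text \<open>
  A monomial ideal has exactly one inclusion-minimal generating set consisting of monomials, so the
  description below is proper for every monomial ideal \<open>J\<close>.
\<close>

definition minimal_monomial_generators ::
  "'k::field itself \<Rightarrow> 'a set \<Rightarrow> (('a \<Rightarrow>\<^sub>0 nat) \<Rightarrow>\<^sub>0 'k) set \<Rightarrow> ('a \<Rightarrow>\<^sub>0 nat) set" where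
  "minimal_monomial_generators K V J = (THE A. A \<subseteq> monomials V
      \<and> Idl\<^bsub>mpoly_ring K V\<^esub> (mon ` A) = J
      \<and> (\<forall>B. B \<subset> A \<longrightarrow> Idl\<^bsub>mpoly_ring K V\<^esub> (mon ` B) \<noteq> J))"


section \<open>Graphs\<close>

type_synonym 'a graph = "'a set \<times> 'a set set"

abbreviation verts :: "'a graph \<Rightarrow> 'a set" where "verts \<equiv> fst"
abbreviation edges :: "'a graph \<Rightarrow> 'a set set" where "edges \<equiv> snd"

text \<open>Finite, without loops, multiple edges or isolated vertices.\<close>

definition simple_graph :: "'a graph \<Rightarrow> bool" where
  "simple_graph G \<longleftrightarrow> finite (verts G)
    \<and> (\<forall>e\<in>edges G. e \<subseteq> verts G \<and> card e = 2)
    \<and> (\<forall>v\<in>verts G. \<exists>e\<in>edges G. v \<in> e)"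

definition connected_graph :: "'a graph \<Rightarrow> bool" where
  "connected_graph G \<longleftrightarrow> verts G \<noteq> {}
    \<and> (\<forall>u\<in>verts G. \<forall>v\<in>verts G. (u, v) \<in> {(x, y). {x, y} \<in> edges G}\<^sup>*)"

definition independence_number :: "'a graph \<Rightarrow> nat" where
  "independence_number G = Max {card A | A. A \<subseteq> verts G \<and> (\<forall>e\<in>edges G. \<not> e \<subseteq> A)}"

text \<open>
  The edges of the closed walk \<open>x\<^sub>0, x\<^sub>1, \<dots>, x\<^sub>n\<^sub>-\<^sub>1, x\<^sub>0\<close> and of the path \<open>x\<^sub>0, x\<^sub>1, \<dots>, x\<^sub>n\<^sub>-\<^sub>1\<close>,
  respectively.
\<close>

definition cycle_edges :: "'a list \<Rightarrow> 'a set set" where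
  "cycle_edges xs = {{xs ! i, xs ! (Suc i mod length xs)} | i. i < length xs}"

definition path_edges :: "'a list \<Rightarrow> 'a set set" where
  "path_edges xs = {{xs ! i, xs ! Suc i} | i. Suc i < length xs}"

text \<open>
  A cycle is represented by its edge set, so that rotations and reversals of a vertex sequence give
  the same cycle.  The length of a cycle is then its number of edges.
\<close>

definition cycles :: "'a graph \<Rightarrow> 'a set set set" where
  "cycles G = {cycle_edges xs | xs. 3 \<le> length xs \<and> distinct xs \<and> set xs \<subseteq> verts G
      \<and> cycle_edges xs \<subseteq> edges G}"

definition unicyclic :: "'a graph \<Rightarrow> bool" where
  "unicyclic G \<longleftrightarrow> simple_graph G \<and> connected_graph G \<and> (\<exists>!C. C \<in> cycles G)"


section \<open>Edge ideals and the strong exchange property\<close>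

definition edge_ideal :: "'k::field itself \<Rightarrow> 'a graph \<Rightarrow> (('a \<Rightarrow>\<^sub>0 nat) \<Rightarrow>\<^sub>0 'k) set" where
  "edge_ideal K G = Idl\<^bsub>mpoly_ring K (verts G)\<^esub> {var u * var v | u v. {u, v} \<in> edges G}"

definition W_gens :: "'k::field itself \<Rightarrow> ('a \<Rightarrow> nat) \<Rightarrow> 'a graph \<Rightarrow> ('a \<Rightarrow>\<^sub>0 nat) set" where
  "W_gens K c G =
    (let V = verts G; I = edge_ideal K G in
      minimal_monomial_generators K V
        (bounded_ideal K V c (ideal_power K V I (delta_bound K V c I))))"

definition strong_exchange :: "'a set \<Rightarrow> ('a \<Rightarrow>\<^sub>0 nat) set \<Rightarrow> bool" where
  "strong_exchange V W \<longleftrightarrow> (\<forall>a\<in>W. \<forall>b\<in>W. \<forall>\<xi>\<in>V. \<forall>\<rho>\<in>V.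
      Poly_Mapping.lookup b \<xi> < Poly_Mapping.lookup a \<xi> \<longrightarrow>
      Poly_Mapping.lookup a \<rho> < Poly_Mapping.lookup b \<rho> \<longrightarrow>
      Poly_Mapping.single \<rho> 1 + (a - Poly_Mapping.single \<xi> 1) \<in> W)"

definition enjoys_strong_exchange :: "'k::field itself \<Rightarrow> 'a graph \<Rightarrow> bool" where
  "enjoys_strong_exchange K G \<longleftrightarrow>
    (\<forall>c. (\<forall>v\<in>verts G. 0 < c v) \<longrightarrow> strong_exchange (verts G) (W_gens K c G))"


section \<open>Attaching paths\<close>

definition cycle_graph :: "'a list \<Rightarrow> 'a graph" where
  "cycle_graph xs = (set xs, cycle_edges xs)"

text \<open>
  \<open>attachment H P G\<close>: the graph \<open>G\<close> arises from \<open>H\<close> by attaching, for each \<open>(v, ys) \<in> P\<close>, the path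
  with new vertices \<open>ys\<close> to the vertex \<open>v\<close>; the number of paths is finite and the length of the path
  is \<open>length ys \<ge> 1\<close>.  As the new vertices may be any elements of the vertex type, for a family of
  admissible \<open>H\<close> and \<open>P\<close> that is closed under renaming the graphs \<open>G\<close> so obtained are closed under
  isomorphism.
\<close>

definition attachment :: "'a graph \<Rightarrow> ('a \<times> 'a list) set \<Rightarrow> 'a graph \<Rightarrow> bool" where
  "attachment H P G \<longleftrightarrow> finite P
    \<and> (\<forall>(v, ys)\<in>P. v \<in> verts H \<and> ys \<noteq> [] \<and> distinct ys \<and> set ys \<inter> verts H = {})
    \<and> (\<forall>p\<in>P. \<forall>q\<in>P. p \<noteq> q \<longrightarrow> set (snd p) \<inter> set (snd q) = {})
    \<and> G = (verts H \<union> (\<Union>(v, ys)\<in>P. set ys), edges H \<union> (\<Union>(v, ys)\<in>P. path_edges (v # ys)))"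

text \<open>In the next two definitions, \<open>inj_on fst P\<close> says that each vertex gets at most one path.\<close>

definition C4_pendants :: "'a graph \<Rightarrow> bool" where
  "C4_pendants G \<longleftrightarrow> (\<exists>xs P. length xs = 4 \<and> distinct xs \<and> attachment (cycle_graph xs) P G
      \<and> inj_on fst P \<and> (\<forall>(v, ys)\<in>P. length ys = 1))"

definition C3_short_paths :: "'a graph \<Rightarrow> bool" where
  "C3_short_paths G \<longleftrightarrow> (\<exists>xs P. length xs = 3 \<and> distinct xs \<and> attachment (cycle_graph xs) P G
      \<and> inj_on fst P \<and> (\<forall>(v, ys)\<in>P. length ys \<le> 2))"

definition C4_seven_vertices :: "'a graph \<Rightarrow> bool" where
  "C4_seven_vertices G \<longleftrightarrow> (\<exists>x1 x2 x3 x4 x5 x6 x7. distinct [x1, x2, x3, x4, x5, x6, x7]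
      \<and> G = ({x1, x2, x3, x4, x5, x6, x7},
             {{x1, x2}, {x2, x3}, {x3, x4}, {x4, x1}} \<union> {{x1, x5}, {x5, x6}, {x3, x7}}))"

definition cycle_one_path :: "nat \<Rightarrow> nat \<Rightarrow> 'a graph \<Rightarrow> bool" where
  "cycle_one_path n r G \<longleftrightarrow> (\<exists>xs v ys. length xs = n \<and> distinct xs \<and> length ys = r
      \<and> attachment (cycle_graph xs) {(v, ys)} G)"

definition C3_paths_at_vertex :: "'a graph \<Rightarrow> bool" where
  "C3_paths_at_vertex G \<longleftrightarrow> (\<exists>xs P. length xs = 3 \<and> distinct xs \<and> attachment (cycle_graph xs) P G
      \<and> (\<exists>v\<in>set xs. \<forall>(u, ys)\<in>P. u = v \<and> length ys \<le> 2))"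

end

theory Submission
  imports Defs "HOL-Library.Multiset"
begin

text \<open>
  The exponents in \<open>\<W>(\<cc>, G)\<close> are the degree vectors of the largest multisets of edges
  whose degrees are bounded by \<open>\<cc>\<close>.  Following an alternating trail in the symmetric difference
  of two such multisets shows that these vectors satisfy the exchange axiom of base systems of
  discrete polymatroids.  With it, a failure of strong exchange can be moved to a \<^emph>\<open>bad square\<close>:
  four vertices \<open>p, q, r, s\<close> and a vector \<open>m\<close> such that \<open>m + p + q\<close>, \<open>m + r + s\<close>,
  \<open>m + p + r\<close> and \<open>m + q + s\<close> are degree vectors while \<open>m + q + r\<close> is not.

  Strong exchange fails if among four independent vertices one neighbour sees exactly the first two
  and another sees the last two, as on every long cycle, or if some vertex has two nonadjacent
  neighbours that see no vertex of a triangle.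
  Conversely, if the incidence matrix is invertible, the absence of bad squares is a sign
  condition on twice its inverse, and the remaining cases are settled by augmenting along edges
  at a leaf.  The shape of a unicyclic graph without the two obstructions is found by rooting the
  trees hanging off the cycle.
\<close>

section \<open>Monomial ideals\<close>

text \<open>The positive results are proved for capacities that may vanish. A vertex of capacity
  zero is in effect deleted, so the property passes to induced subgraphs and only the largest graphs
  of each kind need a proof: heptagon, hexagon, pentagon with a tail of length two, two graphs
  around the square, and around the triangle two fixed graphs and one infinite family. The parity of
  the cycle decides the method. With an odd cycle the incidence matrix is invertible and twice its
  inverse is integral, so a vector has only one candidate for its edge multiplicities. With an even
  cycle the graph is bipartite and the matrix is singular; there the alternating sign vector
  restricts the corners of a bad square, and for the square the missing degree vector is built
  explicitly after the edges outside the square are peeled off. The bound three on the independence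
  number enters because two claws contain four independent vertices, while for cycle lengths five to
  seven the graphs without two claws are so small that they have no four independent
  vertices.\<close>

definition monomial_ideal ::
  "'a set \<Rightarrow> ('a \<Rightarrow>\<^sub>0 nat) set \<Rightarrow> (('a \<Rightarrow>\<^sub>0 nat) \<Rightarrow>\<^sub>0 'k::field) set" where
  "monomial_ideal V A = {p. Poly_Mapping.keys p \<subseteq> monomials V
      \<and> (\<forall>a\<in>Poly_Mapping.keys p. \<exists>b\<in>A. \<exists>d. a = b + d)}"

lemma monomials_add: "a \<in> monomials V \<Longrightarrow> b \<in> monomials V \<Longrightarrow> a + b \<in> monomials V"
  unfolding monomials_def using Poly_Mapping.keys_add[of a b] by blast

lemma monomials_addD:
  assumes "a + b \<in> monomials V"
  shows "a \<in> monomials V" and "b \<in> monomials V"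
proof -
  have "Poly_Mapping.keys a \<union> Poly_Mapping.keys b \<subseteq> Poly_Mapping.keys (a + b)"
    by (auto simp: in_keys_iff lookup_add)
  then show "a \<in> monomials V" "b \<in> monomials V"
    using assms by (auto simp: monomials_def)
qed

lemma zero_in_monomials [simp]: "0 \<in> monomials V"
  by (simp add: monomials_def)

lemma keys_mult_in_monomials:
  assumes "Poly_Mapping.keys p \<subseteq> monomials V" "Poly_Mapping.keys q \<subseteq> monomials V"
  shows "Poly_Mapping.keys (p * q) \<subseteq> monomials V"
  using keys_mult[of p q] assms monomials_add by fastforce

lemma keys_uminus: "Poly_Mapping.keys (- p :: 'b \<Rightarrow>\<^sub>0 'c::ab_group_add) = Poly_Mapping.keys p"
  by (auto simp: in_keys_iff)

lemma cring_mpoly_ring: "cring (mpoly_ring K V)"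
proof (rule cringI)
  show "abelian_group (mpoly_ring K V)"
  proof (rule abelian_groupI)
    fix x assume "x \<in> carrier (mpoly_ring K V)"
    then show "\<exists>y\<in>carrier (mpoly_ring K V). y \<oplus>\<^bsub>mpoly_ring K V\<^esub> x = \<zero>\<^bsub>mpoly_ring K V\<^esub>"
      by (intro bexI[of _ "- x"]) (auto simp: mpoly_ring_def keys_uminus)
  qed (use Poly_Mapping.keys_add in \<open>fastforce simp: mpoly_ring_def algebra_simps\<close>)+
  show "comm_monoid (mpoly_ring K V)"
    by (rule comm_monoidI)
      (auto simp: mpoly_ring_def algebra_simps dest: keys_mult_in_monomials[THEN subsetD, rotated 2])
qed (auto simp: mpoly_ring_def algebra_simps)

lemma carrier_mpoly_ring: "p \<in> carrier (mpoly_ring K V) \<longleftrightarrow> Poly_Mapping.keys p \<subseteq> monomials V"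
  by (simp add: mpoly_ring_def)

lemma keys_mon [simp]: "Poly_Mapping.keys (mon a) = {a}"
  by (simp add: mon_def)

lemma mon_mult: "mon a * mon b = mon (a + b)"
  by (simp add: mon_def mult_single)

lemma mon_in_monomial_ideal:
  "mon a \<in> monomial_ideal V A \<longleftrightarrow> a \<in> monomials V \<and> (\<exists>b\<in>A. \<exists>d. a = b + d)"
  by (simp add: monomial_ideal_def)

lemma ideal_monomial_ideal:
  "ideal (monomial_ideal V A) (mpoly_ring K V)" (is "ideal ?I ?R")
proof -
  interpret R: cring ?R by (rule cring_mpoly_ring)
  have add: "p + q \<in> ?I" if "p \<in> ?I" "q \<in> ?I" for p q
    using that Poly_Mapping.keys_add[of p q] unfolding monomial_ideal_def by fastforce
  have neg: "- p \<in> ?I" if "p \<in> ?I" for p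
    using that by (simp add: monomial_ideal_def keys_uminus)
  have mult: "x * p \<in> ?I" if "p \<in> ?I" "Poly_Mapping.keys x \<subseteq> monomials V" for x p
  proof -
    have "\<exists>b\<in>A. \<exists>d. k = b + d" if k: "k \<in> Poly_Mapping.keys (x * p)" for k
    proof -
      obtain i j where ij: "k = i + j" "j \<in> Poly_Mapping.keys p"
        using subsetD[OF keys_mult k] by auto
      then obtain b d where "b \<in> A" "j = b + d"
        using \<open>p \<in> ?I\<close> by (auto simp: monomial_ideal_def)
      then show ?thesis using ij by (metis add.assoc add.commute)
    qed
    then show ?thesis
      using that keys_mult_in_monomials[of x V p] by (auto simp: monomial_ideal_def)
  qed
  have ops: "x \<oplus>\<^bsub>?R\<^esub> y = x + y" "x \<otimes>\<^bsub>?R\<^esub> y = x * y" "\<zero>\<^bsub>?R\<^esub> = 0" for x y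
    by (simp_all add: mpoly_ring_def)
  have sub: "?I \<subseteq> carrier ?R"
    by (auto simp: monomial_ideal_def carrier_mpoly_ring)
  show ?thesis
  proof (rule idealI)
    show "ring ?R" by (rule R.ring_axioms)
    show "subgroup ?I (add_monoid ?R)"
    proof (rule R.add.subgroupI)
      show "?I \<subseteq> carrier ?R" by (rule sub)
      show "?I \<noteq> {}" by (auto simp: monomial_ideal_def intro!: exI[of _ 0])
    next
      fix a assume a: "a \<in> ?I"
      have "\<ominus>\<^bsub>?R\<^esub> a = - a"
        by (rule R.minus_equality) (use sub a neg[OF a] in \<open>auto simp only: ops subset_eq left_minus\<close>)
      then show "\<ominus>\<^bsub>?R\<^esub> a \<in> ?I" using neg[OF a] by simp
    next
      fix a b assume "a \<in> ?I" "b \<in> ?I"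
      then show "a \<oplus>\<^bsub>?R\<^esub> b \<in> ?I" unfolding ops by (rule add)
    qed
    show "x \<otimes>\<^bsub>?R\<^esub> a \<in> ?I" "a \<otimes>\<^bsub>?R\<^esub> x \<in> ?I" if "a \<in> ?I" "x \<in> carrier ?R" for a x
      using mult[of a x] that unfolding ops carrier_mpoly_ring mult.commute[of a x] by blast+
  qed
qed

lemma poly_mapping_sum_single:
  "(p :: 'b \<Rightarrow>\<^sub>0 'c::comm_monoid_add) = (\<Sum>a\<in>Poly_Mapping.keys p. Poly_Mapping.single a (Poly_Mapping.lookup p a))"
  by (rule poly_mapping_eqI)
    (auto simp: lookup_sum lookup_single when_def in_keys_iff sum.delta')

text \<open>A polynomial is the sum of its terms, and each term of an element of
  \<open>monomial_ideal V A\<close> is a multiple of a generator. This replaces generated ideals by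
  a divisibility test on exponents.\<close>

lemma genideal_mon:
  assumes A: "A \<subseteq> monomials V"
  shows "Idl\<^bsub>mpoly_ring K V\<^esub> (mon ` A) = monomial_ideal V A" (is "Idl\<^bsub>?R\<^esub> _ = ?I")
proof
  interpret R: cring ?R by (rule cring_mpoly_ring)
  have "mon ` A \<subseteq> ?I"
    using A by (force simp: mon_in_monomial_ideal)
  then show "Idl\<^bsub>?R\<^esub> (mon ` A) \<subseteq> ?I"
    by (intro R.genideal_minimal ideal_monomial_ideal)
  have "mon ` A \<subseteq> carrier ?R"
    using A by (auto simp: carrier_mpoly_ring)
  then interpret J: ideal "Idl\<^bsub>?R\<^esub> (mon ` A)" ?R
    by (rule R.genideal_ideal)
  have gen: "mon ` A \<subseteq> Idl\<^bsub>?R\<^esub> (mon ` A)"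
    using \<open>mon ` A \<subseteq> carrier ?R\<close> by (rule R.genideal_self)
  show "?I \<subseteq> Idl\<^bsub>?R\<^esub> (mon ` A)"
  proof
    fix p assume p: "p \<in> ?I"
    have "(\<Sum>a\<in>B. Poly_Mapping.single a (Poly_Mapping.lookup p a)) \<in> Idl\<^bsub>?R\<^esub> (mon ` A)"
      if "finite B" "B \<subseteq> Poly_Mapping.keys p" for B
      using that
    proof (induction B rule: finite_induct)
      case empty
      then show ?case using J.zero_closed by (simp add: mpoly_ring_def)
    next
      case (insert a B)
      obtain b d where bd: "b \<in> A" "a = b + d" "a \<in> monomials V"
        using p insert.prems unfolding monomial_ideal_def by fastforce
      let ?x = "Poly_Mapping.single d (Poly_Mapping.lookup p a)"
      have "?x \<in> carrier ?R"
        using bd monomials_addD by (auto simp: carrier_mpoly_ring)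
      then have "?x \<otimes>\<^bsub>?R\<^esub> mon b \<in> Idl\<^bsub>?R\<^esub> (mon ` A)"
        using gen bd by (intro J.I_l_closed) auto
      moreover have "?x \<otimes>\<^bsub>?R\<^esub> mon b = Poly_Mapping.single a (Poly_Mapping.lookup p a)"
        using bd by (simp add: mpoly_ring_def mon_def mult_single add.commute)
      ultimately have "Poly_Mapping.single a (Poly_Mapping.lookup p a) \<in> Idl\<^bsub>?R\<^esub> (mon ` A)"
        by simp
      from J.a_closed[OF this insert.IH] insert show ?case
        by (simp add: mpoly_ring_def)
    qed
    from this[of "Poly_Mapping.keys p"] show "p \<in> Idl\<^bsub>?R\<^esub> (mon ` A)"
      by (subst poly_mapping_sum_single) simp
  qed
qed

text \<open>Products of ideals become sums of exponent sets, so powers of the edge ideal can be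
  described by multisets of edges.\<close>

lemma ideal_prod_monomial_ideal:
  fixes A :: "('a \<Rightarrow>\<^sub>0 nat) set" and K :: "'k::field itself"
  assumes A: "A \<subseteq> monomials V" and B: "B \<subseteq> monomials V"
  shows "monomial_ideal V A \<cdot>\<^bsub>mpoly_ring K V\<^esub> monomial_ideal V B
    = monomial_ideal V {a + b | a b. a \<in> A \<and> b \<in> B}" (is "?I \<cdot>\<^bsub>?R\<^esub> ?J = ?L")
proof
  interpret R: cring ?R by (rule cring_mpoly_ring)
  interpret L: ideal ?L ?R by (rule ideal_monomial_ideal)
  show "?I \<cdot>\<^bsub>?R\<^esub> ?J \<subseteq> ?L"
  proof
    fix s assume "s \<in> ?I \<cdot>\<^bsub>?R\<^esub> ?J"
    then show "s \<in> ?L"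
    proof (induction s rule: ideal_prod.induct)
      case (prod i j)
      have "\<exists>b\<in>{a + b | a b. a \<in> A \<and> b \<in> B}. \<exists>d. k = b + d" if k: "k \<in> Poly_Mapping.keys (i * j)" for k
      proof -
        obtain u v where uv: "k = u + v" "u \<in> Poly_Mapping.keys i" "v \<in> Poly_Mapping.keys j"
          using subsetD[OF keys_mult k] by auto
        then obtain a d b d' where "a \<in> A" "u = a + d" "b \<in> B" "v = b + d'"
          using prod by (fastforce simp: monomial_ideal_def)
        moreover then have "k = (a + b) + (d + d')"
          using uv by (simp add: ac_simps)
        ultimately show ?thesis by blast
      qed
      moreover have "Poly_Mapping.keys (i * j) \<subseteq> monomials V"
        using prod by (intro keys_mult_in_monomials) (auto simp: monomial_ideal_def)
      ultimately show ?case by (simp add: monomial_ideal_def mpoly_ring_def)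
    qed (rule L.a_closed)
  qed
  have C: "{a + b | a b. a \<in> A \<and> b \<in> B} \<subseteq> monomials V"
    using A B monomials_add by blast
  have "mon ` {a + b | a b. a \<in> A \<and> b \<in> B} \<subseteq> ?I \<cdot>\<^bsub>?R\<^esub> ?J"
  proof
    fix x assume "x \<in> (mon :: _ \<Rightarrow> _ \<Rightarrow>\<^sub>0 'k) ` {a + b | a b. a \<in> A \<and> b \<in> B}"
    then obtain a b where ab: "x = mon (a + b)" "a \<in> A" "b \<in> B" by auto
    have "mon a \<in> ?I" "mon b \<in> ?J"
      using ab A B by (force simp: mon_in_monomial_ideal)+
    from ideal_prod.prod[OF this, of ?R] show "x \<in> ?I \<cdot>\<^bsub>?R\<^esub> ?J"
      using ab by (simp add: mpoly_ring_def mon_mult)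
  qed
  then have "Idl\<^bsub>?R\<^esub> (mon ` {a + b | a b. a \<in> A \<and> b \<in> B}) \<subseteq> ?I \<cdot>\<^bsub>?R\<^esub> ?J"
    by (intro R.genideal_minimal R.ideal_prod_is_ideal ideal_monomial_ideal)
  then show "?L \<subseteq> ?I \<cdot>\<^bsub>?R\<^esub> ?J"
    by (simp add: genideal_mon[OF C])
qed

lemma monomial_ideal_one: "monomial_ideal V {0} = carrier (mpoly_ring K V)"
  by (auto simp: monomial_ideal_def carrier_mpoly_ring)

text \<open>A divisor of a bounded monomial is bounded, so the truncation can be carried out on the
  generators.\<close>

lemma bounded_ideal_monomial_ideal:
  fixes A :: "('a \<Rightarrow>\<^sub>0 nat) set" and K :: "'k::field itself" and c :: "'a \<Rightarrow> nat" and V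
  assumes A: "A \<subseteq> monomials V"
  defines "B \<equiv> {b \<in> A. \<forall>v\<in>V. Poly_Mapping.lookup b v \<le> c v}"
  shows "bounded_ideal K V c (monomial_ideal V A) = monomial_ideal V B"
proof -
  let ?C = "{a. a \<in> monomials V \<and> mon a \<in> (monomial_ideal V A :: (_ \<Rightarrow>\<^sub>0 'k) set)
      \<and> (\<forall>v\<in>V. Poly_Mapping.lookup a v \<le> c v)}"
  have "{(mon a :: _ \<Rightarrow>\<^sub>0 'k) | a. a \<in> monomials V \<and> mon a \<in> (monomial_ideal V A :: (_ \<Rightarrow>\<^sub>0 'k) set)
      \<and> (\<forall>v\<in>V. Poly_Mapping.lookup a v \<le> c v)} = mon ` ?C"
    by auto
  then have "bounded_ideal K V c (monomial_ideal V A) = monomial_ideal V ?C"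
    unfolding bounded_ideal_def by (metis (no_types, lifting) genideal_mon mem_Collect_eq subsetI)
  moreover have "monomial_ideal V ?C = (monomial_ideal V B :: (_ \<Rightarrow>\<^sub>0 'k) set)"
  proof -
    have div: "\<exists>b\<in>B. \<exists>d. a = b + d" if a: "a \<in> ?C" for a
    proof -
      obtain b d where bd: "b \<in> A" "a = b + d"
        using a by (auto simp: mon_in_monomial_ideal)
      have "Poly_Mapping.lookup b v \<le> c v" if "v \<in> V" for v
      proof -
        have "Poly_Mapping.lookup a v \<le> c v" using \<open>a \<in> ?C\<close> that by simp
        then show ?thesis using bd(2) by (simp add: lookup_add)
      qed
      then have "b \<in> B" using bd by (simp add: B_def)
      then show ?thesis using bd(2) by blast
    qed
    have "B \<subseteq> ?C"
      using A unfolding B_def mon_in_monomial_ideal by auto (metis add.right_neutral)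
    then have "(\<exists>b\<in>?C. \<exists>d. k = b + d) \<longleftrightarrow> (\<exists>b\<in>B. \<exists>d. k = b + d)" for k
      using div by (metis (no_types, lifting) add.assoc subsetD)
    then show ?thesis
      unfolding monomial_ideal_def by simp
  qed
  ultimately show ?thesis by simp
qed

lemma monomial_ideal_nonzero:
  assumes "A \<subseteq> monomials V"
  shows "(monomial_ideal V A :: (_ \<Rightarrow>\<^sub>0 'k::field) set) \<noteq> {0} \<longleftrightarrow> A \<noteq> {}"
proof
  assume "A \<noteq> {}"
  then obtain a where "a \<in> A" by blast
  then have "(mon a :: _ \<Rightarrow>\<^sub>0 'k) \<in> monomial_ideal V A"
    using assms by (force simp: mon_in_monomial_ideal)
  moreover have "mon a \<noteq> (0 :: _ \<Rightarrow>\<^sub>0 'k)" using keys_mon[of a] by (metis keys_zero insert_not_empty)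
  ultimately show "(monomial_ideal V A :: (_ \<Rightarrow>\<^sub>0 'k) set) \<noteq> {0}" by auto
next
  assume "(monomial_ideal V A :: (_ \<Rightarrow>\<^sub>0 'k::field) set) \<noteq> {0}"
  then show "A \<noteq> {}" by (auto simp: monomial_ideal_def)
qed

text \<open>No element of \<open>W\<close> properly divides another. If \<open>A\<close> generates
  the same ideal, each \<open>w\<close> in \<open>W\<close> has a divisor \<open>b\<close> in
  \<open>A\<close>, which in turn has a divisor in \<open>W\<close>; that divisor must be
  \<open>w\<close>, so \<open>b = w\<close>. Hence \<open>W\<close> lies in every monomial
  generating set.\<close>

lemma minimal_monomial_generators_equigenerated:
  fixes W :: "('a \<Rightarrow>\<^sub>0 nat) set" and K :: "'k::field itself"
  assumes W: "W \<subseteq> monomials V"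
    and anti: "\<And>a d. a \<in> W \<Longrightarrow> a + d \<in> W \<Longrightarrow> d = 0"
  shows "minimal_monomial_generators K V (monomial_ideal V W) = W"
  unfolding minimal_monomial_generators_def
proof (rule the_equality)
  let ?R = "mpoly_ring K V"
  have in_gen: "w \<in> A" if A: "A \<subseteq> monomials V" and w: "w \<in> W"
    and eq: "monomial_ideal V A = (monomial_ideal V W :: (_ \<Rightarrow>\<^sub>0 'k) set)"
    for w A
  proof -
    have "(mon w :: _ \<Rightarrow>\<^sub>0 'k) \<in> monomial_ideal V W"
      using w W by (force simp: mon_in_monomial_ideal)
    then obtain b d where bd: "b \<in> A" "w = b + d"
      by (auto simp: eq[symmetric] mon_in_monomial_ideal)
    then have "(mon b :: _ \<Rightarrow>\<^sub>0 'k) \<in> monomial_ideal V A"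
      using A by (force simp: mon_in_monomial_ideal)
    then obtain w' d' where w': "w' \<in> W" "b = w' + d'"
      by (auto simp: eq mon_in_monomial_ideal)
    then have "w = w' + (d' + d)" using bd by (simp add: ac_simps)
    then have "d' + d = 0" using anti[of w' "d' + d"] w' \<open>w \<in> W\<close> by simp
    then have "d = 0"
      by (intro poly_mapping_eqI) (metis add_is_0 lookup_add lookup_zero)
    then show ?thesis using bd by simp
  qed
  show "W \<subseteq> monomials V \<and> Idl\<^bsub>?R\<^esub> (mon ` W) = monomial_ideal V W \<and>
    (\<forall>B\<subset>W. Idl\<^bsub>?R\<^esub> (mon ` B) \<noteq> monomial_ideal V W)"
  proof (intro conjI allI impI W genideal_mon)
    fix B assume B: "B \<subset> W"
    then have "B \<subseteq> monomials V" using W by blast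
    then show "Idl\<^bsub>?R\<^esub> (mon ` B) \<noteq> monomial_ideal V W"
      using in_gen[of B] B by (auto simp: genideal_mon)
  qed
  fix A :: "('a \<Rightarrow>\<^sub>0 nat) set"
  assume A: "A \<subseteq> monomials V \<and> Idl\<^bsub>?R\<^esub> (mon ` A) = monomial_ideal V W \<and>
    (\<forall>B\<subset>A. Idl\<^bsub>?R\<^esub> (mon ` B) \<noteq> monomial_ideal V W)"
  then have "W \<subseteq> A" using in_gen[of A] by (auto simp: genideal_mon)
  moreover have "Idl\<^bsub>?R\<^esub> (mon ` W) = monomial_ideal V W" using W by (rule genideal_mon)
  ultimately show "A = W" using A by blast
qed

section \<open>Degree vectors of maximum bounded edge multisets\<close>

definition deg :: "'a set multiset \<Rightarrow> 'a \<Rightarrow> nat" where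
  "deg M v = size {#e \<in># M. v \<in> e#}"

text \<open>In optimisation these are integral b-matchings; an edge may be repeated as often as the
  capacities allow.\<close>

definition bmatchings :: "'a set set \<Rightarrow> ('a \<Rightarrow> nat) \<Rightarrow> 'a set multiset set" where
  "bmatchings E c = {M. set_mset M \<subseteq> E \<and> (\<forall>v. deg M v \<le> c v)}"

definition max_bmatchings :: "'a set set \<Rightarrow> ('a \<Rightarrow> nat) \<Rightarrow> 'a set multiset set" where
  "max_bmatchings E c = {M \<in> bmatchings E c. \<forall>N\<in>bmatchings E c. size N \<le> size M}"

definition max_degrees :: "'a set set \<Rightarrow> ('a \<Rightarrow> nat) \<Rightarrow> ('a \<Rightarrow> nat) set" where
  "max_degrees E c = deg ` max_bmatchings E c"

lemma deg_empty [simp]: "deg {#} v = 0"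
  by (simp add: deg_def)

lemma deg_union [simp]: "deg (M + N) v = deg M v + deg N v"
  by (simp add: deg_def)

lemma deg_add_mset [simp]: "deg (add_mset e M) v = (if v \<in> e then 1 else 0) + deg M v"
  by (simp add: deg_def)

lemma deg_diff: "N \<subseteq># M \<Longrightarrow> deg (M - N) v = deg M v - deg N v"
  using deg_union[of "M - N" N v] by (simp add: subset_mset.diff_add)

lemma deg_mono: "N \<subseteq># M \<Longrightarrow> deg N v \<le> deg M v"
  by (metis deg_union le_add2 subset_mset.diff_add)

lemma deg_pos_iff: "0 < deg M v \<longleftrightarrow> (\<exists>e\<in>#M. v \<in> e)"
  by (induction M) auto

lemma sum_deg:
  assumes "finite V" "\<And>e. e \<in># M \<Longrightarrow> e \<subseteq> V \<and> card e = 2"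
  shows "(\<Sum>v\<in>V. deg M v) = 2 * size M"
  using assms(2)
proof (induction M)
  case (add e M)
  have "V \<inter> e = e" using add.prems[of e] by auto
  then have "(\<Sum>v\<in>V. if v \<in> e then 1 else (0::nat)) = 2"
    using add.prems[of e] assms(1) by (simp add: sum.If_cases)
  then show ?case using add by (simp add: sum.distrib)
qed simp

lemma size_bmatching_le:
  assumes "finite V" "\<And>e. e \<in> E \<Longrightarrow> e \<subseteq> V \<and> card e = 2" "M \<in> bmatchings E c"
  shows "2 * size M \<le> (\<Sum>v\<in>V. c v)"
proof -
  have "2 * size M = (\<Sum>v\<in>V. deg M v)"
    using assms(2,3) by (intro sum_deg[OF assms(1), symmetric]) (auto simp: bmatchings_def)
  also have "\<dots> \<le> (\<Sum>v\<in>V. c v)"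
    using assms(3) by (intro sum_mono) (simp add: bmatchings_def)
  finally show ?thesis .
qed

lemma max_bmatchings_same_size:
  "M \<in> max_bmatchings E c \<Longrightarrow> N \<in> max_bmatchings E c \<Longrightarrow> size M = size N"
  by (simp add: max_bmatchings_def antisym)

lemma max_bmatchingsI:
  "M \<in> max_bmatchings E c \<Longrightarrow> N \<in> bmatchings E c \<Longrightarrow> size M \<le> size N \<Longrightarrow> N \<in> max_bmatchings E c"
  by (fastforce simp: max_bmatchings_def)

section \<open>Exponents of edge multisets and the generators of the bounded powers\<close>

definition edge_exponent :: "'a set \<Rightarrow> 'a \<Rightarrow>\<^sub>0 nat" where
  "edge_exponent e = (\<Sum>v\<in>e. Poly_Mapping.single v 1)"

definition exponent :: "'a set multiset \<Rightarrow> 'a \<Rightarrow>\<^sub>0 nat" where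
  "exponent M = (\<Sum>e\<in>#M. edge_exponent e)"

lemma lookup_edge_exponent:
  "finite e \<Longrightarrow> Poly_Mapping.lookup (edge_exponent e) v = (if v \<in> e then 1 else 0)"
  by (auto simp: edge_exponent_def lookup_sum lookup_single when_def)

lemma lookup_exponent:
  "(\<And>e. e \<in># M \<Longrightarrow> finite e) \<Longrightarrow> Poly_Mapping.lookup (exponent M) v = deg M v"
  unfolding exponent_def
  by (induction M) (simp_all add: lookup_add lookup_edge_exponent)

context
  fixes G :: "'a graph"
  assumes G: "simple_graph G"
begin

lemma edge_subset: "e \<in> edges G \<Longrightarrow> e \<subseteq> verts G"
  and edge_card: "e \<in> edges G \<Longrightarrow> card e = 2"
  and edge_finite: "e \<in> edges G \<Longrightarrow> finite e"
  and verts_finite: "finite (verts G)"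
  using G by (auto simp: simple_graph_def) (metis card.infinite zero_neq_numeral)

lemma lookup_exponent_edges:
  "set_mset M \<subseteq> edges G \<Longrightarrow> Poly_Mapping.lookup (exponent M) = deg M"
  using edge_finite by (intro ext lookup_exponent) auto

lemma deg_outside: "set_mset M \<subseteq> edges G \<Longrightarrow> v \<notin> verts G \<Longrightarrow> deg M v = 0"
  using deg_pos_iff[of M v] edge_subset by blast

lemma sum_deg_edges:
  assumes "set_mset M \<subseteq> edges G"
  shows "(\<Sum>v\<in>verts G. deg M v) = 2 * size M"
  using assms edge_subset edge_card by (intro sum_deg verts_finite) auto

lemma exponent_monomials:
  assumes "set_mset M \<subseteq> edges G"
  shows "exponent M \<in> monomials (verts G)"
proof -
  have "v \<in> verts G" if "v \<in> Poly_Mapping.keys (exponent M)" for v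
    using that deg_outside[OF assms, of v] by (auto simp: in_keys_iff lookup_exponent_edges[OF assms])
  then show ?thesis by (auto simp: monomials_def)
qed

lemma edge_ideal_monomial_ideal:
  "edge_ideal (K :: 'k::field itself) G = monomial_ideal (verts G) (edge_exponent ` edges G)"
proof -
  have *: "var u * var v = (mon (edge_exponent {u, v}) :: _ \<Rightarrow>\<^sub>0 'k)" if "{u, v} \<in> edges G" for u v :: 'a
  proof -
    have "u \<noteq> v" using edge_card[OF that] by auto
    then show ?thesis by (simp add: var_def mon_mult edge_exponent_def)
  qed
  have "{var u * var v | u v. {u, v} \<in> edges G} = (mon :: _ \<Rightarrow> _ \<Rightarrow>\<^sub>0 'k) ` edge_exponent ` edges G"
  proof (intro Set.set_eqI iffI)
    fix x :: "('a \<Rightarrow>\<^sub>0 nat) \<Rightarrow>\<^sub>0 'k"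
    assume "x \<in> mon ` edge_exponent ` edges G"
    then obtain e where e: "e \<in> edges G" "x = mon (edge_exponent e)" by auto
    then obtain u v where "e = {u, v}" using edge_card[OF e(1)] by (auto simp: card_2_iff)
    then show "x \<in> {var u * var v | u v. {u, v} \<in> edges G}"
      using e *[of u v] by (intro CollectI exI[of _ u] exI[of _ v]) simp
  next
    fix x :: "('a \<Rightarrow>\<^sub>0 nat) \<Rightarrow>\<^sub>0 'k"
    assume "x \<in> {var u * var v | u v. {u, v} \<in> edges G}"
    then obtain u v where "x = var u * var v" "{u, v} \<in> edges G" by blast
    then show "x \<in> mon ` edge_exponent ` edges G"
      unfolding *[OF \<open>{u, v} \<in> edges G\<close>] by blast
  qed
  moreover have "edge_exponent e \<in> monomials (verts G)" if "e \<in> edges G" for e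
    using exponent_monomials[of "{#e#}"] that by (simp add: exponent_def)
  then have "edge_exponent ` edges G \<subseteq> monomials (verts G)" by blast
  ultimately show ?thesis
    unfolding edge_ideal_def by (simp only: genideal_mon)
qed

lemma ideal_power_edge_ideal:
  "ideal_power K (verts G) (edge_ideal K G) q =
    monomial_ideal (verts G) {exponent M | M. set_mset M \<subseteq> edges G \<and> size M = q}"
proof (induction q)
  case 0
  have "{exponent M | M. set_mset M \<subseteq> edges G \<and> size M = 0} = {0}"
    by (auto simp: exponent_def)
  then show ?case
    by (simp add: ideal_power_def ideals_set_def monomial_ideal_one[of _ K])
next
  case (Suc q)
  let ?A = "\<lambda>q. {exponent M | M. set_mset M \<subseteq> edges G \<and> size M = q}"
  have 1: "?A q \<subseteq> monomials (verts G)" for q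
    using exponent_monomials by auto
  have 2: "edge_exponent ` edges G \<subseteq> monomials (verts G)"
  proof
    fix a assume "a \<in> edge_exponent ` edges G"
    then obtain e where "e \<in> edges G" "a = exponent {#e#}" by (auto simp: exponent_def)
    then show "a \<in> monomials (verts G)" using exponent_monomials[of "{#e#}"] by simp
  qed
  have "{a + b | a b. a \<in> ?A q \<and> b \<in> edge_exponent ` edges G} = ?A (Suc q)"
  proof (intro Set.set_eqI iffI)
    fix x assume "x \<in> {a + b | a b. a \<in> ?A q \<and> b \<in> edge_exponent ` edges G}"
    then obtain M e where "set_mset M \<subseteq> edges G" "size M = q" "e \<in> edges G"
      "x = exponent M + edge_exponent e" by auto
    then show "x \<in> ?A (Suc q)"
      by (intro CollectI exI[of _ "add_mset e M"]) (simp add: exponent_def add.commute)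
  next
    fix x assume "x \<in> ?A (Suc q)"
    then obtain N where N: "set_mset N \<subseteq> edges G" "size N = Suc q" "x = exponent N" by auto
    then obtain e M where eM: "N = add_mset e M" by (metis size_eq_Suc_imp_eq_union)
    have "x = exponent M + edge_exponent e" "set_mset M \<subseteq> edges G" "size M = q" "e \<in> edges G"
      using N eM by (auto simp: exponent_def add.commute)
    then show "x \<in> {a + b | a b. a \<in> ?A q \<and> b \<in> edge_exponent ` edges G}"
      by blast
  qed
  then show ?case
    using Suc ideal_prod_monomial_ideal[OF 1 2, of K]
    by (simp add: ideal_power_def ideals_set_def edge_ideal_monomial_ideal)
qed

lemma bounded_power:
  "bounded_ideal K (verts G) c (ideal_power K (verts G) (edge_ideal K G) q) =
    monomial_ideal (verts G) (exponent ` {M \<in> bmatchings (edges G) c. size M = q})"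
proof -
  let ?A = "{exponent M | M. set_mset M \<subseteq> edges G \<and> size M = q}"
  have "?A \<subseteq> monomials (verts G)" using exponent_monomials by auto
  moreover have "{b \<in> ?A. \<forall>v\<in>verts G. Poly_Mapping.lookup b v \<le> c v} =
    exponent ` {M \<in> bmatchings (edges G) c. size M = q}"
  proof -
    have "deg M v \<le> c v" if "set_mset M \<subseteq> edges G" "\<forall>v\<in>verts G. deg M v \<le> c v" for M v
      using that deg_outside[of M v] by (cases "v \<in> verts G") auto
    then show ?thesis
      by (auto simp: bmatchings_def lookup_exponent_edges image_iff)
  qed
  ultimately show ?thesis
    by (simp add: ideal_power_edge_ideal bounded_ideal_monomial_ideal)
qed

lemma max_bmatchings_nonempty: "max_bmatchings (edges G) c \<noteq> {}"
proof -
  have "{#} \<in> bmatchings (edges G) c" by (simp add: bmatchings_def)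
  moreover have "size M \<le> (\<Sum>v\<in>verts G. c v)" if "M \<in> bmatchings (edges G) c" for M
    using size_bmatching_le[OF verts_finite _ that] edge_subset edge_card by fastforce
  ultimately have "\<exists>M. M \<in> bmatchings (edges G) c \<and> (\<forall>N. N \<in> bmatchings (edges G) c \<longrightarrow> size N \<le> size M)"
    by (intro ex_has_greatest_nat[where b = "Suc (\<Sum>v\<in>verts G. c v)"]) (auto simp: less_Suc_eq_le)
  then show ?thesis by (auto simp: max_bmatchings_def)
qed

text \<open>Edge multisets of one size have exponents of one total degree, so none properly divides
  another and the generators of the top bounded power are already minimal.\<close>

lemma W_gens_max_degrees:
  "W_gens (K :: 'k::field itself) c G = {a. Poly_Mapping.lookup a \<in> max_degrees (edges G) c}"
proof -
  let ?B = "\<lambda>q. {M \<in> bmatchings (edges G) c. size M = q}"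
  obtain M0 where M0: "M0 \<in> max_bmatchings (edges G) c"
    using max_bmatchings_nonempty by blast
  have sub: "exponent ` ?B q \<subseteq> monomials (verts G)" for q
    using exponent_monomials by (auto simp: bmatchings_def)
  have "delta_bound K (verts G) c (edge_ideal K G) = (GREATEST q. ?B q \<noteq> {})"
    by (simp add: delta_bound_def bounded_power monomial_ideal_nonzero[OF sub])
  also have "\<dots> = size M0"
  proof (rule Greatest_equality)
    show "?B (size M0) \<noteq> {}" using M0 by (auto simp: max_bmatchings_def)
  qed (use M0 in \<open>auto simp: max_bmatchings_def\<close>)
  finally have "W_gens K c G = minimal_monomial_generators K (verts G)
      (monomial_ideal (verts G) (exponent ` ?B (size M0)))"
    by (simp add: W_gens_def Let_def bounded_power)
  also have "\<dots> = exponent ` ?B (size M0)"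
  proof (rule minimal_monomial_generators_equigenerated[OF sub])
    fix a d assume "a \<in> exponent ` ?B (size M0)" "a + d \<in> exponent ` ?B (size M0)"
    then obtain M N where MN: "M \<in> ?B (size M0)" "N \<in> ?B (size M0)" "a = exponent M" "a + d = exponent N"
      by auto
    then have sub: "set_mset M \<subseteq> edges G" "set_mset N \<subseteq> edges G"
      by (simp_all add: bmatchings_def)
    have eq: "deg N v = deg M v + Poly_Mapping.lookup d v" for v
      unfolding lookup_exponent_edges[symmetric, OF sub(1)] lookup_exponent_edges[symmetric, OF sub(2)]
        MN(3,4)[symmetric] by (rule lookup_add)
    have "(\<Sum>v\<in>verts G. deg N v) = 2 * size M0" "(\<Sum>v\<in>verts G. deg M v) = 2 * size M0"
      using MN(1,2) sum_deg_edges[OF sub(1)] sum_deg_edges[OF sub(2)] by simp_all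
    then have "(\<Sum>v\<in>verts G. Poly_Mapping.lookup d v) = 0"
      by (simp add: eq sum.distrib)
    then have "Poly_Mapping.lookup d v = 0" for v
      using verts_finite deg_outside[OF sub(2), of v] eq[of v]
      by (cases "v \<in> verts G") auto
    then show "d = 0" by (intro poly_mapping_eqI) simp
  qed
  also have "?B (size M0) = max_bmatchings (edges G) c"
  proof (intro subset_antisym subsetI)
    fix M assume "M \<in> ?B (size M0)"
    then show "M \<in> max_bmatchings (edges G) c" by (intro max_bmatchingsI[OF M0]) auto
  next
    fix M assume M: "M \<in> max_bmatchings (edges G) c"
    then show "M \<in> ?B (size M0)"
      using max_bmatchings_same_size[OF M0 M] by (simp add: max_bmatchings_def)
  qed
  also have "exponent ` max_bmatchings (edges G) c = {a. Poly_Mapping.lookup a \<in> max_degrees (edges G) c}"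
  proof -
    have look: "Poly_Mapping.lookup (exponent M) = deg M" if "M \<in> max_bmatchings (edges G) c" for M
      using that by (intro lookup_exponent_edges) (simp add: max_bmatchings_def bmatchings_def)
    show ?thesis
    proof (intro Set.set_eqI iffI)
      fix a assume "a \<in> {a. Poly_Mapping.lookup a \<in> max_degrees (edges G) c}"
      then obtain M where M: "M \<in> max_bmatchings (edges G) c" "Poly_Mapping.lookup a = deg M"
        unfolding max_degrees_def by blast
      then have "a = exponent M"
        using look[OF M(1)] by (intro poly_mapping_eqI) simp
      then show "a \<in> exponent ` max_bmatchings (edges G) c" using M(1) by (rule image_eqI)
    next
      fix a assume "a \<in> exponent ` max_bmatchings (edges G) c"
      then show "a \<in> {a. Poly_Mapping.lookup a \<in> max_degrees (edges G) c}"
        using look by (auto simp: max_degrees_def)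
    qed
  qed
  finally show ?thesis .
qed

end

section \<open>Strong exchange as a property of degree vectors\<close>

text \<open>Meant for distinct \<open>x\<close> and \<open>y\<close> with \<open>w x\<close>
  positive; the exchange hypotheses \<open>w' x < w x\<close> and \<open>w y < w' y\<close> force
  both.\<close>

definition shift :: "('a \<Rightarrow> nat) \<Rightarrow> 'a \<Rightarrow> 'a \<Rightarrow> 'a \<Rightarrow> nat" where
  "shift w x y = w(x := w x - 1, y := w y + 1)"

definition exchange_closed :: "('a \<Rightarrow> nat) set \<Rightarrow> bool" where
  "exchange_closed W \<longleftrightarrow>
    (\<forall>w\<in>W. \<forall>w'\<in>W. \<forall>x y. w' x < w x \<longrightarrow> w y < w' y \<longrightarrow> shift w x y \<in> W)"

lemma max_degrees_outside:
  "simple_graph G \<Longrightarrow> w \<in> max_degrees (edges G) c \<Longrightarrow> v \<notin> verts G \<Longrightarrow> w v = 0"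
  unfolding max_degrees_def max_bmatchings_def bmatchings_def by (auto dest: deg_outside)

lemma strong_exchange_iff:
  fixes K :: "'k::field itself"
  assumes G: "simple_graph G"
  shows "strong_exchange (verts G) (W_gens K c G) \<longleftrightarrow> exchange_closed (max_degrees (edges G) c)"
proof -
  let ?W = "max_degrees (edges G) c"
  have lift: "\<exists>a. Poly_Mapping.lookup a = w" if "w \<in> ?W" for w
  proof -
    have "{v. w v \<noteq> 0} \<subseteq> verts G" using max_degrees_outside[OF G that] by (metis (mono_tags) mem_Collect_eq subsetI)
    then have "finite {v. w v \<noteq> 0}" using verts_finite[OF G] by (rule finite_subset)
    then have "Poly_Mapping.lookup (Poly_Mapping.Abs_poly_mapping w) = w"
      by (intro Abs_poly_mapping_inverse CollectI)
    then show ?thesis ..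
  qed
  have look: "Poly_Mapping.lookup (Poly_Mapping.single y 1 + (a - Poly_Mapping.single x 1)) =
      shift (Poly_Mapping.lookup a) x y" if "x \<noteq> y" for a :: "'a \<Rightarrow>\<^sub>0 nat" and x y
    using that by (auto simp: fun_eq_iff lookup_add lookup_minus lookup_single shift_def when_def)
  show ?thesis
  proof
    assume S: "strong_exchange (verts G) (W_gens K c G)"
    show "exchange_closed ?W"
      unfolding exchange_closed_def
    proof (intro ballI allI impI)
      fix w w' x y assume w: "w \<in> ?W" "w' \<in> ?W" and less: "w' x < w x" "w y < w' y"
      obtain a where a: "Poly_Mapping.lookup a = w" using lift[OF w(1)] ..
      obtain b where b: "Poly_Mapping.lookup b = w'" using lift[OF w(2)] ..
      note ab = a b
      have "x \<in> verts G" using max_degrees_outside[OF G w(1), of x] less(1) by (cases "x \<in> verts G") simp_all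
      moreover have "y \<in> verts G" using max_degrees_outside[OF G w(2), of y] less(2) by (cases "y \<in> verts G") simp_all
      moreover have "a \<in> W_gens K c G" "b \<in> W_gens K c G"
        using ab w by (simp_all add: W_gens_max_degrees[OF G])
      ultimately have "Poly_Mapping.single y 1 + (a - Poly_Mapping.single x 1) \<in> W_gens K c G"
        using S less unfolding strong_exchange_def ab[symmetric] by blast
      moreover have "x \<noteq> y" using less by auto
      ultimately show "shift w x y \<in> ?W"
        unfolding W_gens_max_degrees[OF G] mem_Collect_eq by (simp only: look ab not_False_eq_True)
    qed
  next
    assume E: "exchange_closed ?W"
    show "strong_exchange (verts G) (W_gens K c G)"
      unfolding strong_exchange_def
    proof (intro ballI impI)
      fix a b x y
      assume ab: "a \<in> W_gens K c G" "b \<in> W_gens K c G"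
        and less: "Poly_Mapping.lookup b x < Poly_Mapping.lookup a x"
          "Poly_Mapping.lookup a y < Poly_Mapping.lookup b y"
      have "x \<noteq> y" using less by auto
      have "shift (Poly_Mapping.lookup a) x y \<in> ?W"
        using E[unfolded exchange_closed_def, rule_format, OF _ _ less] ab
        unfolding W_gens_max_degrees[OF G] mem_Collect_eq by simp
      then show "Poly_Mapping.single y 1 + (a - Poly_Mapping.single x 1) \<in> W_gens K c G"
        unfolding W_gens_max_degrees[OF G] mem_Collect_eq look[OF \<open>x \<noteq> y\<close>] .
    qed
  qed
qed

lemma enjoys_strong_exchange_iff:
  "simple_graph G \<Longrightarrow> enjoys_strong_exchange TYPE('k::field) G \<longleftrightarrow>
    (\<forall>c. (\<forall>v\<in>verts G. 0 < c v) \<longrightarrow> exchange_closed (max_degrees (edges G) c))"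
  by (simp add: enjoys_strong_exchange_def strong_exchange_iff)

section \<open>The exchange property\<close>

text \<open>
  The trail is grown one edge at a time, with the roles of \<open>A\<close> and \<open>B\<close> swapped after each edge.  It
  ends either in a vertex of the same kind as \<open>x\<close>, or in one of the opposite kind.
\<close>

lemma alternating_trail:
  fixes A B :: "'a set multiset"
  assumes "\<And>e. e \<in># A + B \<Longrightarrow> card e = 2" and "deg B x < deg A x"
  shows "\<exists>X Y. X \<subseteq># A \<and> Y \<subseteq># B \<and>
    ((size X = size Y + 1 \<and> (\<exists>y. deg B y < deg A y \<and> (y = x \<longrightarrow> deg B x + 2 \<le> deg A x)
        \<and> (\<forall>v. deg X v = deg Y v + of_bool (v = x) + of_bool (v = y)))) \<or>
     (size X = size Y \<and> (\<exists>y. deg A y < deg B y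
        \<and> (\<forall>v. deg X v + of_bool (v = y) = deg Y v + of_bool (v = x)))))"
  using assms
proof (induction "size A + size B" arbitrary: A B x rule: less_induct)
  case less
  have "0 < deg A x" using less.prems(2) by simp
  then obtain e where e: "e \<in># A" "x \<in> e" unfolding deg_pos_iff by blast
  then have "card e = 2" using less.prems(1) by auto
  then obtain y where y: "e = {x, y}" "y \<noteq> x"
    using e(2) unfolding card_2_iff by fastforce
  define A1 where "A1 = A - {#e#}"
  have A: "A = add_mset e A1" using e(1) by (simp add: A1_def)
  have dA: "deg A v = deg A1 v + of_bool (v = x) + of_bool (v = y)" for v
    using y by (auto simp: A)
  show ?case
  proof (cases "deg B y < deg A y")
    case True
    \<comment> \<open>The trail may stop after the single edge \<open>e\<close>, since
      \<open>y\<close> has a surplus in \<open>A\<close> as well.\<close>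
    have "{#e#} \<subseteq># A" "{#} \<subseteq># B" "size {#e#} = size ({#} :: 'a set multiset) + 1" using e(1) by auto
    moreover have "deg {#e#} v = deg {#} v + of_bool (v = x) + of_bool (v = y)" for v
      using y by auto
    ultimately show ?thesis using True y(2) by blast
  next
    case False
    \<comment> \<open>Without \<open>e\<close>, \<open>y\<close> has a surplus in \<open>B\<close>.
      The trail continues from \<open>y\<close> with the two multisets swapped, and \<open>e\<close>
      is put in front of what it returns.\<close>
    then have "deg A1 y < deg B y" using dA[of y] by simp
    moreover have "size B + size A1 < size A + size B" by (simp add: A)
    moreover have "card f = 2" if "f \<in># B + A1" for f
      using that less.prems(1) by (auto simp: A)
    ultimately obtain X Y where XY: "X \<subseteq># B" "Y \<subseteq># A1" and
      cases: "(size X = size Y + 1 \<and> (\<exists>z. deg A1 z < deg B z \<and> (z = y \<longrightarrow> deg A1 y + 2 \<le> deg B y)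
        \<and> (\<forall>v. deg X v = deg Y v + of_bool (v = y) + of_bool (v = z)))) \<or>
       (size X = size Y \<and> (\<exists>z. deg B z < deg A1 z
        \<and> (\<forall>v. deg X v + of_bool (v = z) = deg Y v + of_bool (v = y))))"
      using less.hyps[of B A1 y] by blast
    have sub: "add_mset e Y \<subseteq># A" using XY(2) by (simp add: A)
    have de: "deg (add_mset e Y) v = deg Y v + of_bool (v = x) + of_bool (v = y)" for v
      using y by auto
    from cases show ?thesis
    proof (elim disjE conjE exE)
      fix z assume z: "size X = size Y + 1" "deg A1 z < deg B z" "z = y \<longrightarrow> deg A1 y + 2 \<le> deg B y"
        and eq: "\<forall>v. deg X v = deg Y v + of_bool (v = y) + of_bool (v = z)"
      \<comment> \<open>If \<open>z = y\<close>, the surplus of two at \<open>y\<close> pays for the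
        degree that \<open>e\<close> contributes there; \<open>z = x\<close> is impossible because
        \<open>x\<close> has a surplus in \<open>A\<close>.\<close>
      have "deg A z < deg B z" using z(2,3) dA[of z] dA[of x] less.prems(2) y(2)
        by (cases "z = x"; cases "z = y") auto
      moreover have "size (add_mset e Y) = size X" using z by simp
      moreover have "deg (add_mset e Y) v + of_bool (v = z) = deg X v + of_bool (v = x)" for v
        using eq de by simp
      ultimately show ?thesis using sub XY(1) by blast
    next
      fix z assume z: "size X = size Y" "deg B z < deg A1 z"
        and eq: "\<forall>v. deg X v + of_bool (v = z) = deg Y v + of_bool (v = y)"
      \<comment> \<open>Returning to \<open>x\<close> leaves a surplus in \<open>A1\<close>, hence a
        surplus of at least two in \<open>A\<close>.\<close>
      have "deg B z < deg A z" "z = x \<longrightarrow> deg B x + 2 \<le> deg A x" using z(2) dA[of z] dA[of x] by auto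
      moreover have "size (add_mset e Y) = size X + 1" using z by simp
      moreover have "deg (add_mset e Y) v = deg X v + of_bool (v = x) + of_bool (v = z)" for v
        using eq[rule_format, of v] de[of v] by simp
      ultimately show ?thesis using sub XY(1) by blast
    qed
  qed
qed

lemma bmatchings_replace:
  assumes "M \<in> bmatchings E c" "X \<subseteq># M" "set_mset Y \<subseteq> E"
    "\<And>v. deg M v + deg Y v \<le> c v + deg X v"
  shows "M - X + Y \<in> bmatchings E c"
  unfolding bmatchings_def
proof (intro CollectI conjI allI)
  show "set_mset (M - X + Y) \<subseteq> E"
    using assms(1,3) in_diffD[of _ M X] by (auto simp: bmatchings_def)
  show "deg (M - X + Y) v \<le> c v" for v
    using assms(4)[of v] deg_mono[OF assms(2), of v] by (simp add: deg_diff[OF assms(2)])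
qed

lemma max_degrees_replace:
  assumes M: "M \<in> max_bmatchings E c" and X: "X \<subseteq># M" and Y: "set_mset Y \<subseteq> E"
    and le: "\<And>v. deg M v + deg Y v \<le> c v + deg X v"
  shows "size Y \<le> size X"
    and "size Y = size X \<Longrightarrow> (\<lambda>v. deg M v + deg Y v - deg X v) \<in> max_degrees E c"
proof -
  have N: "M - X + Y \<in> bmatchings E c"
    using M X Y le by (intro bmatchings_replace) (auto simp: max_bmatchings_def)
  have size: "size (M - X + Y) + size X = size M + size Y"
    using size_mset_mono[OF X] by (simp add: size_Diff_submset[OF X])
  have "size (M - X + Y) \<le> size M" using M N unfolding max_bmatchings_def by blast
  then show "size Y \<le> size X" using size by linarith
  assume "size Y = size X"
  then have "M - X + Y \<in> max_bmatchings E c" using size by (intro max_bmatchingsI[OF M N]) simp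
  moreover have "deg (M - X + Y) = (\<lambda>v. deg M v + deg Y v - deg X v)"
    using deg_mono[OF X] by (simp add: deg_diff[OF X] fun_eq_iff)
  ultimately show "(\<lambda>v. deg M v + deg Y v - deg X v) \<in> max_degrees E c"
    unfolding max_degrees_def by (metis imageI)
qed

text \<open>The simultaneous exchange axiom of M-convex sets: one \<open>y\<close> serves both
  vectors.\<close>

definition mconvex :: "('a \<Rightarrow> nat) set \<Rightarrow> bool" where
  "mconvex W \<longleftrightarrow> (\<forall>w\<in>W. \<forall>w'\<in>W. \<forall>x. w' x < w x \<longrightarrow>
    (\<exists>y. w y < w' y \<and> shift w x y \<in> W \<and> shift w' y x \<in> W))"

text \<open>Both multisets are changed along an alternating trail that starts at \<open>x\<close>.
  Maximality rules out one type of end, and the other type provides \<open>y\<close>.\<close>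

lemma mconvex_max_degrees:
  assumes E: "\<And>e. e \<in> E \<Longrightarrow> card e = 2"
  shows "mconvex (max_degrees E c)"
  unfolding mconvex_def
proof (intro ballI allI impI)
  fix w w' x assume "w \<in> max_degrees E c" "w' \<in> max_degrees E c" and less: "w' x < w x"
  then obtain M M' where M: "M \<in> max_bmatchings E c" "w = deg M"
    and M': "M' \<in> max_bmatchings E c" "w' = deg M'" by (auto simp: max_degrees_def)
  have cM: "deg M v \<le> c v" and cM': "deg M' v \<le> c v" for v
    using M M' by (simp_all add: max_bmatchings_def bmatchings_def)
  have sub: "set_mset M \<subseteq> E" "set_mset M' \<subseteq> E"
    using M M' by (simp_all add: max_bmatchings_def bmatchings_def)
  then have "card e = 2" if "e \<in># M + M'" for e using that E by auto
  from alternating_trail[of M M' x, OF this] less obtain X Y where XY: "X \<subseteq># M" "Y \<subseteq># M'" and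
    cases: "(size X = size Y + 1 \<and> (\<exists>y. deg M' y < deg M y \<and> (y = x \<longrightarrow> deg M' x + 2 \<le> deg M x)
        \<and> (\<forall>v. deg X v = deg Y v + of_bool (v = x) + of_bool (v = y)))) \<or>
     (size X = size Y \<and> (\<exists>y. deg M y < deg M' y
        \<and> (\<forall>v. deg X v + of_bool (v = y) = deg Y v + of_bool (v = x))))"
    unfolding M M' by blast
  have subXY: "set_mset X \<subseteq> E" "set_mset Y \<subseteq> E" using XY sub by (auto dest: mset_subset_eqD)
  from cases show "\<exists>y. w y < w' y \<and> shift w x y \<in> max_degrees E c \<and> shift w' y x \<in> max_degrees E c"
  proof (elim disjE conjE exE)
    fix y assume y: "size X = size Y + 1" "deg M' y < deg M y" "y = x \<longrightarrow> deg M' x + 2 \<le> deg M x"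
      and eq: "\<forall>v. deg X v = deg Y v + of_bool (v = x) + of_bool (v = y)"
    \<comment> \<open>Putting \<open>X\<close> in place of \<open>Y\<close> in \<open>M'\<close>
      respects the capacities, because \<open>M'\<close> has less degree than \<open>M\<close> at
      both ends, but it would enlarge a maximum.\<close>
    have "deg M' v + deg X v \<le> c v + deg Y v" for v
      using eq[rule_format, of v] y cM[of v] cM'[of v] less M M'
      by (cases "v = x"; cases "v = y") auto
    from max_degrees_replace(1)[OF M'(1) XY(2) subXY(1) this] y(1) show ?thesis by simp
  next
    fix y assume y: "size X = size Y" "deg M y < deg M' y"
      and eq: "\<forall>v. deg X v + of_bool (v = y) = deg Y v + of_bool (v = x)"
    have ne: "x \<noteq> y" using less y M M' by auto
    have "deg M' v + deg X v \<le> c v + deg Y v" for v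
      using eq[rule_format, of v] y cM[of v] cM'[of v] less M M'
      by (cases "v = x"; cases "v = y") auto
    from max_degrees_replace(2)[OF M'(1) XY(2) subXY(1) this y(1)]
    have "(\<lambda>v. deg M' v + deg X v - deg Y v) \<in> max_degrees E c" .
    moreover have "(\<lambda>v. deg M' v + deg X v - deg Y v) = shift w' y x"
    proof
      fix v show "deg M' v + deg X v - deg Y v = shift w' y x v"
        using eq[rule_format, of v] y M' ne by (cases "v = x"; cases "v = y") (auto simp: shift_def)
    qed
    moreover have "deg M v + deg Y v \<le> c v + deg X v" for v
      using eq[rule_format, of v] y cM[of v] cM'[of v] less M M'
      by (cases "v = x"; cases "v = y") auto
    from max_degrees_replace(2)[OF M(1) XY(1) subXY(2) this y(1)[symmetric]]
    have "(\<lambda>v. deg M v + deg Y v - deg X v) \<in> max_degrees E c" .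
    moreover have "(\<lambda>v. deg M v + deg Y v - deg X v) = shift w x y"
    proof
      fix v show "deg M v + deg Y v - deg X v = shift w x y v"
        using eq[rule_format, of v] less M M' ne by (cases "v = x"; cases "v = y") (auto simp: shift_def)
    qed
    ultimately show ?thesis using y(2) M M' by metis
  qed
qed

section \<open>From a failure of exchange to a bad square\<close>

definition plus2 :: "('a \<Rightarrow> nat) \<Rightarrow> 'a \<Rightarrow> 'a \<Rightarrow> 'a \<Rightarrow> nat" where
  "plus2 m p q = (\<lambda>v. m v + of_bool (v = p) + of_bool (v = q))"

text \<open>The four pairs in \<open>W\<close> are the sides of the four-cycle
  \<open>p, q, s, r\<close>, and the missing pair is the diagonal \<open>q, r\<close>. The other
  diagonal is left open.\<close>

definition bad_square :: "('a \<Rightarrow> nat) set \<Rightarrow> ('a \<Rightarrow> nat) \<Rightarrow> 'a \<Rightarrow> 'a \<Rightarrow> 'a \<Rightarrow> 'a \<Rightarrow> bool" where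
  "bad_square W m p q r s \<longleftrightarrow> distinct [p, q, r, s] \<and> plus2 m p q \<in> W \<and> plus2 m r s \<in> W
    \<and> plus2 m p r \<in> W \<and> plus2 m q s \<in> W \<and> plus2 m q r \<notin> W"

lemma sum_eq_two:
  fixes f :: "'a \<Rightarrow> nat"
  assumes "finite V" "sum f V = 2" "a \<in> V" "b \<in> V" "a \<noteq> b" "0 < f a" "0 < f b" "v \<in> V"
  shows "f v = of_bool (v = a) + of_bool (v = b)"
proof -
  have "sum f V = f a + (f b + sum f (V - {a} - {b}))"
    using assms by (simp add: sum.remove[of V a] sum.remove[of "V - {a}" b])
  then have *: "f a = 1" "f b = 1" "sum f (V - {a} - {b}) = 0" using assms by linarith+
  then show ?thesis using assms by (cases "v = a"; cases "v = b") auto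
qed

text \<open>Descent on the distance from \<open>w'\<close> to \<open>w\<close>, with
  \<open>w\<close>, \<open>x\<close>, \<open>y\<close> fixed. At distance two, \<open>w\<close> and
  \<open>w'\<close> are opposite sides of a square; at larger distance, \<open>w'\<close> can be
  moved towards \<open>w\<close> without losing the failure.\<close>

lemma bad_square_exists:
  fixes W :: "('a \<Rightarrow> nat) set"
  assumes mc: "mconvex W" and V: "finite V" and supp: "\<And>w v. w \<in> W \<Longrightarrow> v \<notin> V \<Longrightarrow> w v = 0"
    and sum: "\<And>w w'. w \<in> W \<Longrightarrow> w' \<in> W \<Longrightarrow> sum w V = sum w' V"
    and ex: "w \<in> W" "w' \<in> W" "w' x < w x" "w y < w' y" "shift w x y \<notin> W"
  shows "\<exists>m p q r s. bad_square W m p q r s"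
  using ex
proof (induction "\<Sum>v\<in>V. w v - w' v" arbitrary: w' rule: less_induct)
  case (less w')
  let ?D = "\<lambda>w'. \<Sum>v\<in>V. w v - w' v"
  note w = \<open>w \<in> W\<close> and w' = \<open>w' \<in> W\<close> and x = \<open>w' x < w x\<close> and y = \<open>w y < w' y\<close>
  have inV: "v \<in> V" if "0 < u v" "u \<in> W" for u v
    using supp[of u v] that by auto
  have exch: "\<exists>b. u b < u' b \<and> shift u a b \<in> W \<and> shift u' b a \<in> W" if "u \<in> W" "u' \<in> W" "u' a < u a" for u u' a
    using mc that unfolding mconvex_def by blast
  have pos: "a \<in> V" if "w' a < w a" for a
    using inV[of w a] that w by simp
  \<comment> \<open>Moving a unit of \<open>w'\<close> from \<open>b\<close> to \<open>a\<close>
    preserves the failing instance as long as it does not use up the gap at \<open>x\<close> or at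
    \<open>y\<close>.\<close>
  have closer: ?case if a: "w' a < w a" "a = x \<Longrightarrow> w' x + 2 \<le> w x"
    and b: "w b < w' b" "b = y \<Longrightarrow> w y + 2 \<le> w' y" and u: "shift w' b a \<in> W" for a b
  proof (rule less.hyps[OF _ w u _ _ less.prems(5)])
    have ne: "a \<noteq> b" "a \<noteq> y" "b \<noteq> x" using a b x y by auto
    show "shift w' b a x < w x" "w y < shift w' b a y"
      using a b x y ne by (cases "a = x"; cases "b = y"; force simp: shift_def)+
    show "?D (shift w' b a) < ?D w'"
    proof (rule sum_strict_mono_ex1[OF V])
      show "\<forall>v\<in>V. w v - shift w' b a v \<le> w v - w' v" using a b ne by (auto simp: shift_def)
      show "\<exists>v\<in>V. w v - shift w' b a v < w v - w' v"
        using a b ne pos[OF a(1)] by (intro bexI[of _ a]) (auto simp: shift_def)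
    qed
  qed
  obtain z where z: "w z < w' z" "shift w x z \<in> W" "shift w' z x \<in> W"
    using exch[OF w w' x] by blast
  \<comment> \<open>With \<open>z = y\<close> the failing shift would lie in \<open>W\<close>; the
    same argument gives that \<open>h\<close> differs from \<open>x\<close>.\<close>
  have zy: "z \<noteq> y" using z(2) less.prems(5) by auto
  obtain h where h: "w' h < w h" "shift w' y h \<in> W" "shift w h y \<in> W"
    using exch[OF w' w y] by blast
  have hx: "h \<noteq> x" using h(3) less.prems(5) by auto
  show ?case
  proof (cases "?D w' \<le> 2")
    case True
    have "?D w' = (w x - w' x) + ((w h - w' h) + (\<Sum>v\<in>V - {x} - {h}. w v - w' v))"
      using V pos[OF x] pos[OF h(1)] hx by (simp add: sum.remove[of V x] sum.remove[of "V - {x}" h])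
    with True x h(1) have D2: "?D w' = 2" by linarith
    have "(\<Sum>v\<in>V. w v + (w' v - w v)) = (\<Sum>v\<in>V. w' v + (w v - w' v))"
      by (intro sum.cong) auto
    then have D2': "(\<Sum>v\<in>V. w' v - w v) = 2"
      using sum[OF w w'] D2 by (simp add: sum.distrib)
    have 1: "w v - w' v = of_bool (v = x) + of_bool (v = h)" for v
    proof (cases "v \<in> V")
      case True
      show ?thesis
        by (rule sum_eq_two[OF V D2 pos[OF x] pos[OF h(1)] hx[symmetric] _ _ True]) (use x h(1) in auto)
    qed (use supp[OF w] supp[OF w'] pos[OF x] pos[OF h(1)] in auto)
    have yz: "y \<in> V" "z \<in> V" using inV[of w' y] inV[of w' z] y z(1) w' by auto
    have 2: "w' v - w v = of_bool (v = y) + of_bool (v = z)" for v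
    proof (cases "v \<in> V")
      case True
      show ?thesis
        by (rule sum_eq_two[OF V D2' yz zy[symmetric] _ _ True]) (use y z(1) in auto)
    qed (use supp[OF w] supp[OF w'] yz in auto)
    \<comment> \<open>The differences are now pinned down: \<open>w\<close> exceeds
      \<open>w'\<close> by one at \<open>x\<close> and at \<open>h\<close>, and \<open>w'\<close>
      exceeds \<open>w\<close> by one at \<open>y\<close> and at \<open>z\<close>. The common part
      is the base of the square.\<close>
    define m where "m v = min (w v) (w' v)" for v
    have ne: "x \<noteq> y" "x \<noteq> z" "h \<noteq> y" "h \<noteq> z" using x y h(1) z(1) by auto
    have w_eq: "w v = m v + of_bool (v = x) + of_bool (v = h)" for v
      using 1[of v] unfolding m_def by (simp split: if_splits)
    have w'_eq: "w' v = m v + of_bool (v = y) + of_bool (v = z)" for v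
      using 2[of v] unfolding m_def by (simp split: if_splits)
    have "plus2 m x h = w" "plus2 m y z = w'"
      by (simp_all add: plus2_def fun_eq_iff w_eq w'_eq)
    moreover have "plus2 m x y = shift w h y" "plus2 m h z = shift w x z" "plus2 m h y = shift w x y"
      using ne hx by (auto simp: plus2_def fun_eq_iff shift_def w_eq)
    ultimately have "bad_square W m x h y z"
      using ne hx zy w w' z h less.prems(5) by (simp add: bad_square_def)
    then show ?thesis by blast
  next
    case False
    show ?thesis
    proof (cases "w' x + 2 \<le> w x \<or> w y + 2 \<le> w' y")
      case True
      then show ?thesis
        using closer[OF x _ z(1) _ z(3)] closer[OF h(1) _ y _ h(2)] zy hx by blast
    next
      case one: False
      \<comment> \<open>The gaps at \<open>x\<close> and \<open>y\<close> are exactly one, so a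
        distance above two leaves a surplus of \<open>w\<close> at some other \<open>g\<close>; the
        vertex \<open>h\<close> counts only if its gap is at least two.\<close>
      have "\<exists>g\<in>V. g \<noteq> x \<and> w' g + of_bool (g = h) < w g"
      proof (rule ccontr)
        assume "\<not> ?thesis"
        then have "w v - w' v \<le> of_bool (v = x) + of_bool (v = h)" if "v \<in> V" for v
          using that one by (cases "v = x") force+
        then have "?D w' \<le> (\<Sum>v\<in>V. of_bool (v = x) + of_bool (v = h))" by (rule sum_mono)
        also have "\<dots> \<le> 2" using V by (simp add: sum.distrib of_bool_def)
        finally show False using False by simp
      qed
      then obtain g where g: "g \<in> V" "g \<noteq> x" "w' g + of_bool (g = h) < w g" by blast
      \<comment> \<open>\<open>u\<close> agrees with \<open>w\<close> at \<open>y\<close>, so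
        exchanging it at \<open>g\<close> involves some \<open>t\<close> other than
        \<open>y\<close>. Comparing the result with \<open>w'\<close> at \<open>t\<close> turns this
        into a move of \<open>w'\<close> itself, from \<open>t\<close> into \<open>g\<close> or
        \<open>h\<close>.\<close>
      define u where "u = shift w' y h"
      have yh: "y \<noteq> h" using y h(1) by auto
      have "u g < w g" using g y h(1) by (cases "g = h"; cases "g = y") (auto simp: u_def shift_def)
      from exch[OF w h(2)[folded u_def] this] obtain t where
        t: "w t < u t" "shift u t g \<in> W" by blast
      have "t \<noteq> y" "t \<noteq> h" using t(1) one y h(1) yh by (auto simp: u_def shift_def)
      then have t': "w t < w' t" "u t = w' t" using t(1) by (simp_all add: u_def shift_def)
      have tg: "t \<noteq> g" using t' g by auto
      have "shift u t g t < w' t" using t' tg by (auto simp: shift_def)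
      from exch[OF w' t(2) this] obtain e where e: "w' e < shift u t g e" "shift w' t e \<in> W"
        by blast
      have "e = g \<or> e = h"
        using e(1) by (auto simp: shift_def u_def split: if_splits)
      then have "w' e < w e" "e \<noteq> x" using g h hx by auto
      then show ?thesis using closer[OF _ _ t'(1) _ e(2)] \<open>t \<noteq> y\<close> by blast
    qed
  qed
qed

section \<open>Obstructions to strong exchange\<close>

lemma sum_deg_card:
  assumes "finite T"
  shows "(\<Sum>v\<in>T. deg M v) = (\<Sum>e\<in>#M. card (e \<inter> T))"
proof (induction M)
  case (add e M)
  have "(\<Sum>v\<in>T. if v \<in> e then 1 else (0::nat)) = card (e \<inter> T)"
    using assms by (simp add: sum.If_cases Int_commute)
  then show ?case using add by (simp add: sum.distrib)
qed simp

lemma sum_deg_le: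
  assumes "finite S" "finite T" "\<And>e. e \<in># M \<Longrightarrow> card (e \<inter> S) \<le> card (e \<inter> T)"
  shows "(\<Sum>v\<in>S. deg M v) \<le> (\<Sum>v\<in>T. deg M v)"
  unfolding sum_deg_card[OF assms(1)] sum_deg_card[OF assms(2)]
  using assms(3) by (intro sum_mset_mono) auto

lemma size_le_sum_deg:
  assumes "finite A" "\<And>e. e \<in># M \<Longrightarrow> e \<inter> A \<noteq> {}"
  shows "size M \<le> (\<Sum>v\<in>A. deg M v)"
proof -
  have "1 \<le> card (e \<inter> A)" if "e \<in># M" for e
    using assms(2)[OF that] assms(1) by (simp add: Suc_le_eq card_gt_0_iff)
  then have "(\<Sum>e\<in>#M. 1) \<le> (\<Sum>e\<in>#M. card (e \<inter> A))" by (intro sum_mset_mono) auto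
  then show ?thesis by (simp add: sum_deg_card[OF assms(1)])
qed

lemma bmatchingsD:
  assumes "M \<in> bmatchings E c"
  shows "e \<in># M \<Longrightarrow> e \<in> E" "deg M v \<le> c v"
  using assms by (auto simp: bmatchings_def)

lemma deg_image_mset_set:
  "finite A \<Longrightarrow> deg (image_mset g (mset_set A)) v = card {a \<in> A. v \<in> g a}"
  by (simp add: deg_def filter_mset_image_mset)

lemma sum_shift:
  fixes w :: "'a \<Rightarrow> nat"
  assumes "finite T" "y \<in> T" "x \<notin> T"
  shows "(\<Sum>v\<in>T. shift w x y v) = (\<Sum>v\<in>T. w v) + 1"
proof -
  have "shift w x y v = w v + of_bool (v = y)" if "v \<in> T" for v
    using that assms(2,3) by (auto simp: shift_def)
  then have "(\<Sum>v\<in>T. shift w x y v) = (\<Sum>v\<in>T. w v + of_bool (v = y))" by (rule sum.cong[OF refl])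
  then show ?thesis using assms by (simp add: sum.distrib of_bool_def)
qed

lemma card_Int_pair: "a \<noteq> b \<Longrightarrow> card ({a, b} \<inter> T) = of_bool (a \<in> T) + of_bool (b \<in> T)"
  by auto

definition independent :: "'a graph \<Rightarrow> 'a set \<Rightarrow> bool" where
  "independent G S \<longleftrightarrow> S \<subseteq> verts G \<and> (\<forall>e\<in>edges G. \<not> e \<subseteq> S)"

context
  fixes G :: "'a graph"
  assumes G: "simple_graph G"
begin

lemma edgeE:
  assumes "e \<in> edges G"
  obtains u v where "e = {u, v}" "u \<noteq> v" "u \<in> verts G" "v \<in> verts G"
  using edge_subset[OF G assms] edge_card[OF G assms] by (auto simp: card_2_iff)

lemma edge_irrefl: "{u, v} \<in> edges G \<Longrightarrow> u \<noteq> v"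
  using edge_card[OF G, of "{u, v}"] by auto

lemma edge_verts: "{u, v} \<in> edges G \<Longrightarrow> u \<in> verts G" "{u, v} \<in> edges G \<Longrightarrow> v \<in> verts G"
  using edge_subset[OF G, of "{u, v}"] by auto

lemma independentI:
  assumes "S \<subseteq> verts G" "\<And>u v. u \<in> S \<Longrightarrow> v \<in> S \<Longrightarrow> {u, v} \<notin> edges G"
  shows "independent G S"
  unfolding independent_def using assms edgeE by (metis insert_subset)

lemma independentD: "independent G S \<Longrightarrow> u \<in> S \<Longrightarrow> v \<in> S \<Longrightarrow> {u, v} \<notin> edges G"
  by (auto simp: independent_def)

lemma maximal_independent:
  assumes "independent G S0" "S0 \<subseteq> U" "U \<subseteq> verts G"
  obtains S where "S0 \<subseteq> S" "S \<subseteq> U" "independent G S" "\<And>v. v \<in> U - S \<Longrightarrow> \<exists>s\<in>S. {v, s} \<in> edges G"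
proof -
  let ?F = "{S. S0 \<subseteq> S \<and> S \<subseteq> U \<and> independent G S}"
  have "finite (Pow (verts G))" using verts_finite[OF G] by simp
  then have "finite ?F" by (rule finite_subset[rotated]) (auto simp: independent_def)
  moreover have "S0 \<in> ?F" using assms by simp
  ultimately have "\<exists>S\<in>?F. S0 \<le> S \<and> (\<forall>T\<in>?F. S \<le> T \<longrightarrow> S = T)" by (rule finite_has_maximal2)
  then obtain S where "S \<in> ?F" and max: "\<forall>T\<in>?F. S \<le> T \<longrightarrow> S = T"
    by (elim bexE conjE) (rule that)
  then have S: "S0 \<subseteq> S" "S \<subseteq> U" "independent G S" by simp_all
  have "\<exists>s\<in>S. {v, s} \<in> edges G" if v: "v \<in> U - S" for v
  proof (rule ccontr)
    assume none: "\<not> ?thesis"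
    have "independent G (insert v S)"
    proof (rule independentI)
      fix a b assume "a \<in> insert v S" "b \<in> insert v S"
      moreover have "{v, t} \<notin> edges G" "{t, v} \<notin> edges G" if "t \<in> S" for t
        using none that insert_commute[of t v "{}"] by auto
      moreover have "{t, t'} \<notin> edges G" if "t \<in> S" "t' \<in> S" for t t'
        using S(3) that by (rule independentD)
      moreover have "{v, v} \<notin> edges G" using edge_irrefl[of v v] by blast
      ultimately show "{a, b} \<notin> edges G" by blast
    qed (use S(2) v assms(3) in blast)
    then have "insert v S \<in> ?F" using S v by simp blast
    then have "S = insert v S" using max by (auto dest: bspec)
    then show False using v by blast
  qed
  then show ?thesis using S by (intro that[of S])
qed

text \<open>
  Let \<open>S\<close> be a maximal independent set containing the four vertices.  With capacity one outside \<open>S\<close> and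
  unbounded capacity on \<open>S\<close>, every vertex outside \<open>S\<close> freely picks a neighbour in \<open>S\<close>, so the degrees
  on \<open>T = S - N(y\<^sub>1)\<close> are bounded by the number of vertices with a neighbour in \<open>T\<close>.
\<close>

lemma two_claws_obstruction:
  assumes ind: "independent G {x1, z1, x2, z2}" and dist: "distinct [x1, z1, x2, z2]"
    and edges: "{y1, x1} \<in> edges G" "{y1, z1} \<in> edges G" "{y2, x2} \<in> edges G" "{y2, z2} \<in> edges G"
    and non: "{y1, x2} \<notin> edges G" "{y1, z2} \<notin> edges G"
  shows "\<exists>c. (\<forall>v\<in>verts G. 0 < c v) \<and> \<not> exchange_closed (max_degrees (edges G) c)"
proof -
  let ?E = "edges G" and ?V = "verts G"
  have "{x1, z1, x2, z2} \<subseteq> ?V" using ind by (simp add: independent_def)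
  from maximal_independent[OF ind this] obtain S where
    S: "{x1, z1, x2, z2} \<subseteq> S" "S \<subseteq> ?V" "independent G S" "\<And>v. v \<in> ?V - S \<Longrightarrow> \<exists>s\<in>S. {v, s} \<in> ?E"
    by blast
  define A where "A = ?V - S"
  define c where "c v = (if v \<in> S then card A + 1 else (1::nat))" for v
  have cA: "c v = 1" if "v \<in> A" for v using that by (simp add: c_def A_def)
  have fin: "finite ?V" "finite S" "finite A"
    using verts_finite[OF G] S(2) finite_subset by (auto simp: A_def)
  have indS: "\<not> (u \<in> S \<and> v \<in> S)" if "{u, v} \<in> ?E" for u v
    using S(3) that by (auto simp: independent_def)
  have y: "y1 \<in> A" "y2 \<in> A" "y1 \<noteq> y2"
    using edges non S(1) indS[OF edges(1)] indS[OF edges(3)] edge_verts(1) by (auto simp: A_def)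
  have e_cases: "\<exists>a v. e = {a, v} \<and> a \<noteq> v \<and> a \<in> A \<and> (v \<in> A \<or> v \<in> S)" if e: "e \<in> ?E" for e
  proof -
    obtain u v where "e = {u, v}" "u \<noteq> v" "u \<in> ?V" "v \<in> ?V" using edgeE[OF e] by blast
    then show ?thesis using indS[of u v] e by (auto simp: A_def insert_commute)
  qed
  have bound: "size M \<le> card A" if M: "M \<in> bmatchings ?E c" for M
  proof -
    have "size M \<le> (\<Sum>v\<in>A. deg M v)"
      using e_cases bmatchingsD(1)[OF M] by (intro size_le_sum_deg fin) blast
    also have "\<dots> \<le> (\<Sum>v\<in>A. 1)"
      using bmatchingsD(2)[OF M] cA by (intro sum_mono) metis
    finally show ?thesis by simp
  qed
  define build where "build f = image_mset (\<lambda>a. {a, f a}) (mset_set A)" for f :: "'a \<Rightarrow> 'a"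
  have deg_build: "deg (build f) v = card {a \<in> A. v \<in> {a, f a}}" for f v
    unfolding build_def by (rule deg_image_mset_set[OF fin(3)])
  have build: "build f \<in> max_bmatchings ?E c" if f: "\<And>a. a \<in> A \<Longrightarrow> f a \<in> S \<and> {a, f a} \<in> ?E" for f
  proof -
    have "build f \<in> bmatchings ?E c"
      unfolding bmatchings_def
    proof (intro CollectI conjI allI)
      show "set_mset (build f) \<subseteq> ?E" using f fin by (auto simp: build_def)
      show "deg (build f) v \<le> c v" for v
      proof (cases "v \<in> S")
        case True
        have "card {a \<in> A. v \<in> {a, f a}} \<le> card A" using fin by (intro card_mono) auto
        then show ?thesis using True by (simp add: deg_build c_def)
      next
        case False
        then have "{a \<in> A. v \<in> {a, f a}} \<subseteq> {v}" using f by auto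
        then have "card {a \<in> A. v \<in> {a, f a}} \<le> 1" using card_mono[of "{v}"] by simp
        then show ?thesis using False by (simp add: deg_build c_def)
      qed
    qed
    moreover have "size (build f) = card A" by (simp add: build_def)
    ultimately show ?thesis using bound by (auto simp: max_bmatchings_def)
  qed
  define T where "T = {s \<in> S. {y1, s} \<notin> ?E}"
  \<comment> \<open>An edge that meets \<open>T\<close> has its other end in \<open>A'\<close>,
    where all capacities are one.\<close>
  define A' where "A' = {a \<in> A. \<exists>t\<in>T. {a, t} \<in> ?E}"
  have T: "finite T" "x2 \<in> T" "z2 \<in> T" "x1 \<notin> T" "T \<subseteq> S" "finite A'" "A' \<subseteq> A"
    using fin S(1) non edges by (auto simp: T_def A'_def)
  have A'y: "y1 \<notin> A'" by (auto simp: A'_def T_def)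
  have T_bound: "(\<Sum>v\<in>T. deg M v) \<le> card A'" if M: "M \<in> bmatchings ?E c" for M
  proof -
    have "card (e \<inter> T) \<le> card (e \<inter> A')" if "e \<in># M" for e
    proof -
      have "e \<in> ?E" using bmatchingsD(1)[OF M that] .
      then obtain a v where av: "e = {a, v}" "a \<noteq> v" "a \<in> A" "{a, v} \<in> ?E" using e_cases by blast
      have "a \<notin> T" using av(3) T(5) by (auto simp: A_def)
      moreover have "v \<in> T \<Longrightarrow> a \<in> A'" using av by (auto simp: A'_def)
      ultimately show ?thesis unfolding av(1) card_Int_pair[OF av(2)] by auto
    qed
    then have "(\<Sum>v\<in>T. deg M v) \<le> (\<Sum>v\<in>A'. deg M v)" using T by (intro sum_deg_le) auto
    also have "\<dots> \<le> (\<Sum>v\<in>A'. 1)"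
      using bmatchingsD(2)[OF M] cA T(7) by (intro sum_mono) (metis subsetD)
    finally show ?thesis by simp
  qed
  \<comment> \<open>Vertices of \<open>A'\<close> choose their partner inside \<open>T\<close>,
    which gives \<open>T\<close> as much degree as it can get.\<close>
  have "\<exists>s. s \<in> S \<and> {a, s} \<in> ?E \<and> (a \<in> A' \<longrightarrow> s \<in> T)" if "a \<in> A" for a
  proof (cases "a \<in> A'")
    case True
    then show ?thesis using T(5) unfolding A'_def by blast
  next
    case False
    then show ?thesis using S(4)[of a] that unfolding A_def by blast
  qed
  then obtain g where g: "\<And>a. a \<in> A \<Longrightarrow> g a \<in> S \<and> {a, g a} \<in> ?E \<and> (a \<in> A' \<longrightarrow> g a \<in> T)"
    by metis
  \<comment> \<open>Since \<open>y1\<close> is not in \<open>A'\<close> and \<open>x2\<close> lies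
    in \<open>T\<close>, the choice \<open>f\<close> still fills \<open>T\<close> to its bound, so a
    shift from \<open>x1\<close> outside \<open>T\<close> to \<open>z2\<close> inside
    \<open>T\<close> overfills it. The choice \<open>f'\<close> lowers \<open>x1\<close> and raises
    \<open>z2\<close>.\<close>
  define f f' where "f = g(y1 := x1, y2 := x2)" and "f' = g(y1 := z1, y2 := z2)"
  have f: "f a \<in> S \<and> {a, f a} \<in> ?E" "f' a \<in> S \<and> {a, f' a} \<in> ?E" if "a \<in> A" for a
    using g[OF that] S(1) edges by (auto simp: f_def f'_def)
  define w w' where "w = deg (build f)" and "w' = deg (build f')"
  have W: "w \<in> max_degrees ?E c" "w' \<in> max_degrees ?E c"
    unfolding w_def w'_def max_degrees_def by (intro imageI build f; assumption)+
  have x1A: "x1 \<notin> A" "z2 \<notin> A" using S(1) by (auto simp: A_def)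
  have "{a \<in> A. x1 \<in> {a, f' a}} \<subset> {a \<in> A. x1 \<in> {a, f a}}"
    using x1A y dist by (auto simp: f_def f'_def)
  then have less1: "w' x1 < w x1"
    unfolding w_def w'_def deg_build using fin by (intro psubset_card_mono) auto
  have "{a \<in> A. z2 \<in> {a, f a}} \<subset> {a \<in> A. z2 \<in> {a, f' a}}"
    using x1A y dist by (auto simp: f_def f'_def)
  then have less2: "w z2 < w' z2"
    unfolding w_def w'_def deg_build using fin by (intro psubset_card_mono) auto
  have "card A' \<le> (\<Sum>v\<in>T. w v)"
  proof -
    have "(\<Sum>v\<in>T. w v) = (\<Sum>a\<in>A. card ({a, f a} \<inter> T))"
      unfolding w_def sum_deg_card[OF T(1)] build_def
      by (simp add: sum_unfold_sum_mset image_mset.compositionality comp_def)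
    moreover have "(\<Sum>a\<in>A'. card ({a, f a} \<inter> T)) \<le> (\<Sum>a\<in>A. card ({a, f a} \<inter> T))"
      using fin T by (intro sum_mono2) auto
    moreover have "(\<Sum>a\<in>A'. 1) \<le> (\<Sum>a\<in>A'. card ({a, f a} \<inter> T))"
    proof (rule sum_mono)
      fix a assume a: "a \<in> A'"
      then have "f a \<in> T" using g[of a] T A'y by (auto simp: f_def)
      then have "{f a} \<subseteq> {a, f a} \<inter> T" by auto
      from card_mono[OF _ this] show "1 \<le> card ({a, f a} \<inter> T)" by simp
    qed
    ultimately show ?thesis by simp
  qed
  then have "(\<Sum>v\<in>T. shift w x1 z2 v) > card A'" using sum_shift[OF T(1,3,4), of w] by simp
  then have "shift w x1 z2 \<notin> max_degrees ?E c"
    using T_bound unfolding max_degrees_def max_bmatchings_def by (auto simp: not_le[symmetric])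
  then have "\<not> exchange_closed (max_degrees ?E c)"
    using W less1 less2 unfolding exchange_closed_def by blast
  moreover have "\<forall>v\<in>?V. 0 < c v" by (simp add: c_def)
  ultimately show ?thesis by blast
qed

text \<open>
  The triangle together with the vertices \<open>U\<close> that are adjacent to it but not to \<open>S\<close> has odd total
  capacity, and exactly one unit of it stays free.  This unit can be placed at any vertex of the
  triangle, but it cannot be traded for capacity in \<open>S\<close>.
\<close>

lemma triangle_claw_obstruction:
  assumes tri: "{k1, k2} \<in> edges G" "{k2, k3} \<in> edges G" "{k1, k3} \<in> edges G"
    and ys: "{y, s1} \<in> edges G" "{y, s2} \<in> edges G" "{s1, s2} \<notin> edges G" "s1 \<noteq> s2"
    and yK: "y \<notin> {k1, k2, k3}" and sK: "{s1, s2} \<inter> {k1, k2, k3} = {}"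
    and far: "\<And>s k. s \<in> {s1, s2} \<Longrightarrow> k \<in> {k1, k2, k3} \<Longrightarrow> {s, k} \<notin> edges G"
  shows "\<exists>c. (\<forall>v\<in>verts G. 0 < c v) \<and> \<not> exchange_closed (max_degrees (edges G) c)"
proof -
  let ?E = "edges G" and ?V = "verts G"
  define K where "K = {k1, k2, k3}"
  have kne: "k1 \<noteq> k2" "k2 \<noteq> k3" "k1 \<noteq> k3" using tri edge_irrefl by blast+
  \<comment> \<open>\<open>S\<close> is taken from here so that no edge joins it to the
    triangle.\<close>
  define R where "R = {v \<in> ?V - K. \<forall>k\<in>K. {v, k} \<notin> ?E}"
  have s12: "{s1, s2} \<subseteq> R"
    using sK far ys(1,2) edge_verts(2) unfolding R_def K_def by blast
  have "independent G {s1, s2}"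
  proof (rule independentI)
    show "{s1, s2} \<subseteq> ?V" using s12 by (auto simp: R_def)
    fix u v assume "u \<in> {s1, s2}" "v \<in> {s1, s2}"
    then show "{u, v} \<notin> ?E" using ys(3) edge_irrefl[of u v] by (auto simp: insert_commute)
  qed
  moreover have "R \<subseteq> ?V" by (auto simp: R_def)
  ultimately obtain S where S: "{s1, s2} \<subseteq> S" "S \<subseteq> R" "independent G S"
    "\<And>v. v \<in> R - S \<Longrightarrow> \<exists>s\<in>S. {v, s} \<in> ?E"
    using maximal_independent[OF _ s12] by blast
  have indS: "\<not> (u \<in> S \<and> v \<in> S)" if "{u, v} \<in> ?E" for u v
    using S(3) that unfolding independent_def by auto
  have SK: "{u, v} \<notin> ?E" if "u \<in> S" "v \<in> K" for u v
    using S(2) that unfolding R_def by blast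
  have SnK: "S \<inter> K = {}" using S(2) unfolding R_def by blast
  define U where "U = {v \<in> ?V - K - S. \<forall>s\<in>S. {v, s} \<notin> ?E}"
  define A where "A = {v \<in> ?V - K - S. \<exists>s\<in>S. {v, s} \<in> ?E}"
  have part: "v \<in> K \<or> v \<in> S \<or> v \<in> U \<or> v \<in> A" if "v \<in> ?V" for v
    using that unfolding U_def A_def by blast
  have disj: "U \<inter> K = {}" "A \<inter> K = {}" "U \<inter> S = {}" "A \<inter> S = {}" "U \<inter> A = {}"
    unfolding U_def A_def by blast+
  have fin: "finite ?V" "finite S" "finite A" "finite U" "finite K"
    using verts_finite[OF G] S(2) unfolding K_def A_def U_def R_def by (auto intro: finite_subset)
  have "\<exists>k. k \<in> K \<and> {u, k} \<in> ?E" if u: "u \<in> U" for u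
  proof (rule ccontr)
    assume "\<not> ?thesis"
    then have "u \<in> R - S" using u unfolding R_def U_def by blast
    then show False using S(4) u unfolding U_def by blast
  qed
  then obtain h where h: "\<And>u. u \<in> U \<Longrightarrow> h u \<in> K \<and> {u, h u} \<in> ?E" by metis
  have "\<exists>s. s \<in> S \<and> {a, s} \<in> ?E" if "a \<in> A" for a using that unfolding A_def by blast
  then obtain g where g: "\<And>a. a \<in> A \<Longrightarrow> g a \<in> S \<and> {a, g a} \<in> ?E" by metis
  \<comment> \<open>Each triangle vertex can serve the vertices of \<open>U\<close> assigned to it
    and one further unit, so \<open>K\<close> and \<open>U\<close> together have capacity
    \<open>2 * card U + 3\<close>.\<close>
  define c where "c v = (if v \<in> S then card A + 1 else
    if v \<in> K then card {u \<in> U. h u = v} + 1 else (1::nat))" for v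
  have cA: "c v = 1" if "v \<in> A" for v using that disj by (auto simp: c_def)
  have cU: "c v = 1" if "v \<in> U" for v using that disj by (auto simp: c_def)
  have cK: "c v = card {u \<in> U. h u = v} + 1" if "v \<in> K" for v using that SnK by (auto simp: c_def)
  have "sum c (K \<union> U) = sum c K + sum c U"
    using fin disj by (intro sum.union_disjoint) auto
  also have "sum c K = (\<Sum>v\<in>K. card {u \<in> U. h u = v}) + 3"
    using kne cK by (simp add: sum.distrib K_def)
  also have "(\<Sum>v\<in>K. card {u \<in> U. h u = v}) = card U"
    using sum.group[OF fin(4,5), of h "\<lambda>_. 1 :: nat"] h by (simp add: image_subset_iff)
  also have "sum c U = card U" using cU by simp
  finally have cKU: "sum c (K \<union> U) = 2 * card U + 3" by simp
  have e_cases: "(\<exists>a v. e = {a, v} \<and> a \<noteq> v \<and> a \<in> A) \<or> e \<subseteq> K \<union> U" if e: "e \<in> ?E" for e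
  proof -
    obtain u v where uv: "e = {u, v}" "u \<noteq> v" "u \<in> ?V" "v \<in> ?V" using edgeE[OF e] by blast
    have "{v, u} \<in> ?E" "{u, v} \<in> ?E" using e uv(1) by (simp_all add: insert_commute)
    then have "\<not> (u \<in> S \<and> (v \<in> S \<or> v \<in> K \<or> v \<in> U))" "\<not> (v \<in> S \<and> (u \<in> S \<or> u \<in> K \<or> u \<in> U))"
      using indS SK unfolding U_def by blast+
    then show ?thesis using part[OF uv(3)] part[OF uv(4)] uv(1,2) by blast
  qed
  have degA: "(\<Sum>v\<in>A. deg M v) \<le> card A" if M: "M \<in> bmatchings ?E c" for M
  proof -
    have "(\<Sum>v\<in>A. deg M v) \<le> (\<Sum>v\<in>A. 1)"
      using bmatchingsD(2)[OF M] cA by (intro sum_mono) metis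
    then show ?thesis by simp
  qed
  have bound: "size M \<le> card A + card U + 1" if M: "M \<in> bmatchings ?E c" for M
  proof -
    \<comment> \<open>A fractional cover, doubled: weight one on \<open>A\<close> and one half on
      \<open>K\<close> and \<open>U\<close> covers every edge. Its value exceeds the claimed bound
      by one half, which integrality absorbs.\<close>
    have "2 \<le> 2 * card (e \<inter> A) + card (e \<inter> (K \<union> U))" if "e \<in># M" for e
    proof -
      have e: "e \<in> ?E" using bmatchingsD(1)[OF M that] .
      from e_cases[OF e] show ?thesis
      proof
        assume "\<exists>a v. e = {a, v} \<and> a \<noteq> v \<and> a \<in> A"
        then obtain a v where "e = {a, v}" "a \<noteq> v" "a \<in> A" by blast
        then show ?thesis using card_Int_pair[of a v A] by simp
      next
        assume "e \<subseteq> K \<union> U"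
        then have "e \<inter> (K \<union> U) = e" by blast
        then show ?thesis using edge_card[OF G e] by simp
      qed
    qed
    then have "(\<Sum>e\<in>#M. 2) \<le> (\<Sum>e\<in>#M. 2 * card (e \<inter> A) + card (e \<inter> (K \<union> U)))"
      by (intro sum_mset_mono) auto
    also have "\<dots> = 2 * (\<Sum>e\<in>#M. card (e \<inter> A)) + (\<Sum>e\<in>#M. card (e \<inter> (K \<union> U)))"
      by (simp add: sum_mset.distrib sum_mset_distrib_left)
    also have "\<dots> = 2 * (\<Sum>v\<in>A. deg M v) + (\<Sum>v\<in>K \<union> U. deg M v)"
      using fin by (simp add: sum_deg_card)
    also have "\<dots> \<le> 2 * card A + sum c (K \<union> U)"
      using degA[OF M] bmatchingsD(2)[OF M] by (intro add_mono sum_mono mult_left_mono) auto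
    finally show ?thesis by (simp add: cKU)
  qed
  have S_bound: "(\<Sum>v\<in>S. deg M v) \<le> card A" if M: "M \<in> bmatchings ?E c" for M
  proof -
    have "card (e \<inter> S) \<le> card (e \<inter> A)" if "e \<in># M" for e
      using e_cases[OF bmatchingsD(1)[OF M that]]
    proof
      assume "\<exists>a v. e = {a, v} \<and> a \<noteq> v \<and> a \<in> A"
      then obtain a v where av: "e = {a, v}" "a \<noteq> v" "a \<in> A" by blast
      have "a \<notin> S" using av(3) disj by blast
      then show ?thesis unfolding av(1) card_Int_pair[OF av(2)] using av(3) by simp
    next
      assume "e \<subseteq> K \<union> U"
      then have "e \<inter> S = {}" using disj SnK by blast
      then show ?thesis by simp
    qed
    then have "(\<Sum>v\<in>S. deg M v) \<le> (\<Sum>v\<in>A. deg M v)" using fin by (intro sum_deg_le) auto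
    then show ?thesis using degA[OF M] by simp
  qed
  define build where "build e f = add_mset e (image_mset (\<lambda>u. {u, h u}) (mset_set U)
    + image_mset (\<lambda>a. {a, f a}) (mset_set A))" for e and f :: "'a \<Rightarrow> 'a"
  have deg_build: "deg (build e f) v = of_bool (v \<in> e) + card {u \<in> U. v \<in> {u, h u}} + card {a \<in> A. v \<in> {a, f a}}"
    for e f v
    unfolding build_def by (simp add: deg_image_mset_set[OF fin(3)] deg_image_mset_set[OF fin(4)])
  have build: "build e f \<in> max_bmatchings ?E c"
    if f: "\<And>a. a \<in> A \<Longrightarrow> f a \<in> S \<and> {a, f a} \<in> ?E" and e: "e \<in> ?E" "e \<subseteq> K" for e f
  proof -
    have "build e f \<in> bmatchings ?E c"
      unfolding bmatchings_def
    proof (intro CollectI conjI allI)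
      show "set_mset (build e f) \<subseteq> ?E" using f h e fin by (auto simp: build_def)
      have U0: "{u \<in> U. v \<in> {u, h u}} = {}" if "v \<notin> K" "v \<notin> U" for v using h that by auto
      have A0: "{a \<in> A. v \<in> {a, f a}} = {}" if "v \<notin> A" "v \<notin> S" for v using f that by auto
      show "deg (build e f) v \<le> c v" for v
      proof -
        consider "v \<in> S" | "v \<in> K" | "v \<in> U" | "v \<in> A" | "v \<notin> S \<union> K \<union> U \<union> A" by blast
        then show ?thesis
        proof cases
          case 1
          then have "v \<notin> e" "{u \<in> U. v \<in> {u, h u}} = {}" using SnK disj e U0 by blast+
          moreover have "card {a \<in> A. v \<in> {a, f a}} \<le> card A" using fin by (intro card_mono) auto
          ultimately show ?thesis using 1 by (simp only: deg_build c_def) simp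
        next
          case 2
          then have "v \<notin> U" "v \<notin> A" "v \<notin> S" using disj SnK by blast+
          then have "{u \<in> U. v \<in> {u, h u}} = {u \<in> U. h u = v}" "{a \<in> A. v \<in> {a, f a}} = {}"
            using A0 by auto
          then show ?thesis using cK[OF 2] by (simp only: deg_build) simp
        next
          case 3
          then have "v \<notin> K" "v \<notin> A" "v \<notin> S" using disj by blast+
          then have "v \<notin> e" "{u \<in> U. v \<in> {u, h u}} = {v}" "{a \<in> A. v \<in> {a, f a}} = {}"
            using 3 e h A0 by auto
          then show ?thesis using cU[OF 3] by (simp only: deg_build) simp
        next
          case 4
          then have "v \<notin> K" "v \<notin> U" "v \<notin> S" using disj by blast+
          then have "v \<notin> e" "{u \<in> U. v \<in> {u, h u}} = {}" "{a \<in> A. v \<in> {a, f a}} = {v}"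
            using 4 e f U0 by auto
          then show ?thesis using cA[OF 4] by (simp only: deg_build) simp
        next
          case 5
          then have "v \<notin> e" "{u \<in> U. v \<in> {u, h u}} = {}" "{a \<in> A. v \<in> {a, f a}} = {}"
            using e U0 A0 by blast+
          then show ?thesis by (simp only: deg_build) simp
        qed
      qed
    qed
    moreover have "size (build e f) = card A + card U + 1" by (simp add: build_def)
    ultimately show ?thesis using bound by (simp add: max_bmatchings_def)
  qed
  \<comment> \<open>The free unit sits at \<open>k1\<close> in \<open>w\<close> and at
    \<open>k2\<close> in \<open>w'\<close>, while \<open>y\<close> switches from \<open>s1\<close>
    to \<open>s2\<close>. As \<open>w\<close> already exhausts the bound on \<open>S\<close>, no
    unit can move from \<open>k2\<close> to \<open>s2\<close>.\<close>
  define f f' where "f = g(y := s1)" and "f' = g(y := s2)"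
  have yA: "y \<in> A"
    using S(1) yK ys(1,2) indS[OF ys(1)] edge_verts(1)[OF ys(1)] unfolding A_def K_def by blast
  have f: "f a \<in> S \<and> {a, f a} \<in> ?E" "f' a \<in> S \<and> {a, f' a} \<in> ?E" if "a \<in> A" for a
    using g[OF that] S(1) ys by (auto simp: f_def f'_def)
  define w w' where "w = deg (build {k2, k3} f)" and "w' = deg (build {k1, k3} f')"
  have W: "w \<in> max_degrees ?E c" "w' \<in> max_degrees ?E c"
    unfolding w_def w'_def max_degrees_def by (rule imageI, rule build, erule f, use tri in \<open>auto simp: K_def\<close>)+
  have k2: "k2 \<in> K" "k2 \<notin> A" "k2 \<notin> S" using disj SnK unfolding K_def by blast+
  then have "{a \<in> A. k2 \<in> {a, f a}} = {}" "{a \<in> A. k2 \<in> {a, f' a}} = {}" using f by auto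
  then have less1: "w' k2 < w k2"
    using kne unfolding w_def w'_def deg_build by (simp only:) simp
  have s2: "s2 \<in> S" using S(1) by simp
  have "s2 \<notin> A" "s2 \<notin> K" using s2 disj(4) SnK by (auto simp: disjoint_iff)
  note s2 = s2 this
  have "{a \<in> A. s2 \<in> {a, f a}} \<subset> {a \<in> A. s2 \<in> {a, f' a}}"
    using s2 yA ys(4) by (auto simp: f_def f'_def)
  then have "card {a \<in> A. s2 \<in> {a, f a}} < card {a \<in> A. s2 \<in> {a, f' a}}"
    using fin by (intro psubset_card_mono) auto
  then have less2: "w s2 < w' s2"
  proof -
    have "s2 \<notin> {k2, k3}" "s2 \<notin> {k1, k3}" using sK by auto
    moreover have "{u \<in> U. s2 \<in> {u, h u}} = {}" using h s2 disj by auto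
    ultimately show ?thesis
      using \<open>card _ < card _\<close> unfolding w_def w'_def deg_build by (simp only:)
  qed
  have "card A \<le> (\<Sum>v\<in>S. w v)"
  proof -
    have "(\<Sum>a\<in>A. 1) \<le> (\<Sum>a\<in>A. card ({a, f a} \<inter> S))"
    proof (rule sum_mono)
      fix a assume "a \<in> A"
      then have "{f a} \<subseteq> {a, f a} \<inter> S" using f by auto
      from card_mono[OF _ this] show "1 \<le> card ({a, f a} \<inter> S)" by simp
    qed
    then show ?thesis
      unfolding w_def sum_deg_card[OF fin(2)] build_def
      by (simp add: sum_unfold_sum_mset image_mset.compositionality comp_def)
  qed
  then have "(\<Sum>v\<in>S. shift w k2 s2 v) > card A" using sum_shift[OF fin(2) s2(1) k2(3), of w] by simp
  then have "shift w k2 s2 \<notin> max_degrees ?E c"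
    using S_bound unfolding max_degrees_def max_bmatchings_def by (auto simp: not_le[symmetric])
  then have "\<not> exchange_closed (max_degrees ?E c)"
    using W less1 less2 unfolding exchange_closed_def by blast
  moreover have "\<forall>v\<in>?V. 0 < c v" by (simp add: c_def)
  ultimately show ?thesis by blast
qed

end

section \<open>Sufficient conditions\<close>

text \<open>Unlike in the strong exchange property, capacities may be zero; this makes the notion
  hereditary for induced subgraphs.\<close>

definition always_exchange_closed :: "'a set set \<Rightarrow> bool" where
  "always_exchange_closed E \<longleftrightarrow> (\<forall>c. exchange_closed (max_degrees E c))"

definition pair_edges :: "'a set set \<Rightarrow> bool" where
  "pair_edges E \<longleftrightarrow> finite E \<and> (\<forall>e\<in>E. card e = 2)"

lemma pair_edges_finite_verts: "pair_edges E \<Longrightarrow> finite (\<Union>E)"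
  unfolding pair_edges_def by (metis card.infinite finite_Union zero_neq_numeral)

lemma deg_pos_in: "set_mset M \<subseteq> E \<Longrightarrow> 0 < deg M v \<Longrightarrow> v \<in> \<Union>E"
  unfolding deg_pos_iff by auto

lemma deg_replicate_mset: "deg (replicate_mset n e) v = (if v \<in> e then n else 0)"
  by (induction n) auto

lemma max_degreesE:
  assumes "w \<in> max_degrees E c"
  obtains M where "M \<in> max_bmatchings E c" "w = deg M" "set_mset M \<subseteq> E" "\<And>v. w v \<le> c v"
  using assms by (auto simp: max_degrees_def max_bmatchings_def bmatchings_def)

lemma sum_deg_pair_edges:
  assumes "pair_edges E" "set_mset M \<subseteq> E"
  shows "(\<Sum>v\<in>\<Union>E. deg M v) = 2 * size M"
  using assms pair_edges_finite_verts[OF assms(1)] by (intro sum_deg) (auto simp: pair_edges_def)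

lemma always_exchange_closedI:
  assumes E: "pair_edges E"
    and no: "\<And>c m p q r s. \<not> bad_square (max_degrees E c) m p q r s"
  shows "always_exchange_closed E"
  unfolding always_exchange_closed_def exchange_closed_def
proof (intro allI ballI impI, rule ccontr)
  fix c w w' x y
  assume *: "w \<in> max_degrees E c" "w' \<in> max_degrees E c" "w' x < w x" "w y < w' y"
    "shift w x y \<notin> max_degrees E c"
  have "\<exists>m p q r s. bad_square (max_degrees E c) m p q r s"
  proof (rule bad_square_exists[OF mconvex_max_degrees pair_edges_finite_verts[OF E] _ _ *])
    show "card e = 2" if "e \<in> E" for e using that E by (simp add: pair_edges_def)
    show "u v = 0" if u: "u \<in> max_degrees E c" and v: "v \<notin> \<Union>E" for u v
    proof -
      obtain M where M: "u = deg M" "set_mset M \<subseteq> E" using max_degreesE[OF u] by metis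
      then show ?thesis using v deg_pos_in[of M E v] by blast
    qed
    show "sum u (\<Union>E) = sum u' (\<Union>E)" if "u \<in> max_degrees E c" "u' \<in> max_degrees E c" for u u'
      using that sum_deg_pair_edges[OF E] max_bmatchings_same_size
      by (metis max_degreesE)
  qed
  then show False using no by blast
qed

section \<open>Augmentations and the limits they put on bad squares\<close>

lemma no_augmenting_edge:
  assumes "w \<in> max_degrees E c" "{u, v} \<in> E" "u \<noteq> v" "w u < c u" "w v < c v"
  shows False
proof -
  obtain M where M: "M \<in> max_bmatchings E c" "w = deg M" "\<And>v. w v \<le> c v"
    using max_degreesE[OF assms(1)] by metis
  have "deg M x + deg {#{u, v}#} x \<le> c x + deg {#} x" for x
    using assms M(2) M(3)[of x] by auto
  from max_degrees_replace(1)[OF M(1) _ _ this] show False using assms(2) by simp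
qed

lemma no_augmenting_path:
  assumes M: "M \<in> max_bmatchings E c" and yz: "{y, z} \<in># M" "y \<noteq> z"
    and uv: "{u, y} \<in> E" "{v, z} \<in> E" "u \<noteq> v" "u \<noteq> y" "v \<noteq> z" "deg M u < c u" "deg M v < c v"
  shows False
proof -
  have le: "deg M x \<le> c x" for x using M by (simp add: max_bmatchings_def bmatchings_def)
  have "deg M x + deg {#{u, y}, {v, z}#} x \<le> c x + deg {#{y, z}#} x" for x
    using uv yz(2) le[of x] by auto
  from max_degrees_replace(1)[OF M _ _ this] yz(1) uv(1,2) show False by simp
qed

text \<open>An alternating path with two edges: the size is kept, and a unit of spare capacity moves
  from \<open>u\<close> to \<open>z\<close>.\<close>

lemma max_bmatchings_rotate:
  assumes M: "M \<in> max_bmatchings E c" and yz: "{y, z} \<in># M" "y \<noteq> z"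
    and u: "{u, y} \<in> E" "u \<noteq> y" "u \<noteq> z" "deg M u < c u"
  shows "add_mset {u, y} (M - {#{y, z}#}) \<in> max_bmatchings E c"
    and "deg (add_mset {u, y} (M - {#{y, z}#})) = shift (deg M) z u"
proof -
  obtain N where N: "M = add_mset {y, z} N" using yz(1) by (metis insert_DiffM)
  have d: "deg (add_mset {u, y} N) = shift (deg M) z u"
    using yz u by (auto simp: fun_eq_iff shift_def N)
  then show "deg (add_mset {u, y} (M - {#{y, z}#})) = shift (deg M) z u" by (simp add: N)
  have le: "deg M x \<le> c x" for x using M by (simp add: max_bmatchings_def bmatchings_def)
  have "shift (deg M) z u x \<le> c x" for x
    using u(3,4) le[of x] by (cases "x = u"; cases "x = z") (auto simp: shift_def)
  then have "add_mset {u, y} N \<in> bmatchings E c"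
    using M u(1) unfolding bmatchings_def mem_Collect_eq d by (auto simp: N max_bmatchings_def bmatchings_def)
  from max_bmatchingsI[OF M this] show "add_mset {u, y} (M - {#{y, z}#}) \<in> max_bmatchings E c"
    by (simp add: N)
qed

lemma plus2_commute: "plus2 m p q = plus2 m q p"
  by (simp add: plus2_def fun_eq_iff)

lemma bad_square_swap:
  assumes "bad_square W m p q r s"
  shows "bad_square W m s q r p" and "bad_square W m p r q s"
  using assms plus2_commute[of m] by (auto simp: bad_square_def)

lemma bad_square_capacity:
  assumes "bad_square (max_degrees E c) m p q r s"
  shows "m p < c p" "m q < c q" "m r < c r" "m s < c s" "m v \<le> c v"
proof -
  have "plus2 m p q v \<le> c v" "plus2 m r s v \<le> c v" for v
    using assms max_degreesE unfolding bad_square_def by metis+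
  note this[of p] this[of q] this[of r] this[of s] this[of v]
  then show "m p < c p" "m q < c q" "m r < c r" "m s < c s" "m v \<le> c v"
    using assms by (auto simp: bad_square_def plus2_def)
qed

text \<open>The opposite side of the square leaves room at both ends of the given pair, so an edge
  there would augment a maximum.\<close>

lemma bad_square_nonadjacent:
  assumes "bad_square (max_degrees E c) m p q r s"
  shows "{p, q} \<notin> E" "{r, s} \<notin> E" "{p, r} \<notin> E" "{q, s} \<notin> E"
proof -
  note cap = bad_square_capacity[OF assms]
  note b = assms[unfolded bad_square_def]
  show "{p, q} \<notin> E" using no_augmenting_edge[of "plus2 m r s" E c p q] b cap by (auto simp: plus2_def)
  show "{r, s} \<notin> E" using no_augmenting_edge[of "plus2 m p q" E c r s] b cap by (auto simp: plus2_def)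
  show "{p, r} \<notin> E" using no_augmenting_edge[of "plus2 m q s" E c p r] b cap by (auto simp: plus2_def)
  show "{q, s} \<notin> E" using no_augmenting_edge[of "plus2 m p r" E c q s] b cap by (auto simp: plus2_def)
qed

text \<open>Degrees \<open>m + q + r\<close> respect the capacities because \<open>m\<close> leaves
  room at every corner, and the degree sum gives the size of a maximum. So any realisation would put
  this vector into \<open>max_degrees E c\<close>.\<close>

lemma bad_square_not_realizable:
  assumes E: "pair_edges E" and b: "bad_square (max_degrees E c) m p q r s"
    and N: "set_mset N \<subseteq> E" "deg N = plus2 m q r"
  shows False
proof -
  note cap = bad_square_capacity[OF b]
  have "plus2 m p q \<in> max_degrees E c" using b by (simp add: bad_square_def)
  then obtain M where M: "M \<in> max_bmatchings E c" "plus2 m p q = deg M" "set_mset M \<subseteq> E"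
    using max_degreesE by metis
  have V: "x \<in> \<Union>E" if "x \<in> {p, q, r}" for x
  proof -
    obtain M' where M': "plus2 m p r = deg M'" "set_mset M' \<subseteq> E"
      using b max_degreesE unfolding bad_square_def by metis
    have "0 < deg M x \<or> 0 < deg M' x" using that unfolding M(2)[symmetric] M'(1)[symmetric]
      by (auto simp: plus2_def)
    then show ?thesis using deg_pos_in[OF M(3)] deg_pos_in[OF M'(2)] by blast
  qed
  have "m v + of_bool (v = q) + of_bool (v = r) \<le> c v" for v
    using cap(2,3) cap(5)[of v] b by (auto simp: bad_square_def)
  then have Nb: "N \<in> bmatchings E c"
    using N by (simp add: bmatchings_def plus2_def)
  have "(\<Sum>v\<in>\<Union>E. plus2 m q r v) = (\<Sum>v\<in>\<Union>E. plus2 m p q v)"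
    using V pair_edges_finite_verts[OF E] by (simp add: plus2_def sum.distrib of_bool_def)
  then have "size N = size M"
    using sum_deg_pair_edges[OF E N(1)] sum_deg_pair_edges[OF E M(3)] unfolding N(2) M(2) by simp
  then have "N \<in> max_bmatchings E c" by (intro max_bmatchingsI[OF M(1) Nb]) simp
  then have "plus2 m q r \<in> max_degrees E c" unfolding max_degrees_def N(2)[symmetric] by (rule imageI)
  then show False using b by (simp add: bad_square_def)
qed

definition leaf_at :: "'a set set \<Rightarrow> 'a \<Rightarrow> 'a \<Rightarrow> bool" where
  "leaf_at E u t \<longleftrightarrow> u \<noteq> t \<and> {u, t} \<in> E \<and> (\<forall>e\<in>E. u \<in> e \<longrightarrow> e = {u, t})"

lemma leaf_deg_le:
  assumes "leaf_at E u t" "set_mset M \<subseteq> E"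
  shows "deg M u \<le> deg M t"
  using assms(2)
proof (induction M)
  case (add e M)
  then have "u \<in> e \<Longrightarrow> t \<in> e" using assms(1) by (auto simp: leaf_at_def)
  then show ?case using add by auto
qed simp

text \<open>If an edge \<open>{t, z}\<close> with \<open>z\<close> other than \<open>u\<close> were
  used, the path \<open>u, t, z, x\<close> would augment.\<close>

lemma leaf_saturated:
  assumes E: "pair_edges E" and M: "M \<in> max_bmatchings E c" and leaf: "leaf_at E u t"
    and nb: "\<And>z. {t, z} \<in> E \<Longrightarrow> z \<noteq> u \<Longrightarrow> {x, z} \<in> E"
    and def: "deg M u < c u" "deg M x < c x" "u \<noteq> x"
  shows "deg M t = deg M u"
proof -
  have sub: "set_mset M \<subseteq> E" using M by (simp add: max_bmatchings_def bmatchings_def)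
  have ne: "a \<noteq> b" if "{a, b} \<in> E" for a b
    using E that unfolding pair_edges_def by force
  have "e = {u, t}" if e: "e \<in># M" "t \<in> e" for e
  proof (rule ccontr)
    assume "e \<noteq> {u, t}"
    have "e \<in> E" using e sub by auto
    then have "card e = 2" using E by (simp add: pair_edges_def)
    then obtain z where z: "e = {t, z}" "t \<noteq> z"
      using e(2) unfolding card_2_iff by fastforce
    then have "z \<noteq> u" using \<open>e \<noteq> {u, t}\<close> by auto
    then have "{x, z} \<in> E" using nb \<open>e \<in> E\<close> z by auto
    from no_augmenting_path[OF M, of t z u x] show False
      using z e(1) leaf def \<open>{x, z} \<in> E\<close> ne[of x z] by (auto simp: leaf_at_def)
  qed
  moreover have "e = {u, t}" if "e \<in># M" "u \<in> e" for e
    using that leaf sub by (auto simp: leaf_at_def)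
  ultimately have "{#e \<in># M. t \<in> e#} = {#e \<in># M. u \<in> e#}"
    by (intro filter_mset_cong) auto
  then show ?thesis by (simp add: deg_def)
qed

text \<open>Both \<open>u\<close> and \<open>x\<close> have room in \<open>m + r + s\<close>, which
  forces equal degrees at \<open>u\<close> and \<open>t\<close> there. The side through
  \<open>u\<close> and one of \<open>r\<close>, \<open>s\<close> raises the degree at
  \<open>u\<close> but not the one at \<open>t\<close> beyond that common value, although a leaf
  never exceeds its neighbour.\<close>

lemma bad_square_leaf:
  assumes E: "pair_edges E" and b: "bad_square (max_degrees E c) m p q r s"
    and leaf: "leaf_at E u t" and nb: "\<And>z. {t, z} \<in> E \<Longrightarrow> z \<noteq> u \<Longrightarrow> {x, z} \<in> E"
    and ux: "(u = p \<and> x = q) \<or> (u = q \<and> x = p)"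
  shows False
proof -
  note cap = bad_square_capacity[OF b]
  obtain M where M: "M \<in> max_bmatchings E c" "plus2 m r s = deg M"
    using b max_degreesE unfolding bad_square_def by metis
  have dist: "distinct [p, q, r, s]" using b by (simp add: bad_square_def)
  have "deg M u < c u" "deg M x < c x" "u \<noteq> x"
    unfolding M(2)[symmetric] using ux dist cap by (auto simp: plus2_def)
  from leaf_saturated[OF E M(1) leaf nb this]
  have 1: "plus2 m r s t = plus2 m r s u" by (simp add: M(2))
  \<comment> \<open>The corner among \<open>r\<close> and \<open>s\<close> that shares a side with
    \<open>u\<close>.\<close>
  define y where "y = (if u = p then r else s)"
  have "plus2 m u y \<in> max_degrees E c" using ux b dist by (auto simp: bad_square_def y_def)
  then obtain M' where M': "plus2 m u y = deg M'" "set_mset M' \<subseteq> E" using max_degreesE by metis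
  from leaf_deg_le[OF leaf M'(2)] have 2: "plus2 m u y u \<le> plus2 m u y t" by (simp add: M'(1))
  have "t \<noteq> u" using leaf by (auto simp: leaf_at_def)
  then show False using 1 2 ux dist unfolding plus2_def y_def by (auto split: if_splits)
qed

section \<open>Edge multiplicities read off from degrees\<close>

text \<open>A weighting with sum \<open>k\<close> on \<open>e\<close> and zero on the other edges
  extracts the multiplicity of \<open>e\<close> from the degrees. For \<open>k = 0\<close> it is a
  linear relation satisfied by all degree vectors.\<close>

lemma sum_potential:
  fixes lam :: "'a \<Rightarrow> int"
  assumes E: "pair_edges E" and M: "set_mset M \<subseteq> E"
    and lam: "\<And>f. f \<in> E \<Longrightarrow> (\<Sum>v\<in>f. lam v) = (if f = e then k else 0)"
  shows "(\<Sum>v\<in>\<Union>E. lam v * int (deg M v)) = k * int (count M e)"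
  using M
proof (induction M)
  case (add f M)
  have f: "f \<subseteq> \<Union>E" "f \<in> E" using add.prems by auto
  have "(\<Sum>v\<in>\<Union>E. lam v * int (deg (add_mset f M) v)) =
    (\<Sum>v\<in>\<Union>E. if v \<in> f then lam v else 0) + (\<Sum>v\<in>\<Union>E. lam v * int (deg M v))"
    unfolding sum.distrib[symmetric] by (intro sum.cong) (auto simp: algebra_simps)
  also have "(\<Sum>v\<in>\<Union>E. if v \<in> f then lam v else 0) = (\<Sum>v\<in>f. lam v)"
    using f pair_edges_finite_verts[OF E] by (simp add: sum.inter_restrict[symmetric] Int_absorb1)
  finally show ?case using add lam[OF f(2)] by (simp add: algebra_simps)
qed simp

lemma sum_plus2:
  fixes lam :: "'a \<Rightarrow> int"
  assumes "finite V" "p \<in> V" "q \<in> V"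
  shows "(\<Sum>v\<in>V. lam v * int (plus2 m p q v)) = (\<Sum>v\<in>V. lam v * int (m v)) + lam p + lam q"
proof -
  have "(\<Sum>v\<in>V. lam v * int (plus2 m p q v)) =
    (\<Sum>v\<in>V. lam v * int (m v) + (if v = p then lam v else 0) + (if v = q then lam v else 0))"
    by (intro sum.cong) (auto simp: plus2_def algebra_simps)
  then show ?thesis using assms by (simp add: sum.distrib)
qed

lemma bad_square_verts:
  assumes "bad_square (max_degrees E c) m p q r s"
  shows "{p, q, r, s} \<subseteq> \<Union>E" and "\<And>v. v \<notin> \<Union>E \<Longrightarrow> m v = 0"
proof -
  have pos: "v \<in> \<Union>E" if "w \<in> max_degrees E c" "0 < w v" for w v
    using that max_degreesE[OF that(1)] deg_pos_in by metis
  show "{p, q, r, s} \<subseteq> \<Union>E"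
    using assms pos[of "plus2 m p q" p] pos[of "plus2 m p q" q] pos[of "plus2 m r s" r] pos[of "plus2 m r s" s]
    unfolding bad_square_def plus2_def by simp
  show "m v = 0" if "v \<notin> \<Union>E" for v
    using assms pos[of "plus2 m p q" v] that unfolding bad_square_def plus2_def by fastforce
qed

text \<open>
  If the incidence matrix of the graph is invertible, with twice its inverse given by \<open>lam\<close>, then
  the multiplicities of a multiset of edges are determined by its degrees, and an integral vector is
  a degree vector as soon as these multiplicities come out nonnegative.
\<close>

lemma bad_square_potential:
  fixes lam :: "'i \<Rightarrow> 'a \<Rightarrow> int"
  assumes E: "pair_edges (ed ` I)" and I: "finite I"
    and left: "\<And>i j. i \<in> I \<Longrightarrow> j \<in> I \<Longrightarrow> (\<Sum>v\<in>ed j. lam i v) = (if i = j then 2 else 0)"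
    and right: "\<And>u v. u \<in> \<Union>(ed ` I) \<Longrightarrow> v \<in> \<Union>(ed ` I) \<Longrightarrow>
      (\<Sum>i\<in>I. if v \<in> ed i then lam i u else 0) = (if u = v then 2 else 0)"
    and parity: "\<And>i u v. i \<in> I \<Longrightarrow> u \<in> \<Union>(ed ` I) \<Longrightarrow> v \<in> \<Union>(ed ` I) \<Longrightarrow> even (lam i u + lam i v)"
    and b: "bad_square (max_degrees (ed ` I) c) m p q r s"
  shows "\<exists>i\<in>I. \<forall>x\<in>{p, s}. \<forall>y\<in>{q, r}. lam i y + 2 \<le> lam i x"
proof (rule ccontr)
  assume no: "\<not> ?thesis"
  let ?E = "ed ` I" and ?V = "\<Union>(ed ` I)"
  have V: "finite ?V" by (rule pair_edges_finite_verts[OF E])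
  note pqrs = bad_square_verts[OF b]
  have pV: "p \<in> ?V" and qV: "q \<in> ?V" and rV: "r \<in> ?V" and sV: "s \<in> ?V" using pqrs(1) by auto
  have inj: "i = j" if "i \<in> I" "j \<in> I" "ed i = ed j" for i j
    using left[OF that(1) that(1)] left[OF that(1) that(2)] that(3) by (auto split: if_splits)
  define B where "B i = (\<Sum>v\<in>?V. lam i v * int (m v))" for i
  have pot: "even (B i + lam i x + lam i y) \<and> 0 \<le> B i + lam i x + lam i y"
    if i: "i \<in> I" and xy: "plus2 m x y \<in> max_degrees ?E c" and V': "x \<in> ?V" "y \<in> ?V" for i x y
  proof -
    obtain M where M: "plus2 m x y = deg M" "set_mset M \<subseteq> ?E" using max_degreesE[OF xy] by metis
    have "(\<Sum>v\<in>?V. lam i v * int (deg M v)) = 2 * int (count M (ed i))"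
    proof (rule sum_potential[OF E M(2)])
      fix f assume "f \<in> ?E"
      then obtain j where "j \<in> I" "f = ed j" by auto
      then show "(\<Sum>v\<in>f. lam i v) = (if f = ed i then 2 else 0)"
        using left[OF i, of j] inj[OF i, of j] by (cases "i = j") auto
    qed
    then have "B i + lam i x + lam i y = 2 * int (count M (ed i))"
      unfolding M(1)[symmetric] sum_plus2[OF V V'] B_def by simp
    then show ?thesis by simp
  qed
  \<comment> \<open>Twice the multiplicity that edge \<open>i\<close> must have in a multiset with
    degrees \<open>m + q + r\<close>.\<close>
  define X where "X i = B i + lam i q + lam i r" for i
  have X: "0 \<le> X i \<and> even (X i)" if i: "i \<in> I" for i
  proof -
    obtain x y where xy: "x \<in> {p, s}" "y \<in> {q, r}" "lam i x < lam i y + 2"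
      using no i by (meson not_le)
    \<comment> \<open>\<open>z\<close> is the other one of \<open>q\<close> and \<open>r\<close>.
      Then \<open>m + x + z\<close> is a side of the square, and passing from it to
      \<open>m + q + r\<close> adds \<open>lam i y - lam i x\<close>, which is even and larger than
      -2, hence nonnegative.\<close>
    define z where "z = (if y = q then r else q)"
    have z: "lam i y + lam i z = lam i q + lam i r" "z \<in> {q, r}" using xy(2) by (auto simp: z_def)
    have "plus2 m x z \<in> max_degrees ?E c"
      using b xy(1) z(2) plus2_commute[of m] unfolding bad_square_def by auto
    then have "even (B i + lam i x + lam i z)" "0 \<le> B i + lam i x + lam i z"
      using pot[OF i, of x z] xy(1) z(2) pV qV rV sV by auto
    moreover have "even (lam i x + lam i y)" using parity[OF i, of x y] xy pV qV rV sV by auto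
    moreover have "X i = (B i + lam i x + lam i z) + (lam i y - lam i x)"
      unfolding X_def using z(1) by simp
    ultimately show ?thesis using xy(3) by presburger
  qed
  define N where "N = (\<Sum>i\<in>I. replicate_mset (nat (X i div 2)) (ed i))"
  have dN: "deg N v = (\<Sum>i\<in>I. if v \<in> ed i then nat (X i div 2) else 0)" for v
  proof -
    have "deg (\<Sum>i\<in>J. replicate_mset (nat (X i div 2)) (ed i)) v =
      (\<Sum>i\<in>J. if v \<in> ed i then nat (X i div 2) else 0)" if "finite J" for J
      using that by (induction J) (auto simp: deg_replicate_mset)
    then show ?thesis using I by (simp add: N_def)
  qed
  have "deg N v = plus2 m q r v" for v
  proof (cases "v \<in> ?V")
    case True
    have "2 * int (deg N v) = (\<Sum>i\<in>I. if v \<in> ed i then X i else 0)"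
      unfolding dN of_nat_sum sum_distrib_left
    proof (intro sum.cong refl)
      fix i assume "i \<in> I"
      then show "2 * int (if v \<in> ed i then nat (X i div 2) else 0) = (if v \<in> ed i then X i else 0)"
        using X[of i] by auto
    qed
    also have "\<dots> = (\<Sum>i\<in>I. \<Sum>u\<in>?V. (if v \<in> ed i then lam i u else 0) * int (plus2 m q r u))"
      unfolding X_def B_def sum_plus2[OF V qV rV, symmetric] by (intro sum.cong) auto
    also have "\<dots> = (\<Sum>u\<in>?V. (\<Sum>i\<in>I. if v \<in> ed i then lam i u else 0) * int (plus2 m q r u))"
      by (subst sum.swap) (simp add: sum_distrib_right)
    also have "\<dots> = (\<Sum>u\<in>?V. (if u = v then 2 else 0) * int (plus2 m q r u))"
      by (intro sum.cong refl) (simp add: right[OF _ True])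
    also have "\<dots> = (\<Sum>u\<in>?V. if u = v then 2 * int (plus2 m q r u) else 0)"
      by (intro sum.cong) auto
    also have "\<dots> = 2 * int (plus2 m q r v)" using True V by simp
    finally show ?thesis by simp
  next
    case False
    then have "deg N v = 0" unfolding dN by (intro sum.neutral) auto
    moreover have "plus2 m q r v = 0" using pqrs(2)[OF False] False qV rV by (auto simp: plus2_def)
    ultimately show ?thesis by simp
  qed
  then have "deg N = plus2 m q r" by blast
  moreover have "set_mset N \<subseteq> ?E" unfolding N_def using I by (auto simp: set_mset_sum split: if_splits)
  ultimately show False using bad_square_not_realizable[OF E b] by blast
qed

lemma deg_image_mset:
  assumes "inj_on f V" "\<And>e. e \<in># M \<Longrightarrow> e \<subseteq> V"
  shows "deg (image_mset ((`) f) M) x = (if x \<in> f ` V then deg M (inv_into V f x) else 0)"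
  using assms(2)
proof (induction M)
  case (add e M)
  have "x \<in> f ` e \<longleftrightarrow> x \<in> f ` V \<and> inv_into V f x \<in> e"
    using add.prems[of e] assms(1) by (auto simp: inv_into_f_f subset_iff)
  then show ?case using add by simp
qed simp

text \<open>Capacity zero outside the image reduces an induced subgraph to the whole graph.\<close>

lemma always_exchange_closed_transfer:
  fixes f :: "'a \<Rightarrow> 'b"
  assumes H: "always_exchange_closed H" "pair_edges H"
    and E: "pair_edges E" "\<And>e. e \<in> E \<Longrightarrow> e \<subseteq> V"
    and f: "inj_on f V" "\<And>u v. u \<in> V \<Longrightarrow> v \<in> V \<Longrightarrow> {u, v} \<in> E \<longleftrightarrow> {f u, f v} \<in> H"
  shows "always_exchange_closed E"
  unfolding always_exchange_closed_def
proof
  fix c :: "'a \<Rightarrow> nat"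
  define lift where "lift w x = (if x \<in> f ` V then w (inv_into V f x) else 0)" for w :: "'a \<Rightarrow> nat" and x
  have lift_f: "lift w (f v) = w v" if "v \<in> V" for w v
    using that f(1) by (simp add: lift_def inv_into_f_f)
  let ?im = "image_mset ((`) f) :: 'a set multiset \<Rightarrow> 'b set multiset"
  have deg_im: "deg (?im M) = lift (deg M)" if "set_mset M \<subseteq> E" for M
  proof
    fix x show "deg (?im M) x = lift (deg M) x"
      unfolding lift_def by (rule deg_image_mset[OF f(1)]) (use that E(2) in auto)
  qed
  have fwd: "?im M \<in> bmatchings H (lift c)" if M: "M \<in> bmatchings E c" for M
  proof -
    have sub: "set_mset M \<subseteq> E" using M by (simp add: bmatchings_def)
    have "f ` e \<in> H" if "e \<in># M" for e
    proof -
      have e: "e \<in> E" "e \<subseteq> V" "card e = 2" using that sub E by (auto simp: pair_edges_def)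
      then obtain u v where "e = {u, v}" by (auto simp: card_2_iff)
      then show ?thesis using e f(2)[of u v] by simp
    qed
    moreover have "lift (deg M) x \<le> lift c x" for x
      using M by (simp add: lift_def bmatchings_def)
    ultimately show ?thesis unfolding bmatchings_def by (auto simp: deg_im[OF sub])
  qed
  have bwd: "\<exists>M\<in>bmatchings E c. N = ?im M" if N: "N \<in> bmatchings H (lift c)" for N
  proof -
    have inV: "x \<in> f ` V" if "e \<in># N" "x \<in> e" for e x
    proof -
      have "0 < deg N x" using that by (auto simp: deg_pos_iff)
      moreover have "deg N x \<le> lift c x" using N by (simp add: bmatchings_def)
      ultimately show ?thesis by (auto simp: lift_def split: if_splits)
    qed
    define M where "M = image_mset (\<lambda>e. inv_into V f ` e) N"
    have im: "f ` inv_into V f ` e = e" if "e \<in># N" for e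
      using inV[OF that] by (force simp: image_image f_inv_into_f)
    have "?im M = image_mset (\<lambda>e. e) N"
      unfolding M_def image_mset.compositionality comp_def by (rule image_mset_cong) (rule im)
    then have NM: "N = ?im M" by simp
    have "inv_into V f ` e \<in> E" if e: "e \<in># N" for e
    proof -
      have "e \<in> H" using e N by (auto simp: bmatchings_def)
      then have "card e = 2" using H(2) by (simp add: pair_edges_def)
      then obtain x y where xy: "e = {x, y}" by (auto simp: card_2_iff)
      then have "x \<in> f ` V" "y \<in> f ` V" using inV[OF e] by auto
      then show ?thesis
        using f(2)[of "inv_into V f x" "inv_into V f y"] xy \<open>e \<in> H\<close>
        by (simp add: inv_into_into f_inv_into_f)
    qed
    then have sub: "set_mset M \<subseteq> E" by (auto simp: M_def)
    have "deg M v \<le> c v" for v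
    proof (cases "v \<in> V")
      case True
      have "deg N (f v) \<le> lift c (f v)" using N by (simp add: bmatchings_def)
      then show ?thesis unfolding NM deg_im[OF sub] lift_f[OF True] .
    next
      case False
      then have "deg M v = 0" using deg_pos_in[OF sub, of v] E(2) by blast
      then show ?thesis by simp
    qed
    then show ?thesis using sub NM by (auto simp: bmatchings_def)
  qed
  have fwd_max: "?im M \<in> max_bmatchings H (lift c)" if M: "M \<in> max_bmatchings E c" for M
    unfolding max_bmatchings_def
  proof (intro CollectI conjI ballI)
    show "?im M \<in> bmatchings H (lift c)" using M fwd by (simp add: max_bmatchings_def)
    fix N assume "N \<in> bmatchings H (lift c)"
    then obtain M' where "M' \<in> bmatchings E c" "N = ?im M'" using bwd by blast
    then show "size N \<le> size (?im M)" using M unfolding max_bmatchings_def by simp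
  qed
  have fwd_deg: "lift w \<in> max_degrees H (lift c)" if w: "w \<in> max_degrees E c" for w
  proof -
    obtain M where M: "M \<in> max_bmatchings E c" "w = deg M" "set_mset M \<subseteq> E" using max_degreesE[OF w] by metis
    then show ?thesis using fwd_max[OF M(1)] unfolding max_degrees_def M(2) deg_im[OF M(3), symmetric]
      by (intro imageI)
  qed
  have bwd_deg: "w \<in> max_degrees E c" if w: "lift w \<in> max_degrees H (lift c)" "\<And>v. v \<notin> V \<Longrightarrow> w v = 0" for w
  proof -
    obtain N where N: "N \<in> max_bmatchings H (lift c)" "lift w = deg N" using max_degreesE[OF w(1)] by metis
    then have "N \<in> bmatchings H (lift c)" by (simp add: max_bmatchings_def)
    then obtain M where M: "M \<in> bmatchings E c" "N = ?im M" using bwd by blast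
    have sub: "set_mset M \<subseteq> E" using M(1) by (simp add: bmatchings_def)
    have "M \<in> max_bmatchings E c"
      unfolding max_bmatchings_def
    proof (intro CollectI conjI ballI M(1))
      fix M' assume "M' \<in> bmatchings E c"
      then have "?im M' \<in> bmatchings H (lift c)" by (rule fwd)
      then have "size (?im M') \<le> size N" using N(1) unfolding max_bmatchings_def by blast
      then show "size M' \<le> size M" by (simp add: M(2))
    qed
    moreover have "w = deg M"
    proof
      fix v
      show "w v = deg M v"
      proof (cases "v \<in> V")
        case True
        then show ?thesis
          using N(2) M(2) deg_im[OF sub] lift_f[OF True, of w] lift_f[OF True, of "deg M"] by simp
      next
        case False
        then show ?thesis using w(2) deg_pos_in[OF sub, of v] E(2) by fastforce
      qed
    qed
    ultimately show ?thesis by (simp add: max_degrees_def)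
  qed
  show "exchange_closed (max_degrees E c)"
    unfolding exchange_closed_def
  proof (intro ballI allI impI)
    fix w w' x y
    assume w: "w \<in> max_degrees E c" "w' \<in> max_degrees E c" and less: "w' x < w x" "w y < w' y"
    have out: "u v = 0" if u: "u \<in> max_degrees E c" "v \<notin> V" for u v
    proof -
      obtain M where M: "u = deg M" "set_mset M \<subseteq> E" using max_degreesE[OF u(1)] by metis
      show ?thesis using deg_pos_in[OF M(2), of v] E(2) u(2) unfolding M(1) by blast
    qed
    have V: "x \<in> V" "y \<in> V" using out[OF w(1), of x] out[OF w(2), of y] less by (metis not_less_zero)+
    have eq: "shift (lift w) (f x) (f y) = lift (shift w x y)"
    proof
      fix z show "shift (lift w) (f x) (f y) z = lift (shift w x y) z"
      proof (cases "z \<in> f ` V")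
        case True
        then obtain v where v: "v \<in> V" "z = f v" by blast
        have "f v = f x \<longleftrightarrow> v = x" "f v = f y \<longleftrightarrow> v = y" "f y = f x \<longleftrightarrow> y = x"
          using f(1) v(1) V by (auto simp: inj_on_def)
        then show ?thesis using v V by (simp add: shift_def lift_f)
      next
        case False
        then show ?thesis using V by (auto simp: shift_def lift_def)
      qed
    qed
    have "lift (shift w x y) \<in> max_degrees H (lift c)"
      unfolding eq[symmetric]
      using H(1) fwd_deg[OF w(1)] fwd_deg[OF w(2)] less V
      unfolding always_exchange_closed_def exchange_closed_def by (simp add: lift_f)
    then show "shift w x y \<in> max_degrees E c"
      using out[OF w(1)] V by (intro bwd_deg) (auto simp: shift_def)
  qed
qed

text \<open>Graphs on the vertices \<open>0, \<dots>, n - 1\<close> given by edge lists, for checking by evaluation.\<close>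

definition edge_of :: "nat \<times> nat \<Rightarrow> nat set" where
  "edge_of e = {fst e, snd e}"

definition list_edges :: "(nat \<times> nat) list \<Rightarrow> nat set set" where
  "list_edges es = edge_of ` set es"

definition adjacent :: "(nat \<times> nat) list \<Rightarrow> nat \<Rightarrow> nat \<Rightarrow> bool" where
  "adjacent es u v \<longleftrightarrow> list_ex (\<lambda>e. e = (u, v) \<or> e = (v, u)) es"

definition neighbours :: "nat \<Rightarrow> (nat \<times> nat) list \<Rightarrow> nat \<Rightarrow> nat list" where
  "neighbours n es u = filter (adjacent es u) [0..<n]"

definition list_graph :: "nat \<Rightarrow> (nat \<times> nat) list \<Rightarrow> bool" where
  "list_graph n es \<longleftrightarrow> list_all (\<lambda>e. fst e < n \<and> snd e < n \<and> fst e \<noteq> snd e) es"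

text \<open>The hypotheses of \<open>bad_square_leaf\<close> in executable form.\<close>

definition leaf_excluded :: "nat \<Rightarrow> (nat \<times> nat) list \<Rightarrow> nat \<Rightarrow> nat \<Rightarrow> bool" where
  "leaf_excluded n es u x \<longleftrightarrow> (case neighbours n es u of
     [t] \<Rightarrow> list_all (\<lambda>z. z = u \<or> adjacent es x z) (neighbours n es t) | _ \<Rightarrow> False)"

definition candidate_pair :: "nat \<Rightarrow> (nat \<times> nat) list \<Rightarrow> int list \<Rightarrow> nat \<Rightarrow> nat \<Rightarrow> bool" where
  "candidate_pair n es row p q \<longleftrightarrow> row ! q + 2 \<le> row ! p \<and> \<not> adjacent es p q
    \<and> \<not> leaf_excluded n es p q \<and> \<not> leaf_excluded n es q p"

text \<open>The pair \<open>p\<close>, \<open>s\<close> enters a bad square symmetrically, so it is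
  listed once with the larger vertex first. Two common partners are demanded because
  \<open>q\<close> and \<open>r\<close> differ.\<close>

definition candidates :: "nat \<Rightarrow> (nat \<Rightarrow> nat \<Rightarrow> bool) \<Rightarrow> (nat \<times> nat \<times> nat list) list" where
  "candidates n P = concat (map (\<lambda>p. let Q = filter (P p) [0..<n] in
    filter (\<lambda>(p, s, qs). 2 \<le> length qs) (map (\<lambda>s. (p, s, filter (P s) Q)) [0..<p])) [0..<n])"

text \<open>Twice the inverse of the incidence matrix, checked from the left and from the right; the
  last conjunct supplies the parity condition of \<open>bad_square_potential\<close>.\<close>

definition half_inverse :: "nat \<Rightarrow> (nat \<times> nat) list \<Rightarrow> int list list \<Rightarrow> bool" where
  "half_inverse n es rows \<longleftrightarrow>
    list_all (\<lambda>i. list_all (\<lambda>j. rows ! i ! fst (es ! j) + rows ! i ! snd (es ! j) = (if i = j then 2 else 0))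
      [0..<length es]) [0..<length es]
  \<and> list_all (\<lambda>u. list_all (\<lambda>v.
      sum_list (map (\<lambda>i. if v = fst (es ! i) \<or> v = snd (es ! i) then rows ! i ! u else 0) [0..<length es])
      = (if u = v then 2 else 0)) [0..<n]) [0..<n]
  \<and> list_all (\<lambda>i. list_all (\<lambda>u. rows ! i ! u mod 2 = rows ! i ! 0 mod 2) [0..<n]) [0..<length es]"

lemma adjacent_iff: "adjacent es u v \<longleftrightarrow> {u, v} \<in> list_edges es"
  unfolding adjacent_def list_edges_def edge_of_def list_ex_iff
  by (force simp: doubleton_eq_iff)

lemma list_graphD:
  assumes "list_graph n es"
  shows "pair_edges (list_edges es)" "\<Union>(list_edges es) \<subseteq> {..<n}"
  using assms unfolding list_graph_def pair_edges_def list_edges_def edge_of_def list_all_iff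
  by auto

lemma set_neighbours:
  assumes "list_graph n es"
  shows "z \<in> set (neighbours n es t) \<longleftrightarrow> {t, z} \<in> list_edges es"
  using list_graphD(2)[OF assms] by (auto simp: neighbours_def adjacent_iff)

lemma candidates_complete:
  assumes "p < n" "s < n" "q < n" "r < n" "p \<noteq> s" "q \<noteq> r" "P p q" "P p r" "P s q" "P s r"
  shows "\<exists>x y qs. (x, y, qs) \<in> set (candidates n P) \<and> {x, y} = {p, s} \<and> q \<in> set qs \<and> r \<in> set qs"
proof -
  have *: "\<exists>qs. (x, y, qs) \<in> set (candidates n P) \<and> q \<in> set qs \<and> r \<in> set qs"
    if "x < n" "y < x" "P x q" "P x r" "P y q" "P y r" for x y
  proof -
    let ?qs = "filter (P y) (filter (P x) [0..<n])"
    have sub: "{q, r} \<subseteq> set ?qs" using that assms by auto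
    have "2 = card {q, r}" using assms(6) by simp
    also have "\<dots> \<le> card (set ?qs)" using sub by (intro card_mono) auto
    also have "\<dots> \<le> length ?qs" by (rule card_length)
    finally have "(x, y, ?qs) \<in> set (candidates n P)"
      using that unfolding candidates_def
      by (auto simp: Let_def intro!: bexI[of _ x] image_eqI[of _ _ y])
    then show ?thesis using sub by blast
  qed
  show ?thesis
    using *[of p s] *[of s p] assms by (cases "s < p") (auto simp: insert_commute)
qed

lemma leaf_excluded:
  assumes G: "list_graph n es" and b: "bad_square (max_degrees (list_edges es) c) m p q r s"
    and ux: "(u = p \<and> x = q) \<or> (u = q \<and> x = p)"
  shows "\<not> leaf_excluded n es u x"
proof
  assume "leaf_excluded n es u x"
  then obtain t where t: "neighbours n es u = [t]"
    "\<And>z. z \<in> set (neighbours n es t) \<Longrightarrow> z = u \<or> adjacent es x z"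
    unfolding leaf_excluded_def list_all_iff by (auto split: list.splits)
  have nb: "{u, z} \<in> list_edges es \<longleftrightarrow> z = t" for z
    using set_neighbours[OF G, of z u] t(1) by auto
  have "e = {u, t}" if e: "e \<in> list_edges es" "u \<in> e" for e
  proof -
    obtain a b where "e = {a, b}" using e(1) by (auto simp: list_edges_def edge_of_def)
    then show ?thesis using e nb[of a] nb[of b] by (auto simp: insert_commute)
  qed
  moreover have "u \<noteq> t"
    using nb[of t] list_graphD(1)[OF G] unfolding pair_edges_def by force
  ultimately have "leaf_at (list_edges es) u t"
    using nb by (simp add: leaf_at_def)
  from bad_square_leaf[OF list_graphD(1)[OF G] b this _ ux] show False
    using t(2) by (auto simp: set_neighbours[OF G] adjacent_iff)
qed

text \<open>By the symmetries of the square, each pair of one of \<open>p\<close>, \<open>s\<close>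
  and one of \<open>q\<close>, \<open>r\<close> can play the part of the side \<open>p, q\<close>,
  so all four pairs must pass the pairwise tests.\<close>

lemma bad_square_candidates:
  assumes G: "list_graph n es" and rows: "half_inverse n es rows"
    and b: "bad_square (max_degrees (list_edges es) c) m p q r s"
  shows "\<exists>i<length es. \<exists>x y qs. (x, y, qs) \<in> set (candidates n (candidate_pair n es (rows ! i)))
    \<and> {x, y} = {p, s} \<and> q \<in> set qs \<and> r \<in> set qs"
proof -
  define ed where "ed i = edge_of (es ! i)" for i
  let ?I = "{..<length es}"
  have E: "list_edges es = ed ` ?I"
  proof -
    have "set es = (!) es ` ?I" by (auto simp: set_conv_nth)
    then show ?thesis by (simp add: list_edges_def ed_def image_image)
  qed
  have V: "\<Union>(ed ` ?I) \<subseteq> {..<n}" using list_graphD(2)[OF G] unfolding E .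
  have ne: "fst (es ! j) \<noteq> snd (es ! j)" if "j < length es" for j
    using G that by (auto simp: list_graph_def list_all_length)
  note rows = rows[unfolded half_inverse_def list_all_iff set_upt]
  note left = rows[THEN conjunct1] and right = rows[THEN conjunct2, THEN conjunct1]
    and par = rows[THEN conjunct2, THEN conjunct2]
  have "\<exists>i\<in>?I. \<forall>x\<in>{p, s}. \<forall>y\<in>{q, r}. rows ! i ! y + 2 \<le> rows ! i ! x"
  proof (rule bad_square_potential[where ed = ed and lam = "\<lambda>i v. rows ! i ! v"])
    show "pair_edges (ed ` ?I)" using list_graphD(1)[OF G] by (simp add: E)
    show "finite ?I" by simp
    show "bad_square (max_degrees (ed ` ?I) c) m p q r s" using b by (simp add: E)
    show "(\<Sum>v\<in>ed j. rows ! i ! v) = (if i = j then 2 else 0)" if "i \<in> ?I" "j \<in> ?I" for i j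
      using left that ne[of j] by (simp add: ed_def edge_of_def)
    show "(\<Sum>i\<in>?I. if v \<in> ed i then rows ! i ! u else 0) = (if u = v then 2 else 0)"
      if "u \<in> \<Union>(ed ` ?I)" "v \<in> \<Union>(ed ` ?I)" for u v
    proof -
      have "(\<Sum>i\<in>?I. if v \<in> ed i then rows ! i ! u else 0) =
        sum_list (map (\<lambda>i. if v = fst (es ! i) \<or> v = snd (es ! i) then rows ! i ! u else 0) [0..<length es])"
        by (simp add: interv_sum_list_conv_sum_set_nat atLeast0LessThan ed_def edge_of_def)
      then show ?thesis using right that V by (simp add: subset_iff)
    qed
    show "even (rows ! i ! u + rows ! i ! v)"
      if "i \<in> ?I" "u \<in> \<Union>(ed ` ?I)" "v \<in> \<Union>(ed ` ?I)" for i u v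
    proof -
      have "u < n" "v < n" using V that by auto
      then have "rows ! i ! u mod 2 = rows ! i ! 0 mod 2" "rows ! i ! v mod 2 = rows ! i ! 0 mod 2"
        using par[THEN bspec, of i, THEN bspec, of u] par[THEN bspec, of i, THEN bspec, of v] that(1)
        by (simp_all del: mod2_eq_if)
      then show ?thesis by presburger
    qed
  qed
  then obtain i where i: "i < length es" "\<And>x y. x \<in> {p, s} \<Longrightarrow> y \<in> {q, r} \<Longrightarrow> rows ! i ! y + 2 \<le> rows ! i ! x"
    by auto
  have sym: "bad_square (max_degrees (list_edges es) c) m p q r s"
    "bad_square (max_degrees (list_edges es) c) m p r q s"
    "bad_square (max_degrees (list_edges es) c) m s q r p"
    "bad_square (max_degrees (list_edges es) c) m s r q p"
    using b bad_square_swap by metis+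
  have pair: "candidate_pair n es (rows ! i) x y"
    if "bad_square (max_degrees (list_edges es) c) m x y z w" "rows ! i ! y + 2 \<le> rows ! i ! x" for x y z w
    using that leaf_excluded[OF G that(1)] bad_square_nonadjacent(1)[OF that(1)]
    unfolding candidate_pair_def adjacent_iff by blast
  have "p < n" "s < n" "q < n" "r < n" using bad_square_verts(1)[OF b] list_graphD(2)[OF G] by auto
  moreover have "p \<noteq> s" "q \<noteq> r" using b by (auto simp: bad_square_def)
  ultimately show ?thesis
    using candidates_complete[of p n s q r "candidate_pair n es (rows ! i)"]
      pair[OF sym(1)] pair[OF sym(2)] pair[OF sym(3)] pair[OF sym(4)] i by blast
qed

lemma always_exchange_closed_list:
  assumes "list_graph n es" "half_inverse n es rows"
    and "list_all (\<lambda>i. candidates n (candidate_pair n es (rows ! i)) = []) [0..<length es]"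
  shows "always_exchange_closed (list_edges es)"
proof (rule always_exchange_closedI[OF list_graphD(1)[OF assms(1)]])
  fix c m p q r s
  show "\<not> bad_square (max_degrees (list_edges es) c) m p q r s"
    using bad_square_candidates[OF assms(1,2), of c m p q r s] assms(3) by (auto simp: list_all_iff)
qed

section \<open>Models with an odd cycle\<close>

definition heptagon :: "(nat \<times> nat) list" where
  "heptagon = [(0, 1), (1, 2), (2, 3), (3, 4), (4, 5), (5, 6), (6, 0)]"

text \<open>The row of an edge alternates between 1 and -1 along the path that remains when the edge
  is deleted; the odd length puts 1 at both ends.\<close>

lemma heptagon_exchange: "always_exchange_closed (list_edges heptagon)"
  by (rule always_exchange_closed_list[where n = 7 and rows =
   "[[1, 1, -1, 1, -1, 1, -1], [-1, 1, 1, -1, 1, -1, 1], [1, -1, 1, 1, -1, 1, -1], [-1, 1, -1, 1, 1, -1, 1],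
     [1, -1, 1, -1, 1, 1, -1], [-1, 1, -1, 1, -1, 1, 1], [1, -1, 1, -1, 1, -1, 1]]"])
    code_simp+

definition pentagon_tail :: "(nat \<times> nat) list" where
  "pentagon_tail = [(0, 1), (1, 2), (2, 3), (3, 4), (4, 0), (0, 5), (5, 6)]"

text \<open>Rows of cycle edges continue to alternate along the tail. The row of a tail edge
  vanishes on the side of the cycle and alternates between 2 and -2 beyond the edge.\<close>

lemma pentagon_tail_exchange: "always_exchange_closed (list_edges pentagon_tail)"
  by (rule always_exchange_closed_list[where n = 7 and rows =
   "[[1, 1, -1, 1, -1, -1, 1], [-1, 1, 1, -1, 1, 1, -1], [1, -1, 1, 1, -1, -1, 1], [-1, 1, -1, 1, 1, 1, -1],
     [1, -1, 1, -1, 1, -1, 1], [0, 0, 0, 0, 0, 2, -2], [0, 0, 0, 0, 0, 0, 2]]"])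
    code_simp+

text \<open>Vertex \<open>i + 3 * j\<close> is the \<open>j\<close>-th vertex of the path at
  \<open>i\<close>, the numbering that \<open>attachment_embedding\<close> expects.\<close>

definition triangle_paths :: "(nat \<times> nat) list" where
  "triangle_paths = [(0, 1), (1, 2), (2, 0), (0, 3), (1, 4), (2, 5), (3, 6), (4, 7), (5, 8)]"

lemma triangle_paths_exchange: "always_exchange_closed (list_edges triangle_paths)"
  by (rule always_exchange_closed_list[where n = 9 and rows =
   "[[1, 1, -1, -1, -1, 1, 1, 1, -1], [-1, 1, 1, 1, -1, -1, -1, 1, 1], [1, -1, 1, -1, 1, -1, 1, -1, 1],
     [0, 0, 0, 2, 0, 0, -2, 0, 0], [0, 0, 0, 0, 2, 0, 0, -2, 0], [0, 0, 0, 0, 0, 2, 0, 0, -2],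
     [0, 0, 0, 0, 0, 0, 2, 0, 0], [0, 0, 0, 0, 0, 0, 0, 2, 0], [0, 0, 0, 0, 0, 0, 0, 0, 2]]"])
    code_simp+

definition triangle_tail :: "(nat \<times> nat) list" where
  "triangle_tail = [(0, 1), (1, 2), (2, 0), (0, 3), (3, 4), (4, 5)]"

lemma triangle_tail_edges:
  "list_edges triangle_tail = {{0, 1}, {1, 2}, {2, 0}, {0, 3}, {3, 4}, {4, 5}}"
  by (simp add: list_edges_def edge_of_def triangle_tail_def)

lemma deg_count:
  assumes "finite E" "set_mset M \<subseteq> E"
  shows "deg M v = (\<Sum>e\<in>{e \<in> E. v \<in> e}. count M e)"
proof -
  have "deg M v = (\<Sum>e\<in>E. if v \<in> e then count M e else 0)"
    using assms(2)
  proof (induction M)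
    case empty
    show ?case by (subst sum.neutral) auto
  next
    case (add f M)
    have "(\<Sum>e\<in>E. if v \<in> e then count (add_mset f M) e else 0) =
      (\<Sum>e\<in>E. (if e = f then of_bool (v \<in> f) else 0) + (if v \<in> e then count M e else 0))"
      by (intro sum.cong) auto
    then show ?case using add assms(1) by (simp add: sum.distrib)
  qed
  then show ?thesis using assms(1) by (simp add: sum.inter_filter)
qed

text \<open>The sign and leaf tests leave one configuration: the tail vertices \<open>5\<close> and
  \<open>3\<close> against the triangle vertices \<open>1\<close> and \<open>2\<close>. There
  \<open>key\<close> yields both \<open>m 1 < m 2\<close> and \<open>m 2 < m 1\<close>.\<close>

lemma triangle_tail_exchange: "always_exchange_closed (list_edges triangle_tail)"
proof -
  let ?E = "list_edges triangle_tail"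
  have G: "list_graph 6 triangle_tail" by code_simp
  note E = list_graphD(1)[OF G]
  let ?rows = "[[1, 1, -1, -1, 1, -1], [-1, 1, 1, 1, -1, 1], [1, -1, 1, -1, 1, -1], [0, 0, 0, 2, -2, 2],
    [0, 0, 0, 0, 2, -2], [0, 0, 0, 0, 0, 2]] :: int list list"
  have rows: "half_inverse 6 triangle_tail ?rows" by code_simp
  have cand: "list_all (\<lambda>i. list_all (\<lambda>t. t = (5, 3, [1, 2]))
    (candidates 6 (candidate_pair 6 triangle_tail (?rows ! i)))) [0..<6]" by code_simp
  have leaf: "leaf_at ?E 5 4" unfolding triangle_tail_edges leaf_at_def by auto
  have key: "m a < m b"
    if ab: "{a, b} = {1, 2 :: nat}" "a \<noteq> b" and W: "plus2 m a 3 \<in> max_degrees ?E c" "plus2 m a 5 \<in> max_degrees ?E c"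
      and cap: "m b < c b" "m 5 < c 5" for c m and a b :: nat
  proof -
    obtain M where M: "M \<in> max_bmatchings ?E c" "plus2 m a 3 = deg M" "set_mset M \<subseteq> ?E"
      "\<And>v. plus2 m a 3 v \<le> c v" using max_degreesE[OF W(1)] by metis
    obtain M' where M': "plus2 m a 5 = deg M'" "set_mset M' \<subseteq> ?E" using max_degreesE[OF W(2)] by metis
    have a: "a \<in> {1, 2}" "b \<in> {1, 2}" using ab by auto
    \<comment> \<open>In \<open>m + a + 5\<close> the leaf \<open>5\<close> has one unit more than
      in \<open>M\<close>. So in \<open>M\<close> the vertex \<open>4\<close> has degree that
      \<open>{4, 5}\<close> does not supply, and \<open>{3, 4}\<close> must be used.\<close>
    have "m 5 + 1 \<le> m 4"
      using leaf_deg_le[OF leaf M'(2)] a unfolding M'(1)[symmetric] plus2_def by auto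
    moreover have d: "deg M v = (\<Sum>e\<in>{e \<in> ?E. v \<in> e}. count M e)" for v
      using E M(3) by (intro deg_count) (auto simp: pair_edges_def)
    have E4: "{e \<in> ?E. 4 \<in> e} = {{3, 4}, {4, 5}}" and E5: "{e \<in> ?E. 5 \<in> e} = {{4, 5}}"
      unfolding triangle_tail_edges by auto
    have "deg M 4 = count M {3, 4} + deg M 5" unfolding d E4 E5 by (simp add: doubleton_eq_iff)
    then have "m 4 = count M {3, 4} + m 5" using a unfolding M(2)[symmetric] plus2_def by auto
    ultimately have c34: "0 < count M {3, 4}" by linarith
    \<comment> \<open>Otherwise trading \<open>{0, a}\<close> for \<open>{a, b}\<close> frees a unit
      at \<open>0\<close>, and \<open>0, 3, 4, 5\<close> becomes an augmenting path. Hence all edges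
      of \<open>M\<close> at \<open>a\<close> are \<open>{a, b}\<close>, so \<open>a\<close> has at
      most the degree of \<open>b\<close>.\<close>
    have "{0, a} \<notin># M"
    proof
      assume "{0, a} \<in># M"
      then have a0: "{a, 0} \<in># M" by (simp add: insert_commute)
      define N where "N = add_mset {b, a} (M - {#{a, 0}#})"
      have ba: "{b, a} \<in> ?E" using ab unfolding triangle_tail_edges by (metis insert_commute insertCI)
      have "deg M b < c b" using cap(1) ab(2) a unfolding M(2)[symmetric] plus2_def by auto
      from max_bmatchings_rotate[OF M(1) a0 _ ba _ _ this]
      have N: "N \<in> max_bmatchings ?E c" "deg N = shift (deg M) 0 b"
        using ab(2) a unfolding N_def by auto
      have "0 < deg M 0" using a0 unfolding deg_pos_iff by blast
      then have "deg N 0 < c 0" using M(4)[of 0] a unfolding N(2) M(2)[symmetric] shift_def by auto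
      moreover have "deg N 5 < c 5" using cap(2) a unfolding N(2) M(2)[symmetric] shift_def plus2_def by auto
      moreover have "{3, 4} \<in># N"
        using c34 a unfolding N_def by (auto simp: doubleton_eq_iff in_diff_count)
      ultimately show False
        using no_augmenting_path[OF N(1), of 3 4 0 5] unfolding triangle_tail_edges
        by (auto simp: insert_commute)
    qed
    then have c0: "count M {0, a} = 0" by (simp add: count_eq_zero_iff)
    have Ea: "{e \<in> ?E. a \<in> e} = {{0, a}, {a, b}}" "{e \<in> ?E. b \<in> e} = {{0, b}, {a, b}}"
      using ab unfolding triangle_tail_edges by (auto simp: doubleton_eq_iff)
    have ne: "{0, a} \<noteq> {a, b}" "{0, b} \<noteq> {a, b}" using a by (auto simp: doubleton_eq_iff)
    have "deg M a = count M {a, b}" "deg M b = count M {0, b} + count M {a, b}"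
      unfolding d Ea using ne c0 by simp_all
    then show "m a < m b" using a ab(2) unfolding M(2)[symmetric] plus2_def by auto
  qed
  show ?thesis
  proof (rule always_exchange_closedI[OF E], rule notI)
    fix c m p q r s assume b: "bad_square (max_degrees ?E c) m p q r s"
    obtain i x y qs where i: "i < length triangle_tail"
      "(x, y, qs) \<in> set (candidates 6 (candidate_pair 6 triangle_tail (?rows ! i)))"
      and xy: "{x, y} = {p, s}" "q \<in> set qs" "r \<in> set qs"
      using bad_square_candidates[OF G rows b] by blast
    have "i < 6" using i(1) by (simp add: triangle_tail_def)
    then have "(x, y, qs) = (5, 3, [1, 2])"
      using cand i(2) by (auto simp only: list_all_iff set_upt atLeast0LessThan lessThan_iff)
    then have ps: "{p, s} = {5, 3}" and qr: "q \<in> {1, 2}" "r \<in> {1, 2}" using xy by auto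
    have "bad_square (max_degrees ?E c) m 5 q r 3 \<or> bad_square (max_degrees ?E c) m 5 r q 3"
      using ps b bad_square_swap[OF b] bad_square_swap(1)[OF bad_square_swap(2)[OF b]]
      by (auto simp: doubleton_eq_iff)
    moreover have False if b: "bad_square (max_degrees ?E c) m 5 q r 3"
      and qr: "q \<in> {1, 2}" "r \<in> {1, 2}" for q r
    proof -
      have ne: "q \<noteq> r" "{q, r} = {1, 2}" "{r, q} = {1, 2}" using b qr unfolding bad_square_def by auto
      have W: "plus2 m q 3 \<in> max_degrees ?E c" "plus2 m q 5 \<in> max_degrees ?E c"
        "plus2 m r 3 \<in> max_degrees ?E c" "plus2 m r 5 \<in> max_degrees ?E c"
        using b plus2_commute[of m] unfolding bad_square_def by metis+
      note cap = bad_square_capacity[OF b]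
      show False
        using key[OF ne(2) ne(1) W(1,2) cap(3) cap(1)] key[OF ne(3) ne(1)[symmetric] W(3,4) cap(2) cap(1)]
        by simp
    qed
    ultimately show False using qr by blast
  qed
qed

section \<open>Bipartite graphs: signed degree sums and leaves\<close>

lemma bipartite_potential:
  fixes \<sigma> :: "'a \<Rightarrow> int"
  assumes E: "pair_edges E" and \<sigma>: "\<And>f. f \<in> E \<Longrightarrow> (\<Sum>v\<in>f. \<sigma> v) = 0"
    and w: "w \<in> max_degrees E c"
  shows "(\<Sum>v\<in>\<Union>E. \<sigma> v * int (w v)) = 0"
proof -
  obtain M where M: "w = deg M" "set_mset M \<subseteq> E" using max_degreesE[OF w] by metis
  show ?thesis using sum_potential[OF E M(2), of \<sigma> "{}" 0] \<sigma> unfolding M(1) by simp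
qed

text \<open>The signed degree sum vanishes on every side of the square; two sides with a common
  corner therefore have equal signs at their other ends.\<close>

lemma bad_square_bipartite:
  fixes \<sigma> :: "'a \<Rightarrow> int"
  assumes E: "pair_edges E" and \<sigma>: "\<And>f. f \<in> E \<Longrightarrow> (\<Sum>v\<in>f. \<sigma> v) = 0"
    and b: "bad_square (max_degrees E c) m p q r s"
  shows "\<sigma> p = \<sigma> s" and "\<sigma> q = \<sigma> r"
proof -
  note V = pair_edges_finite_verts[OF E] and pqrs = bad_square_verts(1)[OF b]
  have "(\<Sum>v\<in>\<Union>E. \<sigma> v * int (m v)) + \<sigma> x + \<sigma> y = 0"
    if "plus2 m x y \<in> max_degrees E c" "x \<in> \<Union>E" "y \<in> \<Union>E" for x y
    using bipartite_potential[OF E \<sigma> that(1)] sum_plus2[OF V that(2,3), of \<sigma> m] by simp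
  then have "(\<Sum>v\<in>\<Union>E. \<sigma> v * int (m v)) + \<sigma> p + \<sigma> q = 0" "(\<Sum>v\<in>\<Union>E. \<sigma> v * int (m v)) + \<sigma> p + \<sigma> r = 0"
    "(\<Sum>v\<in>\<Union>E. \<sigma> v * int (m v)) + \<sigma> q + \<sigma> s = 0"
    using b pqrs unfolding bad_square_def by auto
  then show "\<sigma> p = \<sigma> s" "\<sigma> q = \<sigma> r" by linarith+
qed

text \<open>In a bipartite graph the exchange partner of \<open>v\<close> lies on the side of \<open>v\<close>, hence differs from \<open>u\<close>.\<close>

lemma bipartite_no_adjacent_deficient:
  fixes \<sigma> :: "'a \<Rightarrow> int"
  assumes E: "pair_edges E" and \<sigma>: "\<And>f. f \<in> E \<Longrightarrow> (\<Sum>v\<in>f. \<sigma> v) = 0" "\<sigma> u \<noteq> \<sigma> v"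
    and uv: "{u, v} \<in> E" and w: "w \<in> max_degrees E c" "w u < c u"
    and w': "w' \<in> max_degrees E c" "w' v < c v"
  shows False
proof -
  have ne: "u \<noteq> v" using \<sigma>(2) by auto
  show False
  proof (cases "w v < c v")
    case True
    then show False using no_augmenting_edge[OF w(1) uv ne w(2)] by blast
  next
    case False
    then have "w' v < w v" using w'(2) by simp
    then obtain y where y: "w y < w' y" "shift w v y \<in> max_degrees E c"
      using mconvex_max_degrees[of E c] E w(1) w'(1) unfolding mconvex_def pair_edges_def by blast
    have yv: "y \<noteq> v" using y(1) \<open>w' v < w v\<close> by auto
    have V: "v \<in> \<Union>E" using uv by auto
    have yV: "y \<in> \<Union>E"
    proof -
      obtain M where M: "w' = deg M" "set_mset M \<subseteq> E" using max_degreesE[OF w'(1)] by metis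
      then show ?thesis using deg_pos_in[OF M(2), of y] y(1) by auto
    qed
    have "(\<Sum>x\<in>\<Union>E. \<sigma> x * int (shift w v y x)) =
      (\<Sum>x\<in>\<Union>E. \<sigma> x * int (w x) + (if x = y then \<sigma> x else 0) - (if x = v then \<sigma> x else 0))"
      using yv \<open>w' v < w v\<close> by (intro sum.cong) (auto simp: shift_def algebra_simps of_nat_diff)
    also have "\<dots> = (\<Sum>x\<in>\<Union>E. \<sigma> x * int (w x)) + \<sigma> y - \<sigma> v"
      using V yV pair_edges_finite_verts[OF E] by (simp add: sum.distrib sum_subtractf)
    finally have "\<sigma> y = \<sigma> v"
      using bipartite_potential[OF E \<sigma>(1) y(2)] bipartite_potential[OF E \<sigma>(1) w(1)] by simp
    then have "shift w v y u = w u" using \<sigma>(2) ne by (auto simp: shift_def)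
    moreover have "shift w v y v < c v"
      using yv \<open>w' v < w v\<close> max_degreesE[OF w(1)] by (metis diff_less fun_upd_same fun_upd_other
        less_le_trans less_nat_zero_code not_gr_zero shift_def zero_less_one)
    ultimately show False using no_augmenting_edge[OF y(2) uv ne] w(2) by simp
  qed
qed

text \<open>If a maximum with degrees \<open>m + r + s\<close> used an edge \<open>{t, z}\<close>
  with \<open>z\<close> other than \<open>p\<close>, trading it for \<open>{p, t}\<close> would free
  \<open>z\<close>, although \<open>z\<close> is adjacent to a corner that has room in some maximum.
  Hence all edges at \<open>t\<close> go to \<open>p\<close>, which gives \<open>m t = m p\<close>,
  and in \<open>m + p + q\<close> the leaf would exceed its neighbour.\<close>

lemma bipartite_leaf:
  fixes \<sigma> :: "'a \<Rightarrow> int"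
  assumes E: "pair_edges E" and \<sigma>: "\<And>f. f \<in> E \<Longrightarrow> (\<Sum>v\<in>f. \<sigma> v) = 0"
    and \<sigma>': "\<And>u v. {u, v} \<in> E \<Longrightarrow> \<sigma> u \<noteq> \<sigma> v"
    and b: "bad_square (max_degrees E c) m p q r s"
    and leaf: "leaf_at E p t"
    and nb: "\<And>z. {t, z} \<in> E \<Longrightarrow> z \<noteq> p \<Longrightarrow> \<exists>d\<in>{p, q, r, s}. {z, d} \<in> E"
  shows False
proof -
  note cap = bad_square_capacity[OF b]
  have dist: "distinct [p, q, r, s]" using b by (simp add: bad_square_def)
  have D: "\<exists>w\<in>max_degrees E c. w d < c d" if "d \<in> {p, q, r, s}" for d
  proof -
    have "plus2 m r s p < c p" "plus2 m r s q < c q" "plus2 m p q r < c r" "plus2 m p q s < c s"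
      using dist cap by (auto simp: plus2_def)
    then show ?thesis using b that unfolding bad_square_def by blast
  qed
  have adj: False if "{u, d} \<in> E" "d \<in> {p, q, r, s}" "w \<in> max_degrees E c" "w u < c u" for u d w
    using bipartite_no_adjacent_deficient[OF E \<sigma> \<sigma>'[OF that(1)] that(1,3,4)] D[OF that(2)] by blast
  have pt: "{p, t} \<in> E" "{t, p} \<in> E" "p \<noteq> t" using leaf by (auto simp: leaf_at_def insert_commute)
  \<comment> \<open>Every corner has room in some maximum, so two corners cannot be
    adjacent.\<close>
  have "t \<notin> {p, q, r, s}"
    using adj[OF pt(2)] D[of t] by auto
  then have tn: "t \<noteq> p" "t \<noteq> q" "t \<noteq> r" "t \<noteq> s" by auto
  obtain M where M: "M \<in> max_bmatchings E c" "plus2 m r s = deg M" "set_mset M \<subseteq> E"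
    "\<And>v. plus2 m r s v \<le> c v"
    using b max_degreesE unfolding bad_square_def by metis
  have pdef: "deg M p < c p" using cap dist unfolding M(2)[symmetric] plus2_def by auto
  have "e = {p, t}" if e: "e \<in># M" "t \<in> e" for e
  proof (rule ccontr)
    assume ne: "e \<noteq> {p, t}"
    have eE: "e \<in> E" using e M(3) by auto
    then have "card e = 2" using E by (simp add: pair_edges_def)
    then obtain z where z: "e = {t, z}" "t \<noteq> z"
      using e(2) unfolding card_2_iff by fastforce
    then have zp: "z \<noteq> p" using ne by auto
    then obtain d where d: "d \<in> {p, q, r, s}" "{z, d} \<in> E" using nb eE z by blast
    have tz: "{t, z} \<in># M" using e z by simp
    note rot = max_bmatchings_rotate[OF M(1) tz z(2) pt(1) pt(3) zp[symmetric] pdef]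
    have "0 < deg M z" using tz unfolding deg_pos_iff by blast
    then have "shift (deg M) z p z < c z" using zp M(4)[of z] unfolding M(2)[symmetric] shift_def by auto
    moreover have "shift (deg M) z p \<in> max_degrees E c"
      unfolding rot(2)[symmetric] max_degrees_def by (rule imageI[OF rot(1)])
    ultimately show False using adj[OF d(2,1)] by blast
  qed
  moreover have "e = {p, t}" if "e \<in># M" "p \<in> e" for e
    using that leaf M(3) by (auto simp: leaf_at_def)
  ultimately have "{#e \<in># M. t \<in> e#} = {#e \<in># M. p \<in> e#}"
    by (intro filter_mset_cong) auto
  then have "deg M t = deg M p" by (simp add: deg_def)
  then have "m t = m p" using tn dist unfolding M(2)[symmetric] plus2_def by auto
  obtain M' where M': "plus2 m p q = deg M'" "set_mset M' \<subseteq> E"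
    using b max_degreesE unfolding bad_square_def by metis
  show False
    using leaf_deg_le[OF leaf M'(2)] tn dist \<open>m t = m p\<close> unfolding M'(1)[symmetric] plus2_def by auto
qed

definition two_sided :: "(nat \<times> nat) list \<Rightarrow> bool list \<Rightarrow> bool" where
  "two_sided es sg \<longleftrightarrow> list_all (\<lambda>e. sg ! fst e \<noteq> sg ! snd e) es"

definition side_pair :: "(nat \<times> nat) list \<Rightarrow> bool list \<Rightarrow> bool \<Rightarrow> nat \<Rightarrow> nat \<Rightarrow> bool" where
  "side_pair es sg b p q \<longleftrightarrow> p \<noteq> q \<and> \<not> adjacent es p q \<and> (sg ! p = sg ! q) = b"

definition side :: "bool list \<Rightarrow> nat \<Rightarrow> int" where
  "side sg v = (if sg ! v then 1 else - 1)"

lemma side_edge: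
  assumes "list_graph n es" "two_sided es sg"
  shows "f \<in> list_edges es \<Longrightarrow> (\<Sum>v\<in>f. side sg v) = 0"
    and "{u, v} \<in> list_edges es \<Longrightarrow> side sg u \<noteq> side sg v"
proof -
  show "(\<Sum>v\<in>f. side sg v) = 0" if f: "f \<in> list_edges es"
  proof -
    obtain e where e: "e \<in> set es" "f = {fst e, snd e}"
      using f unfolding list_edges_def edge_of_def by blast
    then have "fst e \<noteq> snd e" "sg ! fst e \<noteq> sg ! snd e"
      using assms by (auto simp: list_graph_def two_sided_def list_all_iff)
    then show ?thesis by (simp add: e(2) side_def)
  qed
  show "side sg u \<noteq> side sg v" if "{u, v} \<in> list_edges es"
    using that assms(2) unfolding adjacent_iff[symmetric] adjacent_def list_ex_iff two_sided_def side_def list_all_iff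
    by fastforce
qed

lemma bad_square_side_candidates:
  assumes G: "list_graph n es" and sg: "two_sided es sg"
    and b: "bad_square (max_degrees (list_edges es) c) m p q r s"
  shows "sg ! p = sg ! s" and "sg ! q = sg ! r"
    and "\<exists>x y qs. (x, y, qs) \<in> set (candidates n (side_pair es sg (sg ! p = sg ! q)))
      \<and> {x, y} = {p, s} \<and> q \<in> set qs \<and> r \<in> set qs"
proof -
  note * = bad_square_bipartite[OF list_graphD(1)[OF G] side_edge(1)[OF G sg] b]
  show sgn: "sg ! p = sg ! s" "sg ! q = sg ! r" using * by (auto simp: side_def split: if_splits)
  have "p < n" "s < n" "q < n" "r < n" using bad_square_verts(1)[OF b] list_graphD(2)[OF G] by auto
  moreover have "p \<noteq> s" "q \<noteq> r" "p \<noteq> q" "p \<noteq> r" "s \<noteq> q" "s \<noteq> r" using b by (auto simp: bad_square_def)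
  moreover have "\<not> adjacent es p q" "\<not> adjacent es p r" "\<not> adjacent es s q" "\<not> adjacent es s r"
    using bad_square_nonadjacent[OF b] unfolding adjacent_iff by (simp_all add: insert_commute)
  ultimately show "\<exists>x y qs. (x, y, qs) \<in> set (candidates n (side_pair es sg (sg ! p = sg ! q)))
      \<and> {x, y} = {p, s} \<and> q \<in> set qs \<and> r \<in> set qs"
    using sgn by (intro candidates_complete) (auto simp: side_pair_def)
qed

section \<open>Models with an even cycle\<close>

definition hexagon :: "(nat \<times> nat) list" where
  "hexagon = [(0, 1), (1, 2), (2, 3), (3, 4), (4, 5), (5, 0)]"

text \<open>Three vertices on a side are too few for four corners, and a vertex has only one
  nonneighbour on the other side, while two are required.\<close>

lemma hexagon_exchange: "always_exchange_closed (list_edges hexagon)"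
proof -
  let ?sg = "[True, False, True, False, True, False]"
  have G: "list_graph 6 hexagon" and sg: "two_sided hexagon ?sg" by code_simp+
  have "candidates 6 (side_pair hexagon ?sg True) = []" "candidates 6 (side_pair hexagon ?sg False) = []"
    by code_simp+
  then have "candidates 6 (side_pair hexagon ?sg b) = []" for b by (cases b) simp_all
  then show ?thesis
    using bad_square_side_candidates(3)[OF G sg]
    by (intro always_exchange_closedI[OF list_graphD(1)[OF G]] notI) fastforce
qed

lemma replicate_mset_subset: "x \<in> A \<Longrightarrow> set_mset (replicate_mset n x) \<subseteq> A"
  by auto

text \<open>On a four-cycle, balance between the two sides is the only condition on a degree
  vector.\<close>

lemma square_realize:
  fixes a0 a1 a2 a3 :: nat
  assumes "a0 + a2 = a1 + a3"
  shows "\<exists>N. set_mset N \<subseteq> {{0, 1}, {1, 2}, {2, 3}, {3, 0 :: nat}} \<and>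
    (\<forall>v. deg N v = (if v = 0 then a0 else if v = 1 then a1 else if v = 2 then a2 else if v = 3 then a3 else 0))"
proof -
  \<comment> \<open>Filling \<open>{0, 1}\<close> as far as possible exhausts \<open>0\<close> or
    \<open>1\<close>; the other multiplicities are then forced.\<close>
  define x where "x = min a0 a1"
  define N :: "nat set multiset" where "N = replicate_mset x {0, 1} + replicate_mset (a0 - x) {3, 0}
    + replicate_mset (a1 - x) {1, 2} + replicate_mset (a3 - (a0 - x)) {2, 3}"
  have "deg N v = (if v = 0 then a0 else if v = 1 then a1 else if v = 2 then a2 else if v = 3 then a3 else 0)" for v
    using assms unfolding N_def x_def by (auto simp: deg_replicate_mset)
  moreover have "set_mset N \<subseteq> {{0, 1}, {1, 2}, {2, 3}, {3, 0}}"
    unfolding N_def by (auto split: if_splits)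
  ultimately show ?thesis by blast
qed

text \<open>Some side of the square has the same value at \<open>u\<close> as
  \<open>m + q + r\<close>, and at \<open>t\<close> and \<open>t'\<close> all these vectors agree
  with \<open>m\<close>.\<close>

lemma bad_square_le:
  assumes b: "bad_square W m p q r s" and le: "\<And>w. w \<in> W \<Longrightarrow> w u \<le> w t + w t'"
    and fx: "t \<notin> {p, q, r, s}" "t' \<notin> {p, q, r, s}"
  shows "plus2 m q r u \<le> plus2 m q r t + plus2 m q r t'"
proof -
  have "plus2 m p q u \<le> plus2 m p q t + plus2 m p q t'" "plus2 m r s u \<le> plus2 m r s t + plus2 m r s t'"
    "plus2 m p r u \<le> plus2 m p r t + plus2 m p r t'" "plus2 m q s u \<le> plus2 m q s t + plus2 m q s t'"
    using b by (auto simp: bad_square_def intro: le)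
  moreover have "distinct [p, q, r, s]" using b by (simp add: bad_square_def)
  ultimately show ?thesis using fx unfolding plus2_def
    by (auto simp: of_bool_def split: if_splits)
qed

text \<open>If \<open>t\<close> is not a corner, a side with the right value at \<open>u\<close>
  suffices. If \<open>t\<close> is a corner, then \<open>u\<close> is not, and a side that avoids
  \<open>t\<close> gives the inequality already for \<open>m\<close>.\<close>

lemma bad_square_leaf_le:
  assumes b: "bad_square (max_degrees E c) m p q r s" and leaf: "leaf_at E u t"
    and fx: "u \<notin> {p, q, r, s} \<or> t \<notin> {p, q, r, s}"
  shows "plus2 m q r u \<le> plus2 m q r t"
proof -
  have le: "w u \<le> w t" if w: "w \<in> max_degrees E c" for w
  proof -
    obtain M where "w = deg M" "set_mset M \<subseteq> E" using max_degreesE[OF w] by metis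
    then show ?thesis using leaf_deg_le[OF leaf] by simp
  qed
  have "plus2 m p q u \<le> plus2 m p q t" "plus2 m r s u \<le> plus2 m r s t"
    "plus2 m p r u \<le> plus2 m p r t" "plus2 m q s u \<le> plus2 m q s t"
    using b by (auto simp: bad_square_def intro: le)
  moreover have "distinct [p, q, r, s]" using b by (simp add: bad_square_def)
  ultimately show ?thesis using fx unfolding plus2_def
    by (auto simp: of_bool_def split: if_splits)
qed

text \<open>All corners have one sign, so \<open>m + q + r\<close> has the same signed sum as the
  side \<open>m + p + q\<close>.\<close>

lemma same_side_balanced:
  assumes G: "list_graph n es" and sg: "two_sided es sg"
    and b: "bad_square (max_degrees (list_edges es) c) m p q r s" and side: "sg ! p = sg ! q"
  shows "(\<Sum>v\<in>\<Union>(list_edges es). side sg v * int (plus2 m q r v)) = 0"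
proof -
  note E = list_graphD(1)[OF G]
  note V = bad_square_verts(1)[OF b] and sgn = bad_square_side_candidates(1,2)[OF G sg b]
  have "(\<Sum>v\<in>\<Union>(list_edges es). side sg v * int (plus2 m p q v)) = 0"
    using b by (intro bipartite_potential[OF E side_edge(1)[OF G sg]]) (auto simp: bad_square_def)
  moreover have "side sg p = side sg r" using side sgn by (simp add: side_def)
  ultimately show ?thesis
    using V sum_plus2[OF pair_edges_finite_verts[OF E], of p q "side sg" m]
      sum_plus2[OF pair_edges_finite_verts[OF E], of q r "side sg" m] by simp
qed

definition square_pendants :: "(nat \<times> nat) list" where
  "square_pendants = [(0, 1), (1, 2), (2, 3), (3, 0), (0, 4), (1, 5), (2, 6), (3, 7)]"

lemma square_pendants_edges: "list_edges square_pendants =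
    {{0, 1}, {1, 2}, {2, 3}, {3, 0}, {0, 4}, {1, 5}, {2, 6}, {3, 7}}"
  by (simp add: list_edges_def edge_of_def square_pendants_def)

text \<open>Corners on both sides can only be the four leaves, which \<open>bipartite_leaf\<close>
  excludes. For corners on one side, \<open>m + q + r\<close> is realised: the pendant edges carry
  the degrees of the leaves, and the square carries the balanced rest.\<close>

lemma square_pendants_exchange: "always_exchange_closed (list_edges square_pendants)"
proof -
  let ?sg = "[True, False, True, False, False, True, False, True]" and ?E = "list_edges square_pendants"
  have G: "list_graph 8 square_pendants" and sg: "two_sided square_pendants ?sg" by code_simp+
  note E = list_graphD(1)[OF G]
  have cand: "candidates 8 (side_pair square_pendants ?sg False) = [(6, 4, [5, 7]), (7, 5, [4, 6])]"
    by code_simp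
  have leaf: "leaf_at ?E 4 0" "leaf_at ?E 5 1" "leaf_at ?E 6 2" "leaf_at ?E 7 3"
    unfolding square_pendants_edges leaf_at_def by auto
  have VE: "\<Union>?E = {0, 1, 2, 3, 4, 5, 6, 7}" unfolding square_pendants_edges by auto
  show ?thesis
  proof (rule always_exchange_closedI[OF E], rule notI)
    fix c m p q r s assume b: "bad_square (max_degrees ?E c) m p q r s"
    note sgn = bad_square_side_candidates[OF G sg b]
    show False
    proof (cases "?sg ! p = ?sg ! q")
      case False
      have eqF: "(?sg ! p = ?sg ! q) = False" using False by simp
      obtain x y qs where xy: "(x, y, qs) \<in> set [(6, 4, [5, 7]), (7, 5, [4, 6])]" "{x, y} = {p, s}"
        "q \<in> set qs" "r \<in> set qs"
        using sgn(3) unfolding eqF cand by blast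
      have "q \<noteq> r" using b by (simp add: bad_square_def)
      then have all: "{p, q, r, s} = {4, 5, 6, 7}" using xy by (auto simp: doubleton_eq_iff)
      then have "p \<in> {4, 5, 6, 7}" by auto
      then have lf: "leaf_at ?E p (p - 4)" using leaf by auto
      have "\<exists>d\<in>{p, q, r, s}. {z, d} \<in> ?E" if "{p - 4, z} \<in> ?E" "z \<noteq> p" for z
        using that \<open>p \<in> {4, 5, 6, 7}\<close> unfolding all square_pendants_edges
        by (auto simp: doubleton_eq_iff)
      from bipartite_leaf[OF E side_edge[OF G sg] b lf this] show False .
    next
      case True
      define w where "w = plus2 m q r"
      have same: "?sg ! x = ?sg ! p" if "x \<in> {p, q, r, s}" for x
        using that True sgn(1,2) by (elim insertE emptyE) (simp_all only:)
      \<comment> \<open>A leaf and its neighbour lie on different sides, so they are not both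
        corners.\<close>
      have leaf_le: "w u \<le> w t" if "leaf_at ?E u t" "?sg ! u \<noteq> ?sg ! t" for u t
        unfolding w_def using same[of u] same[of t] that(2) by (intro bad_square_leaf_le[OF b that(1)]) metis
      have le: "w 4 \<le> w 0" "w 5 \<le> w 1" "w 6 \<le> w 2" "w 7 \<le> w 3"
        using leaf_le[OF leaf(1)] leaf_le[OF leaf(2)] leaf_le[OF leaf(3)] leaf_le[OF leaf(4)] by simp_all
      have "(\<Sum>v\<in>{0, 1, 2, 3, 4, 5, 6, 7}. side ?sg v * int (w v)) = 0"
        using same_side_balanced[OF G sg b True] unfolding VE w_def .
      then have "(w 0 - w 4) + (w 2 - w 6) = (w 1 - w 5) + (w 3 - w 7)"
        using le by (simp add: side_def)
      from square_realize[OF this] obtain N where N: "set_mset N \<subseteq> {{0, 1}, {1, 2}, {2, 3}, {3, 0 :: nat}}"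
        "\<And>v. deg N v = (if v = 0 then w 0 - w 4 else if v = 1 then w 1 - w 5 else if v = 2 then w 2 - w 6
          else if v = 3 then w 3 - w 7 else 0)" by blast
      define N' where "N' = N + replicate_mset (w 4) {0, 4} + replicate_mset (w 5) {1, 5}
        + replicate_mset (w 6) {2, 6} + replicate_mset (w 7) {3, 7}"
      have "set_mset N' \<subseteq> ?E"
        unfolding N'_def square_pendants_edges set_mset_union
        by (intro Un_least replicate_mset_subset order_trans[OF N(1)]) simp_all
      moreover have "deg N' = w"
      proof
        fix v
        have "w v = 0" if "v \<notin> {0, 1, 2, 3, 4, 5, 6, 7}"
        proof -
          have "v \<notin> \<Union>?E" using that unfolding VE .
          then have "m v = 0" "v \<noteq> q" "v \<noteq> r" using bad_square_verts[OF b] by auto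
          then show ?thesis unfolding w_def plus2_def by simp
        qed
        then show "deg N' v = w v" unfolding N'_def using le by (auto simp: deg_replicate_mset N(2))
      qed
      ultimately show False using bad_square_not_realizable[OF E b] unfolding w_def by blast
    qed
  qed
qed

definition square_seven :: "(nat \<times> nat) list" where
  "square_seven = [(0, 1), (1, 2), (2, 3), (3, 0), (0, 4), (4, 5), (2, 6)]"

lemma square_seven_edges: "list_edges square_seven =
    {{0, 1}, {1, 2}, {2, 3}, {3, 0}, {0, 4}, {4, 5}, {2, 6}}"
  by (simp add: list_edges_def edge_of_def square_seven_def)

text \<open>Nonadjacency excludes corners on both sides, and the side \<open>0, 2, 5\<close> is too
  small, so the corners are \<open>1, 3, 4, 6\<close>. The tail and the pendant edge are then peeled
  off and the rest is realised on the square.\<close>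

lemma square_seven_exchange: "always_exchange_closed (list_edges square_seven)"
proof -
  let ?sg = "[True, False, True, False, False, True, False]" and ?E = "list_edges square_seven"
  have G: "list_graph 7 square_seven" and sg: "two_sided square_seven ?sg" by code_simp+
  note E = list_graphD(1)[OF G]
  have cand: "candidates 7 (side_pair square_seven ?sg False) = []"
    "list_all (\<lambda>t. \<not> ?sg ! fst t) (candidates 7 (side_pair square_seven ?sg True))"
    by code_simp+
  have leaf: "leaf_at ?E 5 4" "leaf_at ?E 6 2"
    unfolding square_seven_edges leaf_at_def by auto
  have VE: "\<Union>?E = {0, 1, 2, 3, 4, 5, 6}" unfolding square_seven_edges by auto
  \<comment> \<open>Every edge at \<open>4\<close> ends in \<open>0\<close> or \<open>5\<close>.
    This keeps the degree that remains at \<open>0\<close> nonnegative when the tail is peeled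
    off.\<close>
  have path_le: "w 4 \<le> w 0 + w 5" if w: "w \<in> max_degrees ?E c" for w c
  proof -
    obtain M where M: "w = deg M" "set_mset M \<subseteq> ?E" using max_degreesE[OF w] by metis
    have "(\<Sum>v\<in>{4}. deg M v) \<le> (\<Sum>v\<in>{0, 5}. deg M v)"
      using M(2) unfolding square_seven_edges by (intro sum_deg_le) auto
    then show ?thesis by (simp add: M(1))
  qed
  show ?thesis
  proof (rule always_exchange_closedI[OF E], rule notI)
    fix c m p q r s assume b: "bad_square (max_degrees ?E c) m p q r s"
    note sgn = bad_square_side_candidates[OF G sg b]
    obtain x y qs where x: "(x, y, qs) \<in> set (candidates 7 (side_pair square_seven ?sg (?sg ! p = ?sg ! q)))"
      "{x, y} = {p, s}" using sgn(3) by blast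
    have True: "?sg ! p = ?sg ! q"
    proof (rule ccontr)
      assume "\<not> ?thesis"
      then have eqF: "(?sg ! p = ?sg ! q) = False" by (rule Eq_FalseI[THEN meta_eq_to_obj_eq])
      show False using x(1) unfolding eqF cand(1) by simp
    qed
    have eqT: "(?sg ! p = ?sg ! q) = True" using True by simp
    have "\<not> ?sg ! x" using cand(2) x(1) unfolding eqT by (auto simp: list_all_iff)
    then have neg: "\<not> ?sg ! p" "\<not> ?sg ! s" "\<not> ?sg ! q" "\<not> ?sg ! r"
      using x(2) True sgn(1,2) by (auto simp: doubleton_eq_iff)
    define w where "w = plus2 m q r"
    have S: "{p, q, r, s} \<subseteq> {0, 1, 2, 3, 4, 5, 6}" using bad_square_verts(1)[OF b] unfolding VE .
    have S': "x \<in> {1, 3, 4, 6}" if "x \<in> {p, q, r, s}" for x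
    proof -
      have "\<not> ?sg ! x" using that neg by (elim insertE emptyE) (simp_all only: not_False_eq_True)
      moreover have "x \<in> {0, 1, 2, 3, 4, 5, 6}" using that S by blast
      ultimately show ?thesis by auto
    qed
    have out: "5 \<notin> {p, q, r, s}" "2 \<notin> {p, q, r, s}" "0 \<notin> {p, q, r, s}"
      by (rule notI, drule S', simp)+
    have le: "w 5 \<le> w 4" "w 6 \<le> w 2"
      unfolding w_def using bad_square_leaf_le[OF b leaf(1)] bad_square_leaf_le[OF b leaf(2)] out
      by blast+
    have le': "w 4 \<le> w 0 + w 5"
      unfolding w_def by (rule bad_square_le[OF b path_le out(3,1)])
    have "(\<Sum>v\<in>{0, 1, 2, 3, 4, 5, 6}. side ?sg v * int (w v)) = 0"
      using same_side_balanced[OF G sg b True] unfolding VE w_def .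
    then have "(w 0 + w 5 - w 4) + (w 2 - w 6) = w 1 + w 3"
      using le le' by (simp add: side_def)
    from square_realize[OF this] obtain N where N: "set_mset N \<subseteq> {{0, 1}, {1, 2}, {2, 3}, {3, 0 :: nat}}"
      "\<And>v. deg N v = (if v = 0 then w 0 + w 5 - w 4 else if v = 1 then w 1 else if v = 2 then w 2 - w 6
        else if v = 3 then w 3 else 0)" by blast
    define N' where "N' = N + replicate_mset (w 4 - w 5) {0, 4} + replicate_mset (w 5) {4, 5}
      + replicate_mset (w 6) {2, 6}"
    have "set_mset N' \<subseteq> ?E"
      unfolding N'_def square_seven_edges set_mset_union
      by (intro Un_least replicate_mset_subset order_trans[OF N(1)]) simp_all
    moreover have "deg N' = w"
    proof
      fix v
      have "w v = 0" if "v \<notin> {0, 1, 2, 3, 4, 5, 6}"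
      proof -
        have "v \<notin> \<Union>?E" using that unfolding VE .
        then have "m v = 0" "v \<noteq> q" "v \<noteq> r" using bad_square_verts[OF b] by auto
        then show ?thesis unfolding w_def plus2_def by simp
      qed
      then show "deg N' v = w v" unfolding N'_def using le le' by (auto simp: deg_replicate_mset N(2))
    qed
    ultimately show False using bad_square_not_realizable[OF E b] unfolding w_def by blast
  qed
qed

text \<open>
  The triangle \<open>(c, 0), (c, 3), (c, 4)\<close> with the paths \<open>(t, 1), (t, 2)\<close> attached to \<open>(c, 0)\<close>.  Edges are
  indexed by pairs: a triangle edge by the opposite vertex, another edge by its endpoint farther from
  the triangle.
\<close>

definition star_index :: "'a \<Rightarrow> 'a set \<Rightarrow> ('a \<times> nat) set" where
  "star_index c T = {(c, 0), (c, 3), (c, 4)} \<union> T \<times> {1, 2}"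

definition star_edge :: "'a \<Rightarrow> 'a \<times> nat \<Rightarrow> ('a \<times> nat) set" where
  "star_edge c i = (if snd i = 0 then {(c, 3), (c, 4)} else if snd i = 3 then {(c, 0), (c, 4)}
    else if snd i = 4 then {(c, 0), (c, 3)} else if snd i = 1 then {(c, 0), i} else {(fst i, 1), i})"

text \<open>Twice the inverse of the incidence matrix. The row of a triangle edge alternates along
  each path away from the edge; the row of a path edge lives on the part of its path beyond the
  edge.\<close>

definition star_potential :: "'a \<times> nat \<Rightarrow> 'a \<times> nat \<Rightarrow> int" where
  "star_potential i v = (let k = snd v in
    if snd i = 0 then (if k \<in> {1, 3, 4} then 1 else - 1)
    else if snd i = 3 then (if k \<in> {0, 2, 4} then 1 else - 1)
    else if snd i = 4 then (if k \<in> {0, 2, 3} then 1 else - 1)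
    else if snd i = 1 then (if v = i then 2 else if v = (fst i, 2) then - 2 else 0)
    else (if v = i then 2 else 0))"

definition triangle_star :: "'a \<Rightarrow> 'a set \<Rightarrow> ('a \<times> nat) set set" where
  "triangle_star c T = star_edge c ` star_index c T"

lemma star_index_cases:
  assumes "i \<in> star_index c T"
  obtains "i = (c, 0)" | "i = (c, 3)" | "i = (c, 4)" | t where "t \<in> T" "i = (t, 1)" | t where "t \<in> T" "i = (t, 2)"
  using assms by (auto simp: star_index_def)

lemma star_edge_simps [simp]:
  "star_edge c (t, 0) = {(c, 3), (c, 4)}" "star_edge c (t, 3) = {(c, 0), (c, 4)}"
  "star_edge c (t, 4) = {(c, 0), (c, 3)}" "star_edge c (t, Suc 0) = {(c, 0), (t, 1)}"
  "star_edge c (t, 2) = {(t, 1), (t, 2)}"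
  by (auto simp: star_edge_def)

lemma triangle_star_verts: "\<Union>(star_edge c ` star_index c T) \<subseteq> star_index c T"
  by (auto simp: star_index_def)

lemma pair_edges_triangle_star:
  assumes "finite T"
  shows "pair_edges (triangle_star c T)"
proof -
  have "card (star_edge c i) = 2" if "i \<in> star_index c T" for i
    using that by (cases rule: star_index_cases) simp_all
  then show ?thesis using assms by (auto simp: pair_edges_def triangle_star_def star_index_def)
qed

text \<open>The number of vertices is not bounded, so the inverse is verified symbolically and the
  rows are inspected by the second component of a vertex. The recurring exclusion pairs a leaf
  \<open>(t, 2)\<close> with a neighbour of the hub \<open>(c, 0)\<close>, because the hub is the
  only other neighbour of \<open>(t, 1)\<close>.\<close>

lemma triangle_star_exchange:
  assumes T: "finite T"
  shows "always_exchange_closed (triangle_star c T)"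
proof (rule always_exchange_closedI[OF pair_edges_triangle_star[OF T]], rule notI)
  let ?I = "star_index c T" and ?E = "triangle_star c T"
  note E = pair_edges_triangle_star[OF T]
  fix cap m p q r s
  assume b: "bad_square (max_degrees ?E cap) m p q r s"
  have I: "finite ?I" using T by (simp add: star_index_def)
  have left: "(\<Sum>v\<in>star_edge c j. star_potential i v) = (if i = j then 2 else 0)"
    if i: "i \<in> ?I" and j: "j \<in> ?I" for i j
    using i
  proof (cases rule: star_index_cases)
  qed (use j in \<open>(cases rule: star_index_cases; auto simp: star_potential_def)\<close>)+
  have right: "(\<Sum>i\<in>?I. if v \<in> star_edge c i then star_potential i u else 0) = (if u = v then 2 else 0)"
    if u: "u \<in> ?I" and v: "v \<in> ?I" for u v
  proof -
    let ?f = "\<lambda>i. if v \<in> star_edge c i then star_potential i u else 0"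
    have inj: "inj_on (\<lambda>t. (t, k)) T" for k :: nat by (simp add: inj_on_def)
    have I': "?I = {(c, 0), (c, 3), (c, 4)} \<union> ((\<lambda>t. (t, 1)) ` T \<union> (\<lambda>t. (t, 2)) ` T)"
      by (auto simp: star_index_def)
    have "sum ?f ?I = sum ?f {(c, 0), (c, 3), (c, 4)} + (sum ?f ((\<lambda>t. (t, 1)) ` T) + sum ?f ((\<lambda>t. (t, 2)) ` T))"
      unfolding I' using T by (subst sum.union_disjoint; (subst sum.union_disjoint)?) auto
    also have "\<dots> = (?f (c, 0) + ?f (c, 3) + ?f (c, 4)) + ((\<Sum>t\<in>T. ?f (t, 1)) + (\<Sum>t\<in>T. ?f (t, 2)))"
      unfolding sum.reindex[OF inj] comp_def by simp
    finally have *: "sum ?f ?I = (?f (c, 0) + ?f (c, 3) + ?f (c, 4)) + ((\<Sum>t\<in>T. ?f (t, 1)) + (\<Sum>t\<in>T. ?f (t, 2)))" .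
    have d1: "(\<Sum>t\<in>T. star_potential (t, 1) u) = (if u \<in> T \<times> {1} then 2 else if u \<in> T \<times> {2} then - 2 else 0)"
    proof -
      have "(\<Sum>t\<in>T. star_potential (t, 1) u) =
        (\<Sum>t\<in>T. if t = fst u then (if snd u = 1 then 2 else if snd u = 2 then - 2 else 0) else 0)"
        by (cases u, intro sum.cong refl) (simp add: star_potential_def)
      then show ?thesis using T by (cases u) simp
    qed
    show ?thesis
      using v
    proof (cases rule: star_index_cases)
      case 1
      show ?thesis
        unfolding * using u d1 unfolding 1
        by (cases rule: star_index_cases) (auto simp: star_potential_def)
    next
      case 2
      show ?thesis
        unfolding * using u unfolding 2
        by (cases rule: star_index_cases) (auto simp: star_potential_def)
    next
      case 3
      show ?thesis
        unfolding * using u unfolding 3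
        by (cases rule: star_index_cases) (auto simp: star_potential_def)
    next
      case (4 t)
      have "(\<Sum>s\<in>T. ?f (s, 1)) = (\<Sum>s\<in>T. if s = t then star_potential (t, 1) u else 0)"
        "(\<Sum>s\<in>T. ?f (s, 2)) = (\<Sum>s\<in>T. if s = t then star_potential (t, 2) u else 0)"
        unfolding 4(2) by (intro sum.cong; auto)+
      then have eq: "(\<Sum>s\<in>T. ?f (s, 1)) = star_potential (t, 1) u" "(\<Sum>s\<in>T. ?f (s, 2)) = star_potential (t, 2) u"
        using T 4(1) by simp_all
      show ?thesis
        unfolding * eq using u unfolding 4
        by (cases rule: star_index_cases) (auto simp: star_potential_def)
    next
      case (5 t)
      have "(\<Sum>s\<in>T. ?f (s, 1)) = 0"
        "(\<Sum>s\<in>T. ?f (s, 2)) = (\<Sum>s\<in>T. if s = t then star_potential (t, 2) u else 0)"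
        unfolding 5(2) by (intro sum.neutral sum.cong; auto)+
      then have eq: "(\<Sum>s\<in>T. ?f (s, 1)) = 0" "(\<Sum>s\<in>T. ?f (s, 2)) = star_potential (t, 2) u"
        using T 5(1) by simp_all
      show ?thesis
        unfolding * eq using u unfolding 5
        by (cases rule: star_index_cases) (auto simp: star_potential_def)
    qed
  qed
  have "\<exists>i\<in>?I. \<forall>x\<in>{p, s}. \<forall>y\<in>{q, r}. star_potential i y + 2 \<le> star_potential i x"
  proof (rule bad_square_potential[OF E[unfolded triangle_star_def] I left _ _ b[unfolded triangle_star_def]])
    show "(\<Sum>i\<in>?I. if v \<in> star_edge c i then star_potential i u else 0) = (if u = v then 2 else 0)"
      if "u \<in> \<Union>(star_edge c ` ?I)" "v \<in> \<Union>(star_edge c ` ?I)" for u v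
      using that triangle_star_verts[of c T] by (intro right) auto
    show "even (star_potential i u + star_potential i v)" for i u v :: "'a \<times> nat"
      by (simp add: star_potential_def Let_def)
  qed
  then obtain i where i: "i \<in> ?I" and less: "\<And>x y. x \<in> {p, s} \<Longrightarrow> y \<in> {q, r} \<Longrightarrow>
    star_potential i y + 2 \<le> star_potential i x" by blast
  have dist: "p \<noteq> s" "q \<noteq> r" using b by (auto simp: bad_square_def)
  have VI: "{p, q, r, s} \<subseteq> ?I"
    using bad_square_verts(1)[OF b] triangle_star_verts[of c T] unfolding triangle_star_def by blast
  have leaf: "leaf_at ?E (t, 2) (t, 1)" if "t \<in> T" for t
  proof -
    have "{(t, 2), (t, 1)} \<in> ?E"
      using that unfolding triangle_star_def by (intro image_eqI[of _ _ "(t, 2)"]) (auto simp: star_index_def)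
    moreover have "e = {(t, 2), (t, 1)}" if e: "e \<in> ?E" "(t, 2) \<in> e" for e
    proof -
      obtain i where i: "i \<in> ?I" "e = star_edge c i" using e(1) unfolding triangle_star_def by blast
      from i(1) show ?thesis
        using e(2) unfolding i(2) by (cases rule: star_index_cases) auto
    qed
    moreover have "(t, 2 :: nat) \<noteq> (t, 1)" by simp
    ultimately show ?thesis unfolding leaf_at_def by blast
  qed
  have leaf_nb: "z = (c, 0)" if z: "{(t, 1), z} \<in> ?E" "z \<noteq> (t, 2)" for t z
  proof -
    obtain i where i: "i \<in> ?I" "{(t, 1), z} = star_edge c i"
      using z(1) unfolding triangle_star_def by blast
    from i(1) show ?thesis
      using i(2) z(2) by (cases rule: star_index_cases) (auto simp: doubleton_eq_iff)
  qed
  have hub: "{x, (c, 0)} \<in> ?E" if "x \<in> ?I" "snd x \<in> {1, 3, 4}" for x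
    using that(1)
  proof (cases rule: star_index_cases)
    case 2
    then show ?thesis unfolding triangle_star_def
      by (intro image_eqI[of _ _ "(c, 4)"]) (auto simp: star_index_def)
  next
    case 3
    then show ?thesis unfolding triangle_star_def
      by (intro image_eqI[of _ _ "(c, 3)"]) (auto simp: star_index_def)
  next
    case (4 t)
    then show ?thesis unfolding triangle_star_def
      by (intro image_eqI[of _ _ "(t, 1)"]) (auto simp: star_index_def)
  qed (use that(2) in auto)
  have no_leaf: False if b: "bad_square (max_degrees ?E cap) m p q r s"
    and ux: "(snd p = 2 \<and> snd q \<in> {1, 3, 4}) \<or> (snd q = 2 \<and> snd p \<in> {1, 3, 4})" for p q r s
  proof -
    define u x where "u = (if snd p = 2 then p else q)" and "x = (if snd p = 2 then q else p)"
    have ux': "(u = p \<and> x = q) \<or> (u = q \<and> x = p)" "snd u = 2" "snd x \<in> {1, 3, 4}"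
      using ux by (auto simp: u_def x_def)
    have "{p, q, r, s} \<subseteq> ?I"
      using bad_square_verts(1)[OF b] triangle_star_verts[of c T] unfolding triangle_star_def by blast
    then have uI: "u \<in> ?I" "x \<in> ?I" using ux'(1) by auto
    then obtain t where t: "t \<in> T" "u = (t, 2)" using ux'(2) by (auto simp: star_index_def)
    show False
    proof (rule bad_square_leaf[OF E b _ _ ux'(1)])
      show "leaf_at ?E u (t, 1)" using leaf[OF t(1)] t(2) by simp
      show "{x, z} \<in> ?E" if "{(t, 1), z} \<in> ?E" "z \<noteq> u" for z
        using hub[OF uI(2) ux'(3)] leaf_nb[OF that(1)] that(2) t(2) by simp
    qed
  qed
  have nonadj: "{p, q} \<notin> ?E" "{s, q} \<notin> ?E" "{p, r} \<notin> ?E" "{s, r} \<notin> ?E"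
    using bad_square_nonadjacent[OF b] by (simp_all add: insert_commute)
  note swap = bad_square_swap[OF b]
  have I5: "x \<in> ?I \<Longrightarrow> snd x \<in> {0, 1, 2, 3, 4}" for x
    by (auto simp: star_index_def)
  have I0: "x \<in> ?I \<Longrightarrow> snd x = 0 \<Longrightarrow> x = (c, 0)" and I3: "x \<in> ?I \<Longrightarrow> snd x = 3 \<Longrightarrow> x = (c, 3)"
    and I4: "x \<in> ?I \<Longrightarrow> snd x = 4 \<Longrightarrow> x = (c, 4)" for x
    by (auto simp: star_index_def)
  show False
    using i
  proof (cases rule: star_index_cases)
    case 1
    \<comment> \<open>The row takes only the values 1 and -1, so a gap of two puts \<open>p\<close>,
      \<open>s\<close> on 1 and \<open>q\<close>, \<open>r\<close> on -1.\<close>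
    have K: "snd x \<in> {1, 3, 4} \<and> snd y \<in> {0, 2}" if "x \<in> {p, s}" "y \<in> {q, r}" for x y
      using less[OF that] I5[of y] that VI unfolding 1 star_potential_def Let_def
      by (auto split: if_splits)
    have k: "snd p \<in> {1, 3, 4}" "snd q \<in> {0, 2}" using K[of p q] K[of s q] by blast+
    have "q \<noteq> (c, 0)" using nonadj(1) hub[of p] k VI by auto
    then have "snd q \<noteq> 0" using I0[of q] VI by blast
    then have "snd q = 2" using k(2) by simp
    show False by (rule no_leaf[OF b]) (use k(1) \<open>snd q = 2\<close> in simp)
  next
    case 2
    have K: "snd x \<in> {0, 2, 4} \<and> snd y \<in> {1, 3}" if "x \<in> {p, s}" "y \<in> {q, r}" for x y
      using less[OF that] I5[of y] that VI unfolding 2 star_potential_def Let_def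
      by (auto split: if_splits)
    have k: "snd p \<in> {0, 2, 4}" "snd s \<in> {0, 2, 4}" "snd q \<in> {1, 3}" using K[of p q] K[of s q] by blast+
    have "{q, (c, 0)} \<in> ?E" using hub[of q] k(3) VI by auto
    then have "p \<noteq> (c, 0)" "s \<noteq> (c, 0)" using nonadj(1,2) by (auto simp: insert_commute)
    then have "snd p \<noteq> 0" "snd s \<noteq> 0"
      using I0[of p] I0[of s] VI by blast+
    \<comment> \<open>Apart from leaves, \<open>(c, 4)\<close> is the only vertex left for
      \<open>p\<close> and \<open>s\<close>; as they differ, one of them is a leaf.\<close>
    moreover have "\<not> (snd p = 4 \<and> snd s = 4)" using dist(1) I4[of p] I4[of s] VI by auto
    ultimately have "snd p = 2 \<or> snd s = 2" using k(1,2) by auto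
    then show False
    proof
      assume "snd p = 2"
      show False by (rule no_leaf[OF b]) (use k(3) \<open>snd p = 2\<close> in auto)
    next
      assume "snd s = 2"
      show False by (rule no_leaf[OF swap(1)]) (use k(3) \<open>snd s = 2\<close> in auto)
    qed
  next
    case 3
    have K: "snd x \<in> {0, 2, 3} \<and> snd y \<in> {1, 4}" if "x \<in> {p, s}" "y \<in> {q, r}" for x y
      using less[OF that] I5[of y] that VI unfolding 3 star_potential_def Let_def
      by (auto split: if_splits)
    have k: "snd p \<in> {0, 2, 3}" "snd s \<in> {0, 2, 3}" "snd q \<in> {1, 4}" using K[of p q] K[of s q] by blast+
    have "{q, (c, 0)} \<in> ?E" using hub[of q] k(3) VI by auto
    then have "p \<noteq> (c, 0)" "s \<noteq> (c, 0)" using nonadj(1,2) by (auto simp: insert_commute)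
    then have "snd p \<noteq> 0" "snd s \<noteq> 0"
      using I0[of p] I0[of s] VI by blast+
    moreover have "\<not> (snd p = 3 \<and> snd s = 3)" using dist(1) I3[of p] I3[of s] VI by auto
    ultimately have "snd p = 2 \<or> snd s = 2" using k(1,2) by auto
    then show False
    proof
      assume "snd p = 2"
      show False by (rule no_leaf[OF b]) (use k(3) \<open>snd p = 2\<close> in auto)
    next
      assume "snd s = 2"
      show False by (rule no_leaf[OF swap(1)]) (use k(3) \<open>snd s = 2\<close> in auto)
    qed
  next
    case (4 t)
    \<comment> \<open>The row has one positive and one negative vertex, too few to separate two
      pairs.\<close>
    have "x = (t, 1) \<or> y = (t, 2)" if "x \<in> {p, s}" "y \<in> {q, r}" for x y
      using less[OF that] unfolding 4 star_potential_def Let_def by (auto split: if_splits)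
    then show False using dist by (metis insertCI)
  next
    case (5 t)
    have "x = (t, 2)" if "x \<in> {p, s}" "y \<in> {q, r}" for x y
      using less[OF that] unfolding 5 star_potential_def Let_def by (auto split: if_splits)
    then show False using dist by (metis insertCI)
  qed
qed

section \<open>The structure of unicyclic graphs\<close>

lemma rtrancl_distinct_path:
  assumes "(a, b) \<in> R\<^sup>*"
  shows "\<exists>ys. distinct ys \<and> ys \<noteq> [] \<and> hd ys = a \<and> last ys = b \<and> successively (\<lambda>x y. (x, y) \<in> R) ys"
  using assms
proof (induction rule: converse_rtrancl_induct)
  case base
  show ?case by (intro exI[of _ "[b]"]) simp
next
  case (step x y)
  then obtain ys where ys: "distinct ys" "ys \<noteq> []" "hd ys = y" "last ys = b"
    "successively (\<lambda>x y. (x, y) \<in> R) ys" by blast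
  show ?case
  proof (cases "x \<in> set ys")
    case True
    then obtain us vs where "ys = us @ x # vs" by (auto simp: in_set_conv_decomp)
    then show ?thesis using ys
      by (intro exI[of _ "x # vs"]) (auto simp: successively_append_iff)
  next
    case False
    then show ?thesis using ys step(1)
      by (intro exI[of _ "x # ys"]) (auto simp: successively_Cons)
  qed
qed

lemma Suc_mod_less: "i < n \<Longrightarrow> Suc i mod n < n"
  by (rule mod_less_divisor) linarith

lemma cycle_edges_image:
  "cycle_edges xs = (\<lambda>i. {xs ! i, xs ! (Suc i mod length xs)}) ` {..<length xs}"
  by (auto simp: cycle_edges_def)

text \<open>This is what later allows any chosen cycle vertex to be taken as
  \<open>xs ! 0\<close>.\<close>

lemma cycle_edges_rotate: "cycle_edges (rotate k xs) = cycle_edges xs"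
proof -
  have 1: "cycle_edges (rotate1 xs) = cycle_edges xs" for xs :: "'a list"
  proof (cases "xs = []")
    case False
    let ?n = "length xs"
    have n: "0 < ?n" using False by simp
    have nth: "rotate1 xs ! (j mod ?n) = xs ! (Suc j mod ?n)" for j
      using nth_rotate1[of "j mod ?n" xs] n by (simp add: mod_Suc_eq)
    have "cycle_edges (rotate1 xs) = (\<lambda>i. {xs ! (Suc i mod ?n), xs ! (Suc (Suc i) mod ?n)}) ` {..<?n}"
      unfolding cycle_edges_image length_rotate1
    proof (rule image_cong[OF refl])
      fix i assume "i \<in> {..<?n}"
      then show "{rotate1 xs ! i, rotate1 xs ! (Suc i mod ?n)} = {xs ! (Suc i mod ?n), xs ! (Suc (Suc i) mod ?n)}"
        using nth[of i] nth[of "Suc i"] by simp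
    qed
    also have "\<dots> = cycle_edges xs"
      unfolding cycle_edges_image
    proof (intro equalityI subsetI)
      fix e assume "e \<in> (\<lambda>i. {xs ! (Suc i mod ?n), xs ! (Suc (Suc i) mod ?n)}) ` {..<?n}"
      then obtain i where "e = {xs ! (Suc i mod ?n), xs ! (Suc (Suc i) mod ?n)}" by blast
      then show "e \<in> (\<lambda>i. {xs ! i, xs ! (Suc i mod ?n)}) ` {..<?n}"
        using n by (intro image_eqI[of _ _ "Suc i mod ?n"]) (simp_all add: mod_Suc_eq)
    next
      fix e assume "e \<in> (\<lambda>i. {xs ! i, xs ! (Suc i mod ?n)}) ` {..<?n}"
      then obtain i where i: "e = {xs ! i, xs ! (Suc i mod ?n)}" "i < ?n" by blast
      \<comment> \<open>The cyclic predecessor of \<open>i\<close>.\<close>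
      let ?j = "(i + (?n - 1)) mod ?n"
      have j: "Suc ?j mod ?n = i" using i(2) n by (simp add: mod_Suc_eq)
      then have "Suc (Suc ?j) mod ?n = Suc i mod ?n" by (metis mod_Suc_eq)
      then show "e \<in> (\<lambda>i. {xs ! (Suc i mod ?n), xs ! (Suc (Suc i) mod ?n)}) ` {..<?n}"
        using i n j by (intro image_eqI[of _ _ ?j]) (simp_all only: lessThan_iff mod_less_divisor)
    qed
    finally show ?thesis .
  qed simp
  show ?thesis by (induction k) (simp_all add: 1)
qed

lemma cycle_edges_nth_iff:
  assumes "distinct xs" "i < length xs" "j < length xs"
  shows "{xs ! i, xs ! j} \<in> cycle_edges xs \<longleftrightarrow> j = Suc i mod length xs \<or> i = Suc j mod length xs"
proof
  assume "{xs ! i, xs ! j} \<in> cycle_edges xs"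
  then obtain k where k: "k < length xs" "{xs ! i, xs ! j} = {xs ! k, xs ! (Suc k mod length xs)}"
    by (auto simp: cycle_edges_def)
  then have "Suc k mod length xs < length xs" by (intro Suc_mod_less)
  then show "j = Suc i mod length xs \<or> i = Suc j mod length xs"
    using k assms by (auto simp: doubleton_eq_iff nth_eq_iff_index_eq)
next
  assume "j = Suc i mod length xs \<or> i = Suc j mod length xs"
  then show "{xs ! i, xs ! j} \<in> cycle_edges xs"
    using assms unfolding cycle_edges_def by (auto simp: insert_commute)
qed

lemma cycle_edges_subset: "e \<in> cycle_edges xs \<Longrightarrow> e \<subseteq> set xs"
  unfolding cycle_edges_image using Suc_mod_less[of _ "length xs"] by auto

lemma card_cycle_edges:
  assumes "distinct xs" "3 \<le> length xs"
  shows "card (cycle_edges xs) = length xs"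
proof -
  let ?n = "length xs" and ?f = "\<lambda>i. {xs ! i, xs ! (Suc i mod length xs)}"
  have "inj_on ?f {..<?n}"
  proof (rule inj_onI)
    fix i j assume ij: "i \<in> {..<?n}" "j \<in> {..<?n}" "?f i = ?f j"
    have "Suc i mod ?n < ?n" "Suc j mod ?n < ?n" using ij(1,2) Suc_mod_less[of i ?n] Suc_mod_less[of j ?n] by simp_all
    then have "i = j \<or> (i = Suc j mod ?n \<and> j = Suc i mod ?n)"
      using ij assms(1) by (auto simp: doubleton_eq_iff nth_eq_iff_index_eq)
    \<comment> \<open>Two positions that are cyclic successors of each other would force length at
      most two.\<close>
    moreover have False if "i = Suc j mod ?n" "j = Suc i mod ?n"
    proof -
      have step: "Suc k = ?n \<and> Suc k mod ?n = 0 \<or> Suc k mod ?n = Suc k" if "k < ?n" for k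
        using that by (cases "Suc k = ?n") simp_all
      show False
        using step[of i] step[of j] ij(1,2) assms(2) unfolding that[symmetric] by auto
    qed
    ultimately show "i = j" by blast
  qed
  moreover have "cycle_edges xs = ?f ` {..<?n}" by (auto simp: cycle_edges_def)
  ultimately show ?thesis by (simp add: card_image)
qed

text \<open>A path from \<open>a\<close> to \<open>b\<close> that avoids the edge
  \<open>{a, b}\<close> closes up with it to a cycle, and \<open>C\<close> is the only
  cycle.\<close>

lemma unicyclic_bridge:
  assumes G: "unicyclic G" and C: "C \<in> cycles G"
    and e: "{a, b} \<in> edges G" and path: "(a, b) \<in> {(x, y). {x, y} \<in> edges G - {{a, b}}}\<^sup>*"
  shows "{a, b} \<in> C"
proof -
  have simp: "simple_graph G" using G by (simp add: unicyclic_def)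
  let ?R = "{(x, y). {x, y} \<in> edges G - {{a, b}}}"
  have ab: "a \<noteq> b" using edge_irrefl[OF simp e] .
  obtain ys where ys: "distinct ys" "ys \<noteq> []" "hd ys = a" "last ys = b"
    "successively (\<lambda>x y. (x, y) \<in> ?R) ys" using rtrancl_distinct_path[OF path] by blast
  have nth: "(ys ! i, ys ! Suc i) \<in> ?R" if "Suc i < length ys" for i
    using ys(5) that by (auto simp: successively_conv_nth)
  have ends: "ys ! 0 = a" "ys ! (length ys - 1) = b"
    using ys by (simp_all add: hd_conv_nth last_conv_nth)
  have "length ys \<noteq> 1" using ends ab by auto
  moreover have "length ys \<noteq> 2"
  proof
    assume "length ys = 2"
    then show False using nth[of 0] ends by simp
  qed
  moreover have "length ys \<noteq> 0" using ys(2) by simp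
  ultimately have len: "3 \<le> length ys" by linarith
  have edge: "{ys ! i, ys ! (Suc i mod length ys)} \<in> edges G" if "i < length ys" for i
  proof (cases "Suc i < length ys")
    case True
    then show ?thesis using nth[of i] by simp
  next
    case False
    then have "i = length ys - 1" "Suc i = length ys" using that by auto
    then show ?thesis using ends e by (simp add: insert_commute)
  qed
  then have sub: "cycle_edges ys \<subseteq> edges G" by (auto simp: cycle_edges_def)
  have "set ys \<subseteq> verts G"
  proof
    fix v assume "v \<in> set ys"
    then obtain i where "i < length ys" "v = ys ! i" by (auto simp: in_set_conv_nth)
    then show "v \<in> verts G" using edge[of i] edge_verts(1)[OF simp] by blast
  qed
  then have "cycle_edges ys \<in> cycles G" using ys(1) len sub by (auto simp: cycles_def)
  then have "cycle_edges ys = C" using G C by (auto simp: unicyclic_def)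
  moreover have "{b, a} \<in> cycle_edges ys"
  proof -
    have "Suc (length ys - 1) = length ys" using len by linarith
    then have "{b, a} = {ys ! (length ys - 1), ys ! (Suc (length ys - 1) mod length ys)}"
      using ends by simp
    moreover have "length ys - 1 < length ys" using len by linarith
    ultimately show ?thesis unfolding cycle_edges_image by blast
  qed
  then have "{a, b} \<in> cycle_edges ys" by (simp add: insert_commute)
  ultimately show ?thesis by simp
qed

text \<open>
  Off the cycle \<open>xs\<close> the graph is a forest, given by the neighbour \<open>par v\<close> of \<open>v\<close> on the way to the
  cycle; \<open>h v\<close> is the distance of \<open>v\<close> from the cycle.
\<close>

definition rooted :: "'a graph \<Rightarrow> 'a list \<Rightarrow> ('a \<Rightarrow> 'a) \<Rightarrow> ('a \<Rightarrow> nat) \<Rightarrow> bool" where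
  "rooted G xs par h \<longleftrightarrow> simple_graph G \<and> 3 \<le> length xs \<and> distinct xs \<and> set xs \<subseteq> verts G
    \<and> (\<forall>v\<in>set xs. h v = 0)
    \<and> (\<forall>v\<in>verts G - set xs. par v \<in> verts G \<and> h v = Suc (h (par v)))
    \<and> edges G = cycle_edges xs \<union> (\<lambda>v. {v, par v}) ` (verts G - set xs)"

lemma rooted_rotate: "rooted G xs par h \<Longrightarrow> rooted G (rotate k xs) par h"
  by (simp add: rooted_def cycle_edges_rotate)

text \<open>\<open>h\<close> is the distance from the cycle and \<open>par\<close> picks a neighbour
  one step closer. An edge that is neither in \<open>C\<close> nor a parent edge can be removed
  without separating its ends, since every vertex still reaches the cycle along parent edges;
  \<open>unicyclic_bridge\<close> then puts it into \<open>C\<close> after all.\<close>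

lemma unicyclic_rooted:
  assumes G: "unicyclic G" and C: "C \<in> cycles G"
  obtains xs par h where "rooted G xs par h" "length xs = card C"
proof -
  have simp: "simple_graph G" and conn: "connected_graph G" using G by (simp_all add: unicyclic_def)
  obtain xs where xs: "C = cycle_edges xs" "3 \<le> length xs" "distinct xs" "set xs \<subseteq> verts G"
    "cycle_edges xs \<subseteq> edges G" using C by (auto simp: cycles_def)
  let ?R = "{(x, y). {x, y} \<in> edges G}" and ?Z = "set xs" and ?V = "verts G"
  have x0: "xs ! 0 \<in> ?Z" using xs(2) by (intro nth_mem) linarith
  have ex: "\<exists>n. \<exists>z\<in>?Z. (v, z) \<in> ?R ^^ n" if "v \<in> ?V" for v
  proof -
    have "(v, xs ! 0) \<in> ?R\<^sup>*" using conn that x0 xs(4) unfolding connected_graph_def by blast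
    then show ?thesis using x0 rtrancl_imp_relpow by blast
  qed
  define h where "h v = (LEAST n. \<exists>z\<in>?Z. (v, z) \<in> ?R ^^ n)" for v
  have h: "\<exists>z\<in>?Z. (v, z) \<in> ?R ^^ h v" if "v \<in> ?V" for v
    unfolding h_def by (rule LeastI_ex[OF ex[OF that]])
  have h_le: "h v \<le> n" if "z \<in> ?Z" "(v, z) \<in> ?R ^^ n" for v z n
    unfolding h_def using that by (intro Least_le) blast
  have hZ: "h v = 0" if "v \<in> ?Z" for v using h_le[OF that, of v 0] by simp
  have h0: "v \<in> ?Z" if "v \<in> ?V" "h v = 0" for v using h[OF that(1)] that(2) by simp
  have h_edge: "h u \<le> Suc (h v)" if uv: "{u, v} \<in> edges G" for u v
  proof -
    obtain z where z: "z \<in> ?Z" "(v, z) \<in> ?R ^^ h v" using h edge_verts(2)[OF simp uv] by blast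
    have "(u, z) \<in> ?R ^^ Suc (h v)" using uv z(2) by (intro relpow_Suc_I2[of u v]) auto
    then show ?thesis using h_le[OF z(1)] by blast
  qed
  have "\<exists>u. {v, u} \<in> edges G \<and> h v = Suc (h u)" if v: "v \<in> ?V - ?Z" for v
  proof -
    obtain z where z: "z \<in> ?Z" "(v, z) \<in> ?R ^^ h v" using h v by blast
    have "h v \<noteq> 0" using h0 v by blast
    then obtain n where n: "h v = Suc n" by (cases "h v") auto
    then obtain u where u: "(v, u) \<in> ?R" "(u, z) \<in> ?R ^^ n"
      using z(2) relpow_Suc_D2 by metis
    have "h u \<le> n" using h_le[OF z(1) u(2)] .
    moreover have "h v \<le> Suc (h u)" using h_edge u(1) by simp
    ultimately show ?thesis using u(1) n by auto
  qed
  then obtain par where par: "\<And>v. v \<in> ?V - ?Z \<Longrightarrow> {v, par v} \<in> edges G \<and> h v = Suc (h (par v))"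
    by metis
  have parV: "par v \<in> ?V" if "v \<in> ?V - ?Z" for v using par[OF that] edge_verts(2)[OF simp] by blast
  have key: "e \<in> C \<or> e \<in> (\<lambda>v. {v, par v}) ` (?V - ?Z)" if e: "e \<in> edges G" for e
  proof (rule ccontr)
    assume no: "\<not> ?thesis"
    let ?R' = "{(x, y). {x, y} \<in> edges G - {e}}"
    have sym: "sym ?R'" by (auto simp: sym_def insert_commute)
    have cyc: "(xs ! 0, xs ! i) \<in> ?R'\<^sup>*" if "i < length xs" for i
      using that
    proof (induction i)
      case (Suc i)
      have "{xs ! i, xs ! Suc i} \<in> C"
        unfolding xs(1) using Suc.prems cycle_edges_nth_iff[OF xs(3), of i "Suc i"] by simp
      then have "(xs ! i, xs ! Suc i) \<in> ?R'" using xs(1,5) no by auto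
      then show ?case using Suc by (auto intro: rtrancl_into_rtrancl)
    qed simp
    have root: "(v, xs ! 0) \<in> ?R'\<^sup>*" if "v \<in> ?V" for v
      using that
    proof (induction "h v" arbitrary: v)
      case 0
      then obtain i where "i < length xs" "v = xs ! i" using h0[of v] by (auto simp: in_set_conv_nth)
      then show ?case using cyc sym by (metis sym_rtrancl symD)
    next
      case (Suc n)
      then have v: "v \<in> ?V - ?Z" using hZ[of v] by auto
      then have "(v, par v) \<in> ?R'" using par[OF v] no by auto
      moreover have "(par v, xs ! 0) \<in> ?R'\<^sup>*" using Suc par[OF v] parV[OF v] by auto
      ultimately show ?case by (rule converse_rtrancl_into_rtrancl)
    qed
    obtain a b where ab: "e = {a, b}" "a \<in> ?V" "b \<in> ?V" using edgeE[OF simp e] by metis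
    have "(a, b) \<in> ?R'\<^sup>*"
      using root[OF ab(2)] root[OF ab(3)] sym by (meson rtrancl_trans sym_rtrancl symD)
    then have "{a, b} \<in> C" using unicyclic_bridge[OF G C] e ab(1) by simp
    then show False using no ab(1) by simp
  qed
  have "edges G = cycle_edges xs \<union> (\<lambda>v. {v, par v}) ` (?V - ?Z)"
    using key par xs(1,5) by blast
  then have "rooted G xs par h"
    using simp xs hZ par parV by (simp add: rooted_def)
  moreover have "length xs = card C" using card_cycle_edges[OF xs(3,2)] xs(1) by simp
  ultimately show ?thesis by (rule that)
qed

section \<open>Obstructions located in rooted unicyclic graphs\<close>

definition two_claws :: "'a graph \<Rightarrow> bool" where
  "two_claws G \<longleftrightarrow> (\<exists>x1 z1 x2 z2 y1 y2. independent G {x1, z1, x2, z2} \<and> distinct [x1, z1, x2, z2]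
    \<and> {y1, x1} \<in> edges G \<and> {y1, z1} \<in> edges G \<and> {y2, x2} \<in> edges G \<and> {y2, z2} \<in> edges G
    \<and> {y1, x2} \<notin> edges G \<and> {y1, z2} \<notin> edges G)"

lemma two_claws_not_exchange:
  assumes G: "simple_graph G" and "two_claws G"
  shows "\<not> enjoys_strong_exchange TYPE('k::field) G"
proof -
  from assms(2) have "\<exists>c. (\<forall>v\<in>verts G. 0 < c v) \<and> \<not> exchange_closed (max_degrees (edges G) c)"
    unfolding two_claws_def using two_claws_obstruction[OF G] by (elim exE conjE) blast
  then show ?thesis by (auto simp: enjoys_strong_exchange_iff[OF G])
qed

lemma independence_number_le_iff:
  assumes G: "simple_graph G"
  shows "independence_number G \<le> k \<longleftrightarrow> (\<forall>A. independent G A \<longrightarrow> card A \<le> k)"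
proof -
  let ?S = "{card A | A. A \<subseteq> verts G \<and> (\<forall>e\<in>edges G. \<not> e \<subseteq> A)}"
  have "finite (card ` Pow (verts G))" using verts_finite[OF G] by simp
  then have fin: "finite ?S" by (rule finite_subset[rotated]) auto
  have "\<not> e \<subseteq> {}" if "e \<in> edges G" for e using edge_card[OF G that] by auto
  then have "card {} \<in> ?S" by (intro CollectI exI[of _ "{}"]) simp
  then have "?S \<noteq> {}" by blast
  then show ?thesis
    unfolding independence_number_def using fin by (subst Max_le_iff) (auto simp: independent_def)
qed

lemma two_claws_independence:
  assumes G: "simple_graph G" and "two_claws G"
  shows "\<not> independence_number G \<le> 3"
proof -
  obtain x1 z1 x2 z2 where "independent G {x1, z1, x2, z2}" "distinct [x1, z1, x2, z2]"
    using assms(2) unfolding two_claws_def by blast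
  moreover from this(2) have "card {x1, z1, x2, z2} = 4" by simp
  ultimately show ?thesis unfolding independence_number_le_iff[OF G] by fastforce
qed

locale rooted_graph =
  fixes G :: "'a graph" and xs :: "'a list" and par :: "'a \<Rightarrow> 'a" and h :: "'a \<Rightarrow> nat"
  assumes rooted: "rooted G xs par h"
begin

definition off :: "'a set" where "off = verts G - set xs"

lemma G: "simple_graph G" and len: "3 \<le> length xs" and dist: "distinct xs"
  and cycle_verts: "set xs \<subseteq> verts G"
  and h_cycle: "v \<in> set xs \<Longrightarrow> h v = 0"
  and par_verts: "v \<in> off \<Longrightarrow> par v \<in> verts G"
  and h_par: "v \<in> off \<Longrightarrow> h v = Suc (h (par v))"
  and edges_eq: "edges G = cycle_edges xs \<union> (\<lambda>v. {v, par v}) ` off"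
  using rooted by (auto simp: rooted_def off_def)

lemma off_verts: "v \<in> off \<Longrightarrow> v \<in> verts G" "v \<in> off \<Longrightarrow> v \<notin> set xs"
  by (auto simp: off_def)

lemma adj_iff: "{u, v} \<in> edges G \<longleftrightarrow> {u, v} \<in> cycle_edges xs \<or> (u \<in> off \<and> v = par u) \<or> (v \<in> off \<and> u = par v)"
  unfolding edges_eq by (auto simp: doubleton_eq_iff)

lemma adj_cycle:
  "i < length xs \<Longrightarrow> j < length xs \<Longrightarrow>
    {xs ! i, xs ! j} \<in> edges G \<longleftrightarrow> j = Suc i mod length xs \<or> i = Suc j mod length xs"
  using cycle_edges_nth_iff[OF dist, of i j] off_verts(2)[of "xs ! i"] off_verts(2)[of "xs ! j"]
  by (auto simp: adj_iff)

lemma adj_off: "v \<in> off \<Longrightarrow> {u, v} \<in> edges G \<longleftrightarrow> u = par v \<or> (u \<in> off \<and> par u = v)"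
  "v \<in> off \<Longrightarrow> {v, u} \<in> edges G \<longleftrightarrow> u = par v \<or> (u \<in> off \<and> par u = v)"
  using cycle_edges_subset[of "{u, v}" xs] cycle_edges_subset[of "{v, u}" xs] off_verts(2)[of v]
  by (auto simp: adj_iff)

lemma h_off: "v \<in> off \<Longrightarrow> 0 < h v" using h_par by simp

lemma h0_cycle: "v \<in> verts G \<Longrightarrow> h v = 0 \<Longrightarrow> v \<in> set xs"
  using h_off[of v] by (auto simp: off_def)

lemma ancestor:
  assumes "v \<in> off" "0 < k" "k \<le> h v"
  shows "\<exists>u\<in>off. h u = k"
  using assms
proof (induction "h v" arbitrary: v)
  case (Suc n)
  show ?case
  proof (cases "h v = k")
    case False
    then have "h (par v) = n" "0 < n" "k \<le> n" using Suc h_par[of v] by auto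
    then have "par v \<in> off" using par_verts[OF Suc.prems(1)] h_cycle[of "par v"] by (auto simp: off_def)
    then show ?thesis using Suc.hyps(1)[of "par v"] \<open>h (par v) = n\<close> \<open>k \<le> n\<close> Suc.prems(2) by simp
  qed (use Suc.prems in blast)
qed simp

lemma rotate_to:
  assumes "v \<in> set xs"
  obtains k where "rotate k xs ! 0 = v" "rooted_graph G (rotate k xs) par h"
proof -
  obtain k where k: "k < length xs" "xs ! k = v" using assms by (auto simp: in_set_conv_nth)
  have "0 < length xs" using k(1) by linarith
  then have "rotate k xs ! 0 = v" using k by (simp add: nth_rotate)
  then show ?thesis using rooted_rotate[OF rooted] by (intro that) (simp_all add: rooted_graph_def)
qed

lemma two_clawsI:
  assumes "{y1, x1} \<in> edges G" "{y1, z1} \<in> edges G" "{y2, x2} \<in> edges G" "{y2, z2} \<in> edges G"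
    and "{y1, x2} \<notin> edges G" "{y1, z2} \<notin> edges G"
    and "distinct [x1, z1, x2, z2]"
    and "{x1, z1} \<notin> edges G" "{x1, x2} \<notin> edges G" "{x1, z2} \<notin> edges G"
      "{z1, x2} \<notin> edges G" "{z1, z2} \<notin> edges G" "{x2, z2} \<notin> edges G"
  shows "two_claws G"
proof -
  have "independent G {x1, z1, x2, z2}"
  proof (rule independentI[OF G])
    show "{x1, z1, x2, z2} \<subseteq> verts G" using assms(1-4) edge_verts(2)[OF G] by blast
    fix u v assume "u \<in> {x1, z1, x2, z2}" "v \<in> {x1, z1, x2, z2}"
    then show "{u, v} \<notin> edges G"
      using assms(8-) edge_irrefl[OF G, of u u] by (auto simp: insert_commute)
  qed
  then show ?thesis unfolding two_claws_def using assms(1-7) by blast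
qed

lemma long_cycle:
  assumes "8 \<le> length xs"
  shows "two_claws G"
proof -
  have lt: "i < 7 \<Longrightarrow> Suc i mod length xs = Suc i" "i < 7 \<Longrightarrow> i < length xs" for i using assms by simp_all
  have adj: "{xs ! i, xs ! j} \<in> edges G \<longleftrightarrow> j = Suc i \<or> i = Suc j" if "i < 7" "j < 7" for i j
    using adj_cycle[of i j] lt that by simp
  have neq: "xs ! i = xs ! j \<longleftrightarrow> i = j" if "i < 7" "j < 7" for i j
    using dist lt that by (simp add: nth_eq_iff_index_eq)
  \<comment> \<open>Claws at positions 1 and 5; positions 0 and 6 are nonadjacent because the cycle
    has at least eight vertices.\<close>
  show ?thesis
    by (rule two_clawsI[of "xs ! 1" "xs ! 0" "xs ! 2" "xs ! 5" "xs ! 4" "xs ! 6"])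
      (simp_all add: adj neq)
qed

text \<open>The cycle alone has at most three independent vertices; the branch \<open>p\<close>
  supplies the fourth.\<close>

lemma cycle_branch_6_7:
  assumes l: "length xs = 6 \<or> length xs = 7" and p: "p \<in> off" "par p = xs ! 0"
  shows "two_claws G"
proof -
  have neq: "xs ! i = xs ! j \<longleftrightarrow> i = j" if "i < 6" "j < 6" for i j
    using dist l that by (auto simp: nth_eq_iff_index_eq)
  have pn: "xs ! i \<notin> off" "xs ! i \<noteq> p" "p \<noteq> xs ! i" if "i < 6" for i
    using off_verts(2)[of "xs ! i"] off_verts(2)[OF p(1)] l that by auto
  show ?thesis
    using l by (intro two_clawsI[of "xs ! 4" "xs ! 3" "xs ! 5" "xs ! 0" p "xs ! 1"])
      (auto simp: adj_cycle adj_off p pn neq)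
qed

lemma cycle_4_5:
  assumes l: "length xs = 4 \<or> length xs = 5"
  shows "{xs ! 2, xs ! 1} \<in> edges G" "{xs ! 2, xs ! 3} \<in> edges G" "{xs ! 1, xs ! 3} \<notin> edges G"
    "xs ! 1 \<noteq> xs ! 3" "i < 4 \<Longrightarrow> xs ! i \<in> set xs"
  using l dist by (auto simp: adj_cycle nth_eq_iff_index_eq)

lemma off_adj_cycle: "v \<in> off \<Longrightarrow> z \<in> set xs \<Longrightarrow> {v, z} \<in> edges G \<longleftrightarrow> par v = z"
  "v \<in> off \<Longrightarrow> z \<in> set xs \<Longrightarrow> {z, v} \<in> edges G \<longleftrightarrow> par v = z"
  using off_verts(2)[of z] by (auto simp: adj_off)

lemma off_adj_off: "u \<in> off \<Longrightarrow> v \<in> off \<Longrightarrow> {u, v} \<in> edges G \<longleftrightarrow> par u = v \<or> par v = u"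
  by (auto simp: adj_off)

text \<open>\<open>xs ! 1, xs ! 2, xs ! 3\<close> is one claw, and two nonadjacent vertices off the
  cycle with a common neighbour and no link to it form the other.\<close>

lemma claws_4_5:
  assumes l: "length xs = 4 \<or> length xs = 5" and ab: "a \<in> off" "b \<in> off" "a \<noteq> b"
    and y: "{y, a} \<in> edges G" "{y, b} \<in> edges G" "{a, b} \<notin> edges G"
    and far: "par a \<notin> {xs ! 1, xs ! 2, xs ! 3}" "par b \<notin> {xs ! 1, xs ! 2, xs ! 3}"
  shows "two_claws G"
proof -
  note c = cycle_4_5[OF l]
  have x: "xs ! 1 \<in> set xs" "xs ! 2 \<in> set xs" "xs ! 3 \<in> set xs" by (intro c(5); simp)+
  have ne: "xs ! i \<noteq> a" "xs ! i \<noteq> b" if "i \<in> {1, 2, 3}" for i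
    using off_verts(2)[OF ab(1)] off_verts(2)[OF ab(2)] x that by auto
  show ?thesis
    by (rule two_clawsI[of "xs ! 2" "xs ! 1" "xs ! 3" y a b])
      (use far ab y c x ne[of 1] ne[of 3] in \<open>auto simp: off_adj_cycle\<close>)
qed

lemma two_children_4_5:
  assumes l: "length xs = 4 \<or> length xs = 5" and ab: "a \<in> off" "b \<in> off" "a \<noteq> b"
    and y: "par a = par b" "par a \<notin> {xs ! 1, xs ! 2, xs ! 3}"
  shows "two_claws G"
proof (rule claws_4_5[OF l ab])
  have "par a \<noteq> b" "par b \<noteq> a" using h_par[OF ab(1)] h_par[OF ab(2)] y(1) by (metis n_not_Suc_n)+
  then show "{a, b} \<notin> edges G" using off_adj_off[OF ab(1,2)] by simp
  show "{par a, a} \<in> edges G" using adj_off(1)[OF ab(1)] by simp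
  show "{par a, b} \<in> edges G" using adj_off(1)[OF ab(2)] y(1) by simp
qed (use y in auto)

lemma chain_4_5:
  assumes l: "length xs = 4 \<or> length xs = 5" and p: "p \<in> off" and q: "q \<in> off" "par q = p"
    and r: "r \<in> off" "par r = q" and far: "par p \<notin> {xs ! 1, xs ! 2, xs ! 3}"
  shows "two_claws G"
proof (rule claws_4_5[OF l p r(1)])
  have "h q = Suc (h p)" "h r = Suc (h q)" "h p = Suc (h (par p))" using h_par p q r by auto
  then have "p \<noteq> r" "par p \<noteq> r" "q \<noteq> p" by auto
  then show "p \<noteq> r" "{p, r} \<notin> edges G" using off_adj_off[OF p r(1)] r(2) by auto
  show "{q, p} \<in> edges G" "{q, r} \<in> edges G" using adj_off(2)[OF q(1)] q r by auto
  show "par r \<notin> {xs ! 1, xs ! 2, xs ! 3}"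
    using off_verts(2)[OF q(1)] cycle_4_5(5)[OF l, of 1] cycle_4_5(5)[OF l, of 2] cycle_4_5(5)[OF l, of 3] r(2)
    by auto
qed (rule far)

text \<open>Up to reflection, a branch at another vertex of the pentagon sits one or two steps
  further on.\<close>

lemma branches_5:
  assumes l: "length xs = 5" and p: "p \<in> off" "par p = xs ! 0" and r: "r \<in> off" "par r \<in> {xs ! 1, xs ! 2}"
  shows "two_claws G"
proof -
  have neq: "xs ! i = xs ! j \<longleftrightarrow> i = j" if "i < 5" "j < 5" for i j
    using dist l that by (auto simp: nth_eq_iff_index_eq)
  have x: "xs ! i \<in> set xs" if "i < 5" for i using l that by simp
  have ne: "xs ! i \<noteq> p" "xs ! i \<noteq> r" "p \<noteq> xs ! i" "r \<noteq> xs ! i" if "i < 5" for i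
    using x[OF that] off_verts(2)[OF p(1)] off_verts(2)[OF r(1)] by auto
  have pr: "p \<noteq> r" using p(2) r(2) neq by auto
  from r(2) consider "par r = xs ! 1" | "par r = xs ! 2" by blast
  then show ?thesis
  proof cases
    case 1
    show ?thesis
      by (rule two_clawsI[of "xs ! 0" p "xs ! 4" "xs ! 1" r "xs ! 2"])
        (use pr 1 l in \<open>auto simp: adj_cycle off_adj_cycle off_adj_off p r(1) x ne neq\<close>)
  next
    case 2
    show ?thesis
      by (rule two_clawsI[of "xs ! 2" r "xs ! 1" "xs ! 0" p "xs ! 4"])
        (use pr 2 l in \<open>auto simp: adj_cycle off_adj_cycle off_adj_off p r(1) x ne neq\<close>)
  qed
qed

text \<open>Once a path of length two hangs at \<open>xs ! 0\<close>, the claw at \<open>p\<close>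
  forbids every branch at the two adjacent cycle vertices and a second vertex on a branch at the
  opposite one. A pendant edge there remains possible.\<close>

lemma branches_4:
  assumes l: "length xs = 4" and p: "p \<in> off" "par p = xs ! 0" and q: "q \<in> off" "par q = p"
    and s: "s \<in> off" "par s = xs ! 1 \<or> par s = xs ! 3 \<or> (par s = xs ! 2 \<and> t \<in> off \<and> par t = s)"
  shows "two_claws G"
proof -
  have neq: "xs ! i = xs ! j \<longleftrightarrow> i = j" if "i < 4" "j < 4" for i j
    using dist l that by (auto simp: nth_eq_iff_index_eq)
  have x: "xs ! i \<in> set xs" if "i < 4" for i using l that by simp
  have ne: "xs ! i \<noteq> p" "xs ! i \<noteq> q" "xs ! i \<noteq> s" "p \<noteq> xs ! i" "q \<noteq> xs ! i" "s \<noteq> xs ! i" if "i < 4" for i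
    using x[OF that] off_verts(2)[OF p(1)] off_verts(2)[OF q(1)] off_verts(2)[OF s(1)] by auto
  have hp: "h p = 1" "h q = 2" "h s = 1"
    using h_par[OF p(1)] h_par[OF q(1)] h_par[OF s(1)] p(2) q(2) s(2) h_cycle x by auto
  then have pq: "p \<noteq> q" "s \<noteq> q" "q \<noteq> p" "q \<noteq> s" by auto
  have ps: "p \<noteq> s" using p(2) s(2) neq by auto
  from s(2) consider "par s = xs ! 1" | "par s = xs ! 3" | "par s = xs ! 2" "t \<in> off" "par t = s" by blast
  then show ?thesis
  proof cases
    case 1
    show ?thesis
      by (rule two_clawsI[of p "xs ! 0" q "xs ! 1" "xs ! 2" s])
        (use pq ps 1 l in \<open>auto simp: adj_cycle off_adj_cycle off_adj_off p q s(1) x ne neq\<close>)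
  next
    case 2
    show ?thesis
      by (rule two_clawsI[of p "xs ! 0" q "xs ! 3" "xs ! 2" s])
        (use pq ps 2 l in \<open>auto simp: adj_cycle off_adj_cycle off_adj_off p q s(1) x ne neq\<close>)
  next
    case 3
    have "h t = 2" using h_par[OF 3(2)] 3(3) hp by simp
    then have t: "t \<noteq> p" "t \<noteq> s" "p \<noteq> t" "s \<noteq> t" using hp by auto
    have tq: "t \<noteq> q" "q \<noteq> t" using 3(3) q(2) ps by auto
    have tx: "xs ! i \<noteq> t" "t \<noteq> xs ! i" if "i < 4" for i using x[OF that] off_verts(2)[OF 3(2)] by auto
    show ?thesis
      by (rule two_clawsI[of p "xs ! 0" q s "xs ! 2" t])
        (use pq ps 3(1) l t tq in \<open>auto simp: adj_cycle off_adj_cycle off_adj_off p q s(1) 3(2,3) x ne neq tx\<close>)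
  qed
qed

lemma adj_3:
  assumes "length xs = 3" "i < 3" "j < 3" "i \<noteq> j"
  shows "{xs ! i, xs ! j} \<in> edges G"
proof -
  have "i = 0 \<or> i = 1 \<or> i = 2" "j = 0 \<or> j = 1 \<or> j = 2" using assms(2,3) by linarith+
  then have "j = Suc i mod 3 \<or> i = Suc j mod 3" using assms(4) by (elim disjE) simp_all
  then show ?thesis using assms by (simp add: adj_cycle)
qed

lemma long_path_3:
  assumes l: "length xs = 3" and p: "p \<in> off" "par p = xs ! 0" and q: "q \<in> off" "par q = p"
    and r: "r \<in> off" "par r = q" and s: "s \<in> off" "par s \<in> set xs" "s \<noteq> p"
  shows "two_claws G"
proof -
  have neq: "xs ! i = xs ! j \<longleftrightarrow> i = j" if "i < 3" "j < 3" for i j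
    using dist l that by (auto simp: nth_eq_iff_index_eq)
  have x: "xs ! i \<in> set xs" if "i < 3" for i using l that by simp
  obtain i where i: "i < 3" "par s = xs ! i" using s(2) l by (auto simp: in_set_conv_nth)
  \<comment> \<open>A triangle vertex next to the foot of \<open>s\<close> that is not the foot
    \<open>xs ! 0\<close> of the long path, since it must not be adjacent to
    \<open>p\<close>.\<close>
  define j where "j = (if i = 1 then 2 else 1 :: nat)"
  have j: "j < 3" "j \<noteq> 0" "j \<noteq> i" "i \<noteq> j" by (auto simp: j_def)
  have hp: "h p = 1" "h q = 2" "h r = 3" "h s = 1"
    using h_par[OF p(1)] h_par[OF q(1)] h_par[OF r(1)] h_par[OF s(1)] p(2) q(2) r(2) i h_cycle x by auto
  then have pq: "p \<noteq> q" "p \<noteq> r" "q \<noteq> r" "s \<noteq> q" "s \<noteq> r" "q \<noteq> p" "r \<noteq> p" "r \<noteq> q" "q \<noteq> s" "r \<noteq> s" by auto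
  have ne: "xs ! k \<noteq> p" "xs ! k \<noteq> q" "xs ! k \<noteq> r" "xs ! k \<noteq> s" "p \<noteq> xs ! k" "q \<noteq> xs ! k" "r \<noteq> xs ! k" "s \<noteq> xs ! k"
    if "k < 3" for k
    using x[OF that] off_verts(2)[OF p(1)] off_verts(2)[OF q(1)] off_verts(2)[OF r(1)] off_verts(2)[OF s(1)] by auto
  have "{xs ! i, xs ! j} \<in> edges G"
    using adj_3[OF l i(1) j(1,4)] .
  then show ?thesis
    by (intro two_clawsI[of q p r "xs ! i" "xs ! j" s])
      (use pq s(3) i j l in \<open>auto simp: off_adj_cycle off_adj_off p q r s(1) x ne neq\<close>)
qed

text \<open>One claw consists of the two branches at a common vertex, the other of the remaining
  branch and the third triangle vertex.\<close>

lemma branches_3: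
  assumes l: "length xs = 3" and p: "p \<in> off" "p' \<in> off" "p \<noteq> p'" "par p = par p'" "par p \<in> set xs"
    and r: "r \<in> off" "par r \<in> set xs" "par r \<noteq> par p"
  shows "two_claws G"
proof -
  have neq: "xs ! i = xs ! j \<longleftrightarrow> i = j" if "i < 3" "j < 3" for i j
    using dist l that by (auto simp: nth_eq_iff_index_eq)
  have x: "xs ! i \<in> set xs" if "i < 3" for i using l that by simp
  obtain a where a: "a < 3" "par p = xs ! a" using p(5) l by (auto simp: in_set_conv_nth)
  obtain b where b: "b < 3" "par r = xs ! b" using r(2) l by (auto simp: in_set_conv_nth)
  have ab: "a \<noteq> b" using a b r(3) by auto
  \<comment> \<open>The positions on the triangle add up to three, so this is the remaining
    one.\<close>
  define d where "d = 3 - (a + b)"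
  have d: "d < 3" "d \<noteq> a" "d \<noteq> b" using a(1) b(1) ab by (auto simp: d_def less_Suc_eq numeral_3_eq_3)
  have ne: "xs ! k \<noteq> p" "xs ! k \<noteq> p'" "xs ! k \<noteq> r" "p \<noteq> xs ! k" "p' \<noteq> xs ! k" "r \<noteq> xs ! k" if "k < 3" for k
    using x[OF that] off_verts(2)[OF p(1)] off_verts(2)[OF p(2)] off_verts(2)[OF r(1)] by auto
  have par': "par p' = xs ! a" using a p(4) by simp
  have rp: "r \<noteq> p" "r \<noteq> p'" "p \<noteq> r" "p' \<noteq> r" using r(3) p(4) by auto
  have "{xs ! b, xs ! d} \<in> edges G"
    using adj_3[OF l b(1) d(1) d(3)[symmetric]] .
  then show ?thesis
    by (intro two_clawsI[of "xs ! b" r "xs ! d" "xs ! a" p p'])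
      (use p(3) rp ab d a b par' in \<open>auto simp: off_adj_cycle off_adj_off p(1,2) r(1) x ne neq\<close>)
qed

text \<open>Vertices of height at least two see no vertex of the triangle, as
  \<open>triangle_claw_obstruction\<close> requires.\<close>

lemma two_children_3:
  assumes l: "length xs = 3" and s: "s1 \<in> off" "s2 \<in> off" "s1 \<noteq> s2" "2 \<le> h s1" "2 \<le> h s2"
    and y: "y \<in> off" "{y, s1} \<in> edges G" "{y, s2} \<in> edges G" "{s1, s2} \<notin> edges G"
  shows "\<not> enjoys_strong_exchange TYPE('k::field) G"
proof -
  have x: "set xs = {xs ! 0, xs ! 1, xs ! 2}"
    using l by (auto simp: in_set_conv_nth less_Suc_eq numeral_3_eq_3 numeral_2_eq_2)
  have far: "{s, k} \<notin> edges G" if "s \<in> {s1, s2}" "k \<in> {xs ! 0, xs ! 1, xs ! 2}" for s k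
  proof -
    have k: "k \<in> set xs" using that(2) x by blast
    have "s \<in> off" "2 \<le> h s" using that(1) s by auto
    then have "par s \<noteq> k" using h_par[of s] h_cycle[OF k] by auto
    then show ?thesis using off_adj_cycle(1)[OF \<open>s \<in> off\<close> k] by simp
  qed
  have "\<exists>c. (\<forall>v\<in>verts G. 0 < c v) \<and> \<not> exchange_closed (max_degrees (edges G) c)"
  proof (rule triangle_claw_obstruction[OF G _ _ _ y(2,3,4) s(3) _ _ far])
    show "{xs ! 0, xs ! 1} \<in> edges G" "{xs ! 1, xs ! 2} \<in> edges G" "{xs ! 0, xs ! 2} \<in> edges G"
      using l by (auto simp: adj_cycle)
    show "y \<notin> {xs ! 0, xs ! 1, xs ! 2}" "{s1, s2} \<inter> {xs ! 0, xs ! 1, xs ! 2} = {}"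
      using off_verts(2) y(1) s(1,2) unfolding x[symmetric] by auto
  qed
  then show ?thesis by (auto simp: enjoys_strong_exchange_iff[OF G])
qed

end

section \<open>Recognising graphs as induced subgraphs of the models\<close>

text \<open>The map goes from the model to the graph, and \<open>D\<close> chooses the part of the
  model that occurs; the transfer uses the inverse map.\<close>

lemma exchange_embedding:
  assumes H: "always_exchange_closed H" "pair_edges H" and g: "inj_on g D"
    and E: "E = (\<lambda>e. g ` e) ` {e \<in> H. e \<subseteq> D}"
  shows "always_exchange_closed E"
proof (rule always_exchange_closed_transfer[OF H])
  have "card (g ` e) = 2" if "e \<in> H" "e \<subseteq> D" for e
    using that H(2) card_image[OF inj_on_subset[OF g that(2)]] by (simp add: pair_edges_def)
  then show "pair_edges E" using H(2) unfolding pair_edges_def E by auto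
  show "e \<subseteq> g ` D" if "e \<in> E" for e using that unfolding E by auto
  show "inj_on (inv_into D g) (g ` D)" by (rule inj_on_inv_into) simp
  show "{u, v} \<in> E \<longleftrightarrow> {inv_into D g u, inv_into D g v} \<in> H" if uv: "u \<in> g ` D" "v \<in> g ` D" for u v
  proof -
    obtain i j where ij: "i \<in> D" "j \<in> D" "u = g i" "v = g j" using uv by blast
    have "{u, v} = g ` {i, j}" using ij by simp
    then have "{u, v} \<in> E \<longleftrightarrow> (\<exists>e\<in>H. e \<subseteq> D \<and> g ` {i, j} = g ` e)" unfolding E by auto
    also have "\<dots> \<longleftrightarrow> {i, j} \<in> H"
    proof -
      have "{i, j} \<subseteq> D" using ij(1,2) by simp
      then have "e = {i, j}" if "e \<subseteq> D" "g ` {i, j} = g ` e" for e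
        using inj_on_image_eq_iff[OF g, of "{i, j}" e] that by blast
      then show ?thesis using \<open>{i, j} \<subseteq> D\<close> by blast
    qed
    finally show ?thesis using ij g by simp
  qed
qed

text \<open>A list shorter than the model keeps only an initial segment of its vertices. This is why
  the models number the cycle first and the tail outwards.\<close>

lemma list_embedding:
  assumes H: "always_exchange_closed (list_edges es)" "list_graph n es" and vs: "distinct vs"
    and E: "E = (\<lambda>e. {vs ! fst e, vs ! snd e}) ` set (filter (\<lambda>e. fst e < length vs \<and> snd e < length vs) es)"
  shows "always_exchange_closed E"
proof (rule exchange_embedding[OF H(1) list_graphD(1)[OF H(2)]])
  show "inj_on ((!) vs) {..<length vs}" using vs by (simp add: inj_on_nth)
  have "{e \<in> list_edges es. e \<subseteq> {..<length vs}} =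
    edge_of ` set (filter (\<lambda>e. fst e < length vs \<and> snd e < length vs) es)"
    unfolding list_edges_def edge_of_def by auto
  then show "E = (\<lambda>e. (!) vs ` e) ` {e \<in> list_edges es. e \<subseteq> {..<length vs}}"
    unfolding E by (simp add: image_image edge_of_def)
qed

lemma path_edges_Nil [simp]: "path_edges [x] = {}"
  and path_edges_Cons [simp]: "path_edges (x # y # ys) = insert {x, y} (path_edges (y # ys))"
proof -
  show "path_edges [x] = {}" by (auto simp: path_edges_def)
  have "path_edges (x # y # ys) = (\<lambda>i. {(x # y # ys) ! i, (x # y # ys) ! Suc i}) ` {..<Suc (length ys)}"
    by (auto simp: path_edges_def)
  also have "\<dots> = insert {x, y} ((\<lambda>i. {(y # ys) ! i, (y # ys) ! Suc i}) ` {..<length ys})"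
    unfolding lessThan_Suc_eq_insert_0 by (simp add: image_image)
  also have "\<dots> = insert {x, y} (path_edges (y # ys))" by (auto simp: path_edges_def)
  finally show "path_edges (x # y # ys) = insert {x, y} (path_edges (y # ys))" .
qed

lemma cycle_edges_3: "length xs = 3 \<Longrightarrow> cycle_edges xs = {{xs ! 0, xs ! 1}, {xs ! 1, xs ! 2}, {xs ! 2, xs ! 0}}"
  and cycle_edges_4: "length xs = 4 \<Longrightarrow> cycle_edges xs =
    {{xs ! 0, xs ! 1}, {xs ! 1, xs ! 2}, {xs ! 2, xs ! 3}, {xs ! 3, xs ! 0}}"
  and cycle_edges_5: "length xs = 5 \<Longrightarrow> cycle_edges xs =
    {{xs ! 0, xs ! 1}, {xs ! 1, xs ! 2}, {xs ! 2, xs ! 3}, {xs ! 3, xs ! 4}, {xs ! 4, xs ! 0}}"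
  and cycle_edges_6: "length xs = 6 \<Longrightarrow> cycle_edges xs =
    {{xs ! 0, xs ! 1}, {xs ! 1, xs ! 2}, {xs ! 2, xs ! 3}, {xs ! 3, xs ! 4}, {xs ! 4, xs ! 5}, {xs ! 5, xs ! 0}}"
  and cycle_edges_7: "length xs = 7 \<Longrightarrow> cycle_edges xs =
    {{xs ! 0, xs ! 1}, {xs ! 1, xs ! 2}, {xs ! 2, xs ! 3}, {xs ! 3, xs ! 4}, {xs ! 4, xs ! 5}, {xs ! 5, xs ! 6},
      {xs ! 6, xs ! 0}}"
proof -
  have "{..<3} = {0, 1, 2 :: nat}" "{..<4} = {0, 1, 2, 3 :: nat}" "{..<5} = {0, 1, 2, 3, 4 :: nat}"
    "{..<6} = {0, 1, 2, 3, 4, 5 :: nat}" "{..<7} = {0, 1, 2, 3, 4, 5, 6 :: nat}" by auto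
  note * = this
  show "length xs = 3 \<Longrightarrow> cycle_edges xs = {{xs ! 0, xs ! 1}, {xs ! 1, xs ! 2}, {xs ! 2, xs ! 0}}"
    "length xs = 4 \<Longrightarrow> cycle_edges xs =
    {{xs ! 0, xs ! 1}, {xs ! 1, xs ! 2}, {xs ! 2, xs ! 3}, {xs ! 3, xs ! 0}}"
    "length xs = 5 \<Longrightarrow> cycle_edges xs =
    {{xs ! 0, xs ! 1}, {xs ! 1, xs ! 2}, {xs ! 2, xs ! 3}, {xs ! 3, xs ! 4}, {xs ! 4, xs ! 0}}"
    "length xs = 6 \<Longrightarrow> cycle_edges xs =
    {{xs ! 0, xs ! 1}, {xs ! 1, xs ! 2}, {xs ! 2, xs ! 3}, {xs ! 3, xs ! 4}, {xs ! 4, xs ! 5}, {xs ! 5, xs ! 0}}"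
    "length xs = 7 \<Longrightarrow> cycle_edges xs =
    {{xs ! 0, xs ! 1}, {xs ! 1, xs ! 2}, {xs ! 2, xs ! 3}, {xs ! 3, xs ! 4}, {xs ! 4, xs ! 5}, {xs ! 5, xs ! 6},
      {xs ! 6, xs ! 0}}"
    by (simp_all add: cycle_edges_image * flip: numeral_2_eq_2)
qed

text \<open>In the model the \<open>j\<close>-th vertex of the path at the \<open>i\<close>-th cycle vertex is \<open>i + j * n\<close>.\<close>

lemma attachment_embedding:
  assumes H: "always_exchange_closed H" "pair_edges H"
    and H_eq: "H = cycle_edges [0..<n] \<union> (\<Union>i<n. path_edges (map (\<lambda>j. i + j * n) [0..<Suc k]))"
    and n: "length xs = n" "0 < n" "distinct xs"
    and G: "attachment (cycle_graph xs) P G" "inj_on fst P" "\<And>v ys. (v, ys) \<in> P \<Longrightarrow> length ys \<le> k"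
  shows "always_exchange_closed (edges G)"
proof -
  \<comment> \<open>The empty list stands for a cycle vertex without a path.\<close>
  define Y where "Y i = (if \<exists>ys. (xs ! i, ys) \<in> P then THE ys. (xs ! i, ys) \<in> P else [])" for i
  have uniq: "ys = zs" if "(v, ys) \<in> P" "(v, zs) \<in> P" for v ys zs
    using inj_onD[OF G(2) _ that] by simp
  have Y_eq: "Y i = ys" if "(xs ! i, ys) \<in> P" for i ys
    using that uniq unfolding Y_def by (auto intro!: the_equality)
  have Y_cases: "Y i = [] \<or> (xs ! i, Y i) \<in> P" for i
    using Y_eq[of i] by (cases "\<exists>ys. (xs ! i, ys) \<in> P") (auto simp: Y_def)
  have att: "v \<in> set xs \<and> distinct ys \<and> set ys \<inter> set xs = {}" if "(v, ys) \<in> P" for v ys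
    using G(1) that unfolding attachment_def cycle_graph_def by auto
  have disj: "set ys \<inter> set zs = {}" if "(v, ys) \<in> P" "(u, zs) \<in> P" "(v, ys) \<noteq> (u, zs)" for u v ys zs
    using G(1) that unfolding attachment_def by fastforce
  have Yd: "set (Y i) \<inter> set xs = {}" for i using Y_cases[of i] att[of "xs ! i" "Y i"] by auto
  define L where "L i = xs ! i # Y i" for i
  \<comment> \<open>\<open>x mod n\<close> is the position on the cycle and \<open>x div n\<close>
    the depth on the path there, the cycle vertex itself having depth zero.\<close>
  define g where "g x = L (x mod n) ! (x div n)" for x
  define D where "D = {x. x div n < length (L (x mod n))}"
  have gD: "g (i + j * n) = L i ! j" "i + j * n \<in> D \<longleftrightarrow> j < length (L i)" if "i < n" for i j
    using that by (simp_all add: g_def D_def)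
  have Yk: "length (Y i) \<le> k" for i using Y_cases[of i] G(3)[of "xs ! i" "Y i"] by auto
  have L_inj: "i = i' \<and> j = j'" if "i < n" "i' < n" "j < length (L i)" "j' < length (L i')" "L i ! j = L i' ! j'"
    for i i' j j'
  proof -
    have mem: "L i ! j \<in> set (L i)" "L i' ! j' \<in> set (L i')" using that(3,4) nth_mem by blast+
    have dL: "distinct (L i)" if ii: "i < n" for i
    proof -
      have "xs ! i \<in> set xs" using ii n(1) by simp
      then have "xs ! i \<notin> set (Y i)" using Yd[of i] by blast
      moreover have "distinct (Y i)" using Y_cases[of i] att[of "xs ! i" "Y i"] by auto
      ultimately show ?thesis by (simp add: L_def)
    qed
    have "i = i'"
    proof (rule ccontr)
      assume "i \<noteq> i'"
      then have x: "xs ! i \<noteq> xs ! i'" using n that(1,2) by (simp add: nth_eq_iff_index_eq)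
      have "xs ! i \<in> set xs" "xs ! i' \<in> set xs" using n(1) that(1,2) by auto
      moreover have "set (Y i) \<inter> set xs = {}" "set (Y i') \<inter> set xs = {}"
        by (rule Yd)+
      moreover have "set (Y i) \<inter> set (Y i') = {}"
      proof (cases "Y i = [] \<or> Y i' = []")
        case False
        then have "(xs ! i, Y i) \<in> P" "(xs ! i', Y i') \<in> P" using Y_cases[of i] Y_cases[of i'] by simp_all
        then show ?thesis using x by (intro disj) auto
      qed auto
      ultimately have "set (L i) \<inter> set (L i') = {}" using x unfolding L_def list.set by blast
      then show False using mem unfolding that(5) by blast
    qed
    moreover from this have "j = j'" using that dL[OF that(1)] by (simp add: nth_eq_iff_index_eq)
    ultimately show ?thesis by simp
  qed
  show ?thesis
  proof (rule exchange_embedding[OF H])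
    show "inj_on g D"
    proof (rule inj_onI)
      fix x y assume "x \<in> D" "y \<in> D" "g x = g y"
      then have "x mod n = y mod n \<and> x div n = y div n"
        using L_inj[of "x mod n" "y mod n" "x div n" "y div n"] n(2) unfolding D_def g_def by simp
      then show "x = y" by (metis div_mult_mod_eq)
    qed
    have cyc: "(\<lambda>e. g ` e) ` {e \<in> cycle_edges [0..<n]. e \<subseteq> D} = cycle_edges xs"
    proof -
      have i: "i \<in> D" "g i = xs ! i" if "i < n" for i
        using gD[OF that, of 0] by (simp_all add: L_def)
      have eq: "cycle_edges [0..<n] = (\<lambda>i. {i, Suc i mod n}) ` {..<n}"
        unfolding cycle_edges_image using Suc_mod_less[of _ n] by (intro image_cong) auto
      have all: "{e \<in> cycle_edges [0..<n]. e \<subseteq> D} = cycle_edges [0..<n]"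
        unfolding eq using i(1) Suc_mod_less[of _ n] by auto
      have "(\<lambda>e. g ` e) ` cycle_edges [0..<n] = (\<lambda>i. {xs ! i, xs ! (Suc i mod n)}) ` {..<n}"
        unfolding eq image_image
      proof (rule image_cong[OF refl])
        fix k assume "k \<in> {..<n}"
        then show "g ` {k, Suc k mod n} = {xs ! k, xs ! (Suc k mod n)}"
          using i(2)[of k] i(2)[OF Suc_mod_less[of k n]] by simp
      qed
      then show ?thesis unfolding all cycle_edges_image[of xs] n(1) .
    qed
    have pth: "(\<lambda>e. g ` e) ` {e \<in> path_edges (map (\<lambda>j. i + j * n) [0..<Suc k]). e \<subseteq> D} = path_edges (L i)"
      if i: "i < n" for i
    proof -
      let ?e = "\<lambda>j. {i + j * n, i + Suc j * n}"
      have eq: "path_edges (map (\<lambda>j. i + j * n) [0..<Suc k]) = ?e ` {..<k}"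
      proof -
        have "map (\<lambda>j. i + j * n) [0..<Suc k] ! j = i + j * n" if "j < Suc k" for j
          using that by (simp del: upt_Suc)
        then have "{map (\<lambda>j. i + j * n) [0..<Suc k] ! j, map (\<lambda>j. i + j * n) [0..<Suc k] ! Suc j} = ?e j"
          if "j < k" for j using that by (simp del: upt_Suc mult_Suc)
        then show ?thesis unfolding path_edges_def by (force simp del: upt_Suc mult_Suc)
      qed
      have iff: "?e j \<subseteq> D \<longleftrightarrow> Suc j < length (L i)" for j
        using gD(2)[OF i, of j] gD(2)[OF i, of "Suc j"] by auto
      have "length (L i) \<le> Suc k" using Yk[of i] by (simp add: L_def)
      then have "{e \<in> ?e ` {..<k}. e \<subseteq> D} = ?e ` {j. Suc j < length (L i)}"
        using iff by auto
      then have "(\<lambda>e. g ` e) ` {e \<in> path_edges (map (\<lambda>j. i + j * n) [0..<Suc k]). e \<subseteq> D} =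
        (\<lambda>j. g ` ?e j) ` {j. Suc j < length (L i)}"
        unfolding eq by (simp only: image_image)
      also have "\<dots> = (\<lambda>j. {L i ! j, L i ! Suc j}) ` {j. Suc j < length (L i)}"
        using gD(1)[OF i] by (intro image_cong refl) (simp only: image_insert image_empty)
      also have "\<dots> = path_edges (L i)" by (auto simp: path_edges_def)
      finally show ?thesis .
    qed
    have emb: "(\<lambda>e. g ` e) ` {e \<in> H. e \<subseteq> D} = cycle_edges xs \<union> (\<Union>i<n. path_edges (L i))"
    proof -
      have "{e \<in> H. e \<subseteq> D} = {e \<in> cycle_edges [0..<n]. e \<subseteq> D} \<union>
        (\<Union>i<n. {e \<in> path_edges (map (\<lambda>j. i + j * n) [0..<Suc k]). e \<subseteq> D})"
        unfolding H_eq by auto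
      then show ?thesis by (simp add: image_Un image_UN cyc pth del: upt_Suc)
    qed
    have "(\<Union>i<n. path_edges (L i)) = (\<Union>(v, ys)\<in>P. path_edges (v # ys))"
    proof (intro equalityI subsetI)
      fix e assume "e \<in> (\<Union>i<n. path_edges (L i))"
      then obtain i where "i < n" "e \<in> path_edges (xs ! i # Y i)" by (auto simp: L_def)
      moreover from this have "(xs ! i, Y i) \<in> P" using Y_cases[of i] by (cases "Y i") simp_all
      ultimately show "e \<in> (\<Union>(v, ys)\<in>P. path_edges (v # ys))" by blast
    next
      fix e assume "e \<in> (\<Union>(v, ys)\<in>P. path_edges (v # ys))"
      then obtain v ys where v: "(v, ys) \<in> P" "e \<in> path_edges (v # ys)" by auto
      then obtain i where "i < n" "v = xs ! i" using att[OF v(1)] n(1) by (auto simp: in_set_conv_nth)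
      then have "e \<in> path_edges (L i)" using v Y_eq[of i ys] by (simp add: L_def)
      then show "e \<in> (\<Union>i<n. path_edges (L i))" using \<open>i < n\<close> by blast
    qed
    moreover have "edges G = cycle_edges xs \<union> (\<Union>(v, ys)\<in>P. path_edges (v # ys))"
      using G(1) unfolding attachment_def cycle_graph_def by simp
    ultimately show "edges G = (\<lambda>e. g ` e) ` {e \<in> H. e \<subseteq> D}" unfolding emb by simp
  qed
qed

lemma C4_pendants_exchange: "C4_pendants G \<Longrightarrow> always_exchange_closed (edges G)"
proof -
  assume "C4_pendants G"
  then obtain xs P where *: "length xs = 4" "distinct xs" "attachment (cycle_graph xs) P G" "inj_on fst P"
    "\<And>v ys. (v, ys) \<in> P \<Longrightarrow> length ys \<le> 1" unfolding C4_pendants_def by fastforce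
  have "list_graph 8 square_pendants" by code_simp
  have "list_edges square_pendants =
    cycle_edges [0..<4] \<union> (\<Union>i<4. path_edges (map (\<lambda>j. i + j * 4) [0..<Suc 1]))"
  proof -
    have I: "{..<4} = {0, 1, 2, 3 :: nat}" by auto
    have c: "cycle_edges [0..<4] = {{0, 1}, {1, 2}, {2, 3}, {3, 0 :: nat}}"
      by (simp add: cycle_edges_4 flip: numeral_2_eq_2)
    have p: "path_edges (map (\<lambda>j. i + j * 4) [0..<Suc 1]) = {{i, i + 4 :: nat}}" for i by simp
    have "(\<Union>i<4. {{i, i + 4 :: nat}}) = {{0, 4}, {1, 5}, {2, 6}, {3, 7}}"
      unfolding I by (simp add: insert_commute)
    then show ?thesis unfolding square_pendants_edges c p by (simp only: Un_insert_left Un_empty_left)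
  qed
  from attachment_embedding[OF square_pendants_exchange list_graphD(1)[OF \<open>list_graph 8 square_pendants\<close>]
      this *(1) _ *(2,3,4,5)] show ?thesis by simp
qed

lemma C4_seven_vertices_exchange: "C4_seven_vertices G \<Longrightarrow> always_exchange_closed (edges G)"
proof -
  assume "C4_seven_vertices G"
  then obtain x1 x2 x3 x4 x5 x6 x7 where *: "distinct [x1, x2, x3, x4, x5, x6, x7]"
    "edges G = {{x1, x2}, {x2, x3}, {x3, x4}, {x4, x1}} \<union> {{x1, x5}, {x5, x6}, {x3, x7}}"
    unfolding C4_seven_vertices_def by auto
  have "list_graph 7 square_seven" by code_simp
  from list_embedding[OF square_seven_exchange this *(1)] show ?thesis
    unfolding *(2) by (simp add: square_seven_def insert_commute)
qed

lemma one_path_rotate: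
  assumes "cycle_one_path n r G" "0 < n"
  obtains xs ys where "length xs = n" "distinct (xs @ ys)" "length ys = r"
    "edges G = cycle_edges xs \<union> path_edges (xs ! 0 # ys)"
proof -
  obtain xs v ys where *: "length xs = n" "distinct xs" "length ys = r" "attachment (cycle_graph xs) {(v, ys)} G"
    using assms(1) unfolding cycle_one_path_def by blast
  have att: "v \<in> set xs" "distinct ys" "set ys \<inter> set xs = {}" "edges G = cycle_edges xs \<union> path_edges (v # ys)"
    using *(4) unfolding attachment_def cycle_graph_def by auto
  obtain k where k: "k < length xs" "xs ! k = v" using att(1) by (auto simp: in_set_conv_nth)
  have "rotate k xs ! 0 = v" using k assms(2) *(1) by (simp add: nth_rotate)
  then show ?thesis using att *
    by (intro that[of "rotate k xs" ys]) (auto simp: cycle_edges_rotate)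
qed

text \<open>The graph arises from \<open>square_seven\<close> by deleting the pendant vertex
  \<open>6\<close>.\<close>

lemma square_tail_exchange:
  assumes "cycle_one_path 4 2 G"
  shows "always_exchange_closed (edges G)"
proof -
  obtain xs ys where *: "length xs = 4" "distinct (xs @ ys)" "length ys = 2"
    "edges G = cycle_edges xs \<union> path_edges (xs ! 0 # ys)" using one_path_rotate[OF assms] by auto
  obtain a b where ab: "ys = [a, b]" using *(3) by (auto simp: numeral_2_eq_2 length_Suc_conv)
  have "list_graph 7 square_seven" by code_simp
  from list_embedding[OF square_seven_exchange this *(2)] show ?thesis
    unfolding *(4) cycle_edges_4[OF *(1)] ab using *(1)
    by (simp add: square_seven_def nth_append insert_commute)
qed

lemma triangle_one_path_exchange:
  assumes "cycle_one_path 3 3 G"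
  shows "always_exchange_closed (edges G)"
proof -
  obtain xs ys where *: "length xs = 3" "distinct (xs @ ys)" "length ys = 3"
    "edges G = cycle_edges xs \<union> path_edges (xs ! 0 # ys)" using one_path_rotate[OF assms] by auto
  obtain a b d where ab: "ys = [a, b, d]" using *(3) by (auto simp: numeral_3_eq_3 length_Suc_conv)
  have "list_graph 6 triangle_tail" by code_simp
  from list_embedding[OF triangle_tail_exchange this *(2)] show ?thesis
    unfolding *(4) cycle_edges_3[OF *(1)] ab using *(1)
    by (simp add: triangle_tail_def nth_append insert_commute)
qed

lemma C3_short_paths_exchange:
  assumes H: "always_exchange_closed (list_edges triangle_paths)" and "C3_short_paths G"
  shows "always_exchange_closed (edges G)"
proof -
  obtain xs P where *: "length xs = 3" "distinct xs" "attachment (cycle_graph xs) P G" "inj_on fst P"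
    "\<And>v ys. (v, ys) \<in> P \<Longrightarrow> length ys \<le> 2"
    using assms(2) unfolding C3_short_paths_def by fastforce
  have G: "list_graph 9 triangle_paths" by code_simp
  have "list_edges triangle_paths =
    cycle_edges [0..<3] \<union> (\<Union>i<3. path_edges (map (\<lambda>j. i + j * 3) [0..<Suc 2]))"
  proof -
    have I: "{..<3} = {0, 1, 2 :: nat}" by auto
    have c: "cycle_edges [0..<3] = {{0, 1}, {1, 2}, {2, 0 :: nat}}"
      by (simp add: cycle_edges_3 flip: numeral_2_eq_2)
    have p: "path_edges (map (\<lambda>j. i + j * 3) [0..<Suc 2]) = {{i, i + 3}, {i + 3, i + 6 :: nat}}" for i
      by (simp add: numeral_2_eq_2)
    have "(\<Union>i<3. {{i, i + 3}, {i + 3, i + 6 :: nat}}) =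
      {{0, 3}, {1, 4}, {2, 5}, {3, 6}, {4, 7}, {5, 8}}"
      unfolding I by (simp add: insert_commute)
    moreover have "list_edges triangle_paths =
      {{0, 1}, {1, 2}, {2, 0}, {0, 3}, {1, 4}, {2, 5}, {3, 6}, {4, 7}, {5, 8}}"
      by (simp add: list_edges_def edge_of_def triangle_paths_def)
    ultimately show ?thesis
      unfolding c p by (simp only: Un_insert_left Un_empty_left)
  qed
  from attachment_embedding[OF H list_graphD(1)[OF G] this *(1) _ *(2,3,4,5)] show ?thesis by simp
qed

text \<open>The first vertices of the paths index the star, and \<open>(t, 2)\<close> is kept in
  \<open>D\<close> only for paths of length two.\<close>

lemma C3_paths_at_vertex_exchange:
  assumes "C3_paths_at_vertex G"
  shows "always_exchange_closed (edges G)"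
proof -
  obtain ys P v where *: "length ys = 3" "distinct ys" "attachment (cycle_graph ys) P G" "v \<in> set ys"
    "\<And>u zs. (u, zs) \<in> P \<Longrightarrow> u = v \<and> length zs \<le> 2"
    using assms unfolding C3_paths_at_vertex_def by fastforce
  obtain k where k: "k < length ys" "ys ! k = v" using *(4) by (auto simp: in_set_conv_nth)
  define xs where "xs = rotate k ys"
  have xs: "length xs = 3" "distinct xs" "set xs = set ys" "xs ! 0 = v"
    using * k by (simp_all add: xs_def nth_rotate)
  have EG: "edges G = cycle_edges xs \<union> (\<Union>(u, zs)\<in>P. path_edges (u # zs))" and P: "finite P"
    using *(3) by (auto simp: attachment_def cycle_graph_def xs_def cycle_edges_rotate)
  have att: "zs \<noteq> [] \<and> distinct zs \<and> set zs \<inter> set xs = {}" if "(u, zs) \<in> P" for u zs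
    using *(3) that xs(3) unfolding attachment_def cycle_graph_def by auto
  have disj: "set zs \<inter> set zs' = {}" if "(u, zs) \<in> P" "(u', zs') \<in> P" "(u, zs) \<noteq> (u', zs')" for u u' zs zs'
    using *(3) that unfolding attachment_def by fastforce
  define T where "T = {t. (v, [t]) \<in> P \<or> (\<exists>y. (v, [t, y]) \<in> P)}"
  define T2 where "T2 = {t. \<exists>y. (v, [t, y]) \<in> P}"
  define sec where "sec t = (THE y. (v, [t, y]) \<in> P)" for t
  have sec: "sec t = y" if "(v, [t, y]) \<in> P" for t y
    unfolding sec_def
  proof (rule the_equality)
    show "(v, [t, y]) \<in> P" by (rule that)
    show "y' = y" if y': "(v, [t, y']) \<in> P" for y'
      using disj[OF y' \<open>(v, [t, y]) \<in> P\<close>] by auto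
  qed
  have Pc: "(\<exists>t. zs = [t]) \<or> (\<exists>t y. zs = [t, y])" if "(u, zs) \<in> P" for u zs
    using att[OF that] *(5)[OF that] by (cases zs rule: remdups_adj.cases) auto
  have "T \<subseteq> (\<lambda>p. hd (snd p)) ` P" unfolding T_def by force
  then have T: "finite T" using P finite_surj by blast
  define a b where "a = xs ! 1" and "b = xs ! 2"
  have ab: "distinct [v, a, b]" "set xs = {v, a, b}" "cycle_edges xs = {{v, a}, {a, b}, {b, v}}"
  proof -
    have "xs = [v, a, b]"
      using xs(1,4) unfolding a_def b_def
      by (intro nth_equalityI) (auto simp: less_Suc_eq numeral_3_eq_3 numeral_2_eq_2)
    then show "distinct [v, a, b]" "set xs = {v, a, b}" using xs(2) by auto
    show "cycle_edges xs = {{v, a}, {a, b}, {b, v}}"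
      using cycle_edges_3[OF xs(1)] xs(4) by (simp add: a_def b_def)
  qed
  define D where "D = {(v, 0), (v, 3), (v, 4 :: nat)} \<union> T \<times> {1} \<union> T2 \<times> {2}"
  define g where "g p = (if snd p = 0 then v else if snd p = 3 then a else if snd p = 4 then b
    else if snd p = 1 then fst p else sec (fst p))" for p :: "'a \<times> nat"
  have Tn: "t \<notin> {v, a, b}" if "t \<in> T" for t
    using that att unfolding T_def ab(2)[symmetric] by force
  have T2n: "sec t \<notin> {v, a, b}" "sec t \<notin> T" "t \<in> T" if t: "t \<in> T2" for t
  proof -
    obtain y where y: "(v, [t, y]) \<in> P" using t unfolding T2_def by blast
    show "sec t \<notin> {v, a, b}" using att[OF y] sec[OF y] unfolding ab(2)[symmetric] by auto
    show "t \<in> T" using y unfolding T_def by blast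
    show "sec t \<notin> T"
    proof
      assume "sec t \<in> T"
      then obtain zs where zs: "(v, y # zs) \<in> P" unfolding sec[OF y] T_def by blast
      have "y \<noteq> t" using att[OF y] by auto
      then show False using disj[OF zs y] by auto
    qed
  qed
  have sec_inj: "t = t'" if t: "t \<in> T2" "t' \<in> T2" "sec t = sec t'" for t t'
  proof (rule ccontr)
    assume "t \<noteq> t'"
    obtain y where y: "(v, [t, y]) \<in> P" using t(1) unfolding T2_def by blast
    obtain y' where y': "(v, [t', y']) \<in> P" using t(2) unfolding T2_def by blast
    have "y = y'" using t(3) sec[OF y] sec[OF y'] by simp
    then show False using disj[OF y y'] \<open>t \<noteq> t'\<close> by simp
  qed
  show ?thesis
  proof (rule exchange_embedding[OF triangle_star_exchange[OF T] pair_edges_triangle_star[OF T]])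
    \<comment> \<open>A left inverse of \<open>g\<close> on \<open>D\<close>.\<close>
    define r where "r u = (if u = v then (v, 0) else if u = a then (v, 3) else if u = b then (v, 4)
      else if u \<in> T then (u, 1) else (THE t. t \<in> T2 \<and> sec t = u, 2 :: nat))" for u
    have ne: "v \<noteq> a" "v \<noteq> b" "a \<noteq> b" using ab(1) by auto
    show "inj_on g D"
    proof (rule inj_on_inverseI[of _ r])
      fix p assume "p \<in> D"
      then consider "p = (v, 0)" | "p = (v, 3)" | "p = (v, 4)" | t where "t \<in> T" "p = (t, 1)"
        | t where "t \<in> T2" "p = (t, 2)" unfolding D_def by blast
      then show "r (g p) = p"
      proof cases
        case (4 t)
        then show ?thesis using Tn[OF 4(1)] by (simp add: g_def r_def)
      next
        case (5 t)
        have "(THE t'. t' \<in> T2 \<and> sec t' = sec t) = t"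
          using 5(1) sec_inj by (intro the_equality) blast+
        then show ?thesis using T2n(1,2)[OF 5(1)] by (simp add: g_def r_def 5(2))
      qed (use ne in \<open>simp_all add: g_def r_def\<close>)
    qed
    have mem: "(v, 0) \<in> D" "(v, 3) \<in> D" "(v, 4) \<in> D" "t \<in> T \<Longrightarrow> (t, 1) \<in> D" "(t, 2) \<in> D \<longleftrightarrow> t \<in> T2" for t
      unfolding D_def by auto
    have gv: "g (v, 0) = v" "g (v, 3) = a" "g (v, 4) = b" "g (t, 1) = t" "g (t, 2) = sec t" for t
      by (simp_all add: g_def)
    let ?H = "triangle_star v T"
    have inH: "star_edge v i \<in> ?H" if "i \<in> star_index v T" for i using that by (simp add: triangle_star_def)
    have img: "g ` star_edge v i \<in> (\<lambda>e. g ` e) ` {e \<in> ?H. e \<subseteq> D}"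
      if "i \<in> star_index v T" "star_edge v i \<subseteq> D" for i using inH[OF that(1)] that(2) by blast
    show "edges G = (\<lambda>e. g ` e) ` {e \<in> ?H. e \<subseteq> D}"
    proof (intro equalityI subsetI)
      fix e assume "e \<in> edges G"
      then consider "e = {v, a}" | "e = {a, b}" | "e = {b, v}" | u zs where "(u, zs) \<in> P" "e \<in> path_edges (u # zs)"
        unfolding EG ab(3) by blast
      then show "e \<in> (\<lambda>e. g ` e) ` {e \<in> ?H. e \<subseteq> D}"
      proof cases
        case 1
        then show ?thesis using img[of "(v, 4)"] mem gv by (simp add: star_index_def)
      next
        case 2
        then show ?thesis using img[of "(v, 0)"] mem gv by (simp add: star_index_def)
      next
        case 3
        then show ?thesis using img[of "(v, 3)"] mem gv by (simp add: star_index_def insert_commute)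
      next
        case (4 u zs)
        have u: "u = v" using *(5)[OF 4(1)] by simp
        have first: "{v, t} \<in> (\<lambda>e. g ` e) ` {e \<in> ?H. e \<subseteq> D}" if "t \<in> T" for t
          using img[of "(t, 1)"] mem(1) mem(4)[OF that] gv that by (simp add: star_index_def)
        from Pc[OF 4(1)] show ?thesis
        proof (elim disjE exE)
          fix t assume zs: "zs = [t]"
          then have "t \<in> T" using 4(1) u unfolding T_def by blast
          then show ?thesis using 4(2) first u zs by simp
        next
          fix t y assume zs: "zs = [t, y]"
          have ty: "(v, [t, y]) \<in> P" using 4(1) u zs by simp
          then have t: "t \<in> T" "t \<in> T2" unfolding T_def T2_def by blast+
          have "{t, y} \<in> (\<lambda>e. g ` e) ` {e \<in> ?H. e \<subseteq> D}"
            using img[of "(t, 2)"] mem(4)[OF t(1)] mem(5)[of t] gv t sec[OF ty] by (simp add: star_index_def)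
          then show ?thesis using 4(2) first[OF t(1)] u zs by auto
        qed
      qed
    next
      fix e assume "e \<in> (\<lambda>e. g ` e) ` {e \<in> ?H. e \<subseteq> D}"
      then obtain i where i: "i \<in> star_index v T" "star_edge v i \<subseteq> D" "e = g ` star_edge v i"
        unfolding triangle_star_def by blast
      from i(1) show "e \<in> edges G"
      proof (cases rule: star_index_cases)
        case (4 t)
        have "e = {v, t}" using i(3) gv unfolding 4(2) by simp
        moreover have "\<exists>zs. (v, t # zs) \<in> P" using 4(1) unfolding T_def by blast
        then obtain zs where zs: "(v, t # zs) \<in> P" ..
        have "{v, t} \<in> path_edges (v # t # zs)" by simp
        ultimately show ?thesis using zs unfolding EG by blast
      next
        case (5 t)
        have "(t, 2) \<in> D" using i(2) unfolding 5(2) by simp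
        then obtain y where y: "(v, [t, y]) \<in> P" unfolding mem(5) T2_def by blast
        have "e = {t, y}" using i(3) gv sec[OF y] unfolding 5(2) by simp
        then have "e \<in> path_edges (v # [t, y])" by simp
        then show ?thesis using y unfolding EG by blast
      qed (use i(3) gv in \<open>simp_all add: EG ab(3) insert_commute\<close>)
    qed
  qed
qed

section \<open>The shape of graphs without obstructions\<close>

context rooted_graph
begin

lemma off_finite: "finite off" using verts_finite[OF G] by (simp add: off_def)

lemma par_cycle: "v \<in> off \<Longrightarrow> h v = 1 \<Longrightarrow> par v \<in> set xs"
  using h_par[of v] h0_cycle[OF par_verts[of v]] by simp

lemma par_off: "v \<in> off \<Longrightarrow> 2 \<le> h v \<Longrightarrow> par v \<in> off"
  using h_par[of v] h_cycle[of "par v"] par_verts[of v] by (auto simp: off_def)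

lemma rotated: "rooted_graph G (rotate k xs) par h" "rooted_graph.off G (rotate k xs) = off"
proof -
  show R: "rooted_graph G (rotate k xs) par h" using rooted_rotate[OF rooted] by (simp add: rooted_graph_def)
  show "rooted_graph.off G (rotate k xs) = off" unfolding rooted_graph.off_def[OF R] off_def by simp
qed

lemma distinct_first: "4 \<le> length xs \<Longrightarrow> xs ! 0 \<notin> {xs ! 1, xs ! 2, xs ! 3}"
proof -
  assume "4 \<le> length xs"
  then have "xs ! 0 \<noteq> xs ! i" if "0 < i" "i < 4" for i
    using nth_eq_iff_index_eq[OF dist, of 0 i] that by linarith
  then show ?thesis by simp
qed

lemma unique_child_4_5:
  assumes l: "length xs = 4 \<or> length xs = 5" and no: "\<not> two_claws G"
    and uv: "u \<in> off" "v \<in> off" "par u = par v"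
  shows "u = v"
proof (rule ccontr)
  assume ne: "u \<noteq> v"
  show False
  proof (cases "par u \<in> set xs")
    case True
    then obtain k where k: "rotate k xs ! 0 = par u" using rotate_to by metis
    interpret R: rooted_graph G "rotate k xs" par h by (rule rotated(1))
    have "par u \<notin> {rotate k xs ! 1, rotate k xs ! 2, rotate k xs ! 3}"
      using R.distinct_first l k by auto
    then show False using R.two_children_4_5[of u v] uv ne l no rotated(2)[of k] by simp
  next
    case False
    have "xs ! i \<in> set xs" if "i < 4" for i using that l by auto
    from this[of 1] this[of 2] this[of 3] have "par u \<notin> {xs ! 1, xs ! 2, xs ! 3}" using False by auto
    then show False using two_children_4_5[OF l uv(1,2) ne uv(3)] no by blast
  qed
qed

lemma height_4_5:
  assumes l: "length xs = 4 \<or> length xs = 5" and no: "\<not> two_claws G" and v: "v \<in> off"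
  shows "h v \<le> 2"
proof (rule ccontr)
  assume "\<not> h v \<le> 2"
  then obtain r where r: "r \<in> off" "h r = 3" using ancestor[OF v, of 3] by auto
  have q: "par r \<in> off" "h (par r) = 2" using par_off[OF r(1)] h_par[OF r(1)] r(2) by auto
  have p: "par (par r) \<in> off" "h (par (par r)) = 1" using par_off[OF q(1)] h_par[OF q(1)] q(2) by auto
  obtain k where k: "rotate k xs ! 0 = par (par (par r))" using rotate_to[OF par_cycle[OF p]] by metis
  interpret R: rooted_graph G "rotate k xs" par h by (rule rotated(1))
  have "par (par (par r)) \<notin> {rotate k xs ! 1, rotate k xs ! 2, rotate k xs ! 3}"
    using R.distinct_first l k by auto
  then show False
    using R.chain_4_5[of "par (par r)" "par r" r] p(1) q(1) r(1) l no rotated(2)[of k] by simp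
qed

lemma no_off_6_7:
  assumes l: "length xs = 6 \<or> length xs = 7" and no: "\<not> two_claws G"
  shows "off = {}"
proof (rule ccontr)
  assume "off \<noteq> {}"
  then obtain v where v: "v \<in> off" by blast
  then obtain p where p: "p \<in> off" "h p = 1" using ancestor[OF v, of 1] h_off[OF v] by auto
  obtain k where k: "rotate k xs ! 0 = par p" using rotate_to[OF par_cycle[OF p]] by metis
  interpret R: rooted_graph G "rotate k xs" par h by (rule rotated(1))
  show False using R.cycle_branch_6_7[of p] k p(1) l no rotated(2)[of k] by simp
qed

lemma pentagon_off:
  assumes l: "length xs = 5" and no: "\<not> two_claws G"
  shows "off = {} \<or> (\<exists>k p. par p = rotate k xs ! 0 \<and> (off = {p} \<or> (\<exists>q. q \<noteq> p \<and> par q = p \<and> off = {p, q})))"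
proof (cases "off = {}")
  case False
  then obtain v where v: "v \<in> off" by blast
  have l': "length xs = 4 \<or> length xs = 5" using l by simp
  note uniq = unique_child_4_5[OF l' no] and height = height_4_5[OF l' no]
  obtain p where p: "p \<in> off" "h p = 1" using ancestor[OF v, of 1] h_off[OF v] by auto
  obtain k where k: "rotate k xs ! 0 = par p" using rotate_to[OF par_cycle[OF p]] by metis
  let ?R = "rotate k xs"
  interpret R: rooted_graph G ?R par h by (rule rotated(1))
  have off_R: "R.off = off" by (rule rotated(2))
  have one: "s = p" if s: "s \<in> off" "h s = 1" for s
  proof -
    have "par s \<in> set ?R" using par_cycle[OF s] by simp
    then obtain i where "i < length ?R" and i2: "?R ! i = par s" unfolding in_set_conv_nth by blast
    then have "i < 5" using l by simp
    note i = this i2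
    \<comment> \<open>Seen from \<open>par s\<close>, the foot of \<open>p\<close> is at position
      \<open>5 - i\<close> when \<open>i\<close> is positive. So one of the two branches has the
      other one or two steps further on, and \<open>branches_5\<close> applies.\<close>
    let ?Q = "rotate i ?R"
    interpret Q: rooted_graph G ?Q par h by (rule R.rotated(1))
    have off_Q: "Q.off = off" using R.rotated(2)[of i] off_R by simp
    have Q: "?Q ! j = ?R ! ((i + j) mod 5)" if "j < 5" for j using l that by (simp add: nth_rotate)
    consider "i = 0" | "i = 1 \<or> i = 2" | "i = 3 \<or> i = 4" using i(1) by linarith
    then show ?thesis
    proof cases
      case 1
      then show ?thesis using uniq[OF s(1) p(1)] i k by simp
    next
      case 2
      then have "par s \<in> {?R ! 1, ?R ! 2}" using i(2) by auto
      then show ?thesis using R.branches_5[of p s] l p(1) k s(1) no off_R by simp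
    next
      case 3
      then have "par p \<in> {?Q ! 1, ?Q ! 2}" using Q[of 1] Q[of 2] k by auto
      moreover have "par s = ?Q ! 0" using Q[of 0] i by simp
      ultimately show ?thesis using Q.branches_5[of s p] l p(1) s(1) no off_Q by simp
    qed
  qed
  have two: "par s = p" if s: "s \<in> off" "h s \<noteq> 1" for s
  proof -
    have "h s = 2" using height[OF s(1)] h_off[OF s(1)] s(2) by simp
    then show ?thesis using one[of "par s"] par_off[OF s(1)] h_par[OF s(1)] by simp
  qed
  show ?thesis
  proof (cases "\<exists>q\<in>off. h q \<noteq> 1")
    case True
    then obtain q where q: "q \<in> off" "h q \<noteq> 1" by blast
    have "s = p \<or> s = q" if "s \<in> off" for s
      using one[OF that] two[OF that] two[OF q] uniq[OF that q(1)] by (cases "h s = 1") auto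
    then have "off = {p, q}" using p(1) q(1) by blast
    moreover have "q \<noteq> p" using q(2) p(2) by auto
    ultimately show ?thesis using two[OF q] k by metis
  next
    case False
    then have "off = {p}" using one p(1) by blast
    then show ?thesis using k by metis
  qed
qed simp

text \<open>The positions occupied by \<open>A\<close> and their cyclic successors are
  disjoint.\<close>

lemma cycle_independent:
  assumes A: "independent G A"
  shows "2 * card (A \<inter> set xs) \<le> length xs"
proof -
  let ?n = "length xs"
  define I where "I = {i \<in> {..<?n}. xs ! i \<in> A}"
  have "A \<inter> set xs = (!) xs ` I" unfolding I_def by (auto simp: in_set_conv_nth)
  moreover have "inj_on ((!) xs) I" using dist by (intro inj_on_nth) (auto simp: I_def)
  ultimately have card: "card (A \<inter> set xs) = card I" by (simp add: card_image)
  have inj: "inj_on (\<lambda>i. Suc i mod ?n) I"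
  proof (rule inj_onI)
    fix i j assume "i \<in> I" "j \<in> I" "Suc i mod ?n = Suc j mod ?n"
    then show "i = j" unfolding I_def by (cases "Suc i = ?n"; cases "Suc j = ?n") auto
  qed
  have disj: "I \<inter> (\<lambda>i. Suc i mod ?n) ` I = {}"
  proof (rule ccontr)
    assume "\<not> ?thesis"
    then obtain i where i: "i \<in> I" "Suc i mod ?n \<in> I" by blast
    then have "{xs ! i, xs ! (Suc i mod ?n)} \<in> edges G"
      using adj_cycle[of i "Suc i mod ?n"] unfolding I_def by simp
    then show False using i A independentD[OF G A] unfolding I_def by blast
  qed
  have "finite I" by (simp add: I_def)
  then have "card I + card ((\<lambda>i. Suc i mod ?n) ` I) = card (I \<union> (\<lambda>i. Suc i mod ?n) ` I)"
    using disj by (simp add: card_Un_disjoint)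
  also have "\<dots> \<le> card {..<?n}"
    using Suc_mod_less[of _ ?n] by (intro card_mono) (auto simp: I_def)
  finally show ?thesis using card card_image[OF inj] by simp
qed

lemma independence_bound:
  assumes "length xs div 2 + k \<le> 3" and k: "\<And>A. independent G A \<Longrightarrow> card (A \<inter> off) \<le> k"
  shows "independence_number G \<le> 3"
  unfolding independence_number_le_iff[OF G]
proof (intro allI impI)
  fix A assume A: "independent G A"
  have "A = (A \<inter> set xs) \<union> (A \<inter> off)" using A by (auto simp: independent_def off_def)
  then have "card A \<le> card (A \<inter> set xs) + card (A \<inter> off)" by (metis card_Un_le)
  then show "card A \<le> 3" using cycle_independent[OF A] k[OF A] assms(1) by linarith
qed

text \<open>The absence of two claws gives strong exchange and the bound three at once. As two claws
  refute both, the two properties become equivalent.\<close>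

lemma long_5_6_7:
  assumes l: "length xs \<in> {5, 6, 7}" and no: "\<not> two_claws G"
    and H: "always_exchange_closed (list_edges pentagon_tail)" "always_exchange_closed (list_edges hexagon)"
      "always_exchange_closed (list_edges heptagon)"
  shows "always_exchange_closed (edges G) \<and> independence_number G \<le> 3"
proof -
  consider "length xs = 5" | "length xs = 6" | "length xs = 7" using l by blast
  then show ?thesis
  proof cases
    case 2
    have off: "off = {}" using no_off_6_7 2 no by simp
    have "list_graph 6 hexagon" by code_simp
    from list_embedding[OF H(2) this dist] have "always_exchange_closed (edges G)"
      unfolding edges_eq off cycle_edges_6[OF 2] using 2 by (simp add: hexagon_def)
    moreover have "independence_number G \<le> 3" using 2 off by (intro independence_bound[of 0]) simp_all
    ultimately show ?thesis by blast
  next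
    case 3
    have off: "off = {}" using no_off_6_7 3 no by simp
    have "list_graph 7 heptagon" by code_simp
    from list_embedding[OF H(3) this dist] have "always_exchange_closed (edges G)"
      unfolding edges_eq off cycle_edges_7[OF 3] using 3 by (simp add: heptagon_def)
    moreover have "independence_number G \<le> 3" using 3 off by (intro independence_bound[of 0]) simp_all
    ultimately show ?thesis by blast
  next
    case 1
    have G7: "list_graph 7 pentagon_tail" by code_simp
    from pentagon_off[OF 1 no] show ?thesis
    proof (elim disjE exE conjE)
      assume off: "off = {}"
      from list_embedding[OF H(1) G7 dist] have "always_exchange_closed (edges G)"
        unfolding edges_eq off cycle_edges_5[OF 1] using 1 by (simp add: pentagon_tail_def)
      moreover have "independence_number G \<le> 3" using 1 off by (intro independence_bound[of 0]) simp_all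
      ultimately show ?thesis by blast
    next
      fix k p assume p: "par p = rotate k xs ! 0" and off: "off = {p}"
      have R5: "length (rotate k xs) = 5" using 1 by simp
      have "distinct (rotate k xs @ [p])" using dist off_verts(2)[of p] off by simp
      note emb = list_embedding[OF H(1) G7 this refl]
      have len: "length (rotate k xs @ [p]) = 6" using 1 by simp
      have "edges G = {{rotate k xs ! 0, rotate k xs ! 1}, {rotate k xs ! 1, rotate k xs ! 2},
          {rotate k xs ! 2, rotate k xs ! 3}, {rotate k xs ! 3, rotate k xs ! 4}, {rotate k xs ! 4, rotate k xs ! 0},
          {rotate k xs ! 0, p}}"
        unfolding edges_eq off cycle_edges_rotate[of k xs, symmetric] cycle_edges_5[OF R5]
        using p by (simp add: insert_commute)
      then have "always_exchange_closed (edges G)"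
        using emb unfolding len by (simp add: pentagon_tail_def nth_append 1)
      moreover have "card (A \<inter> off) \<le> 1" for A
        using card_mono[of "{p}" "A \<inter> {p}"] unfolding off by simp
      then have "independence_number G \<le> 3" using 1 by (intro independence_bound[of 1]) simp_all
      ultimately show ?thesis by blast
    next
      fix k p q assume p: "par p = rotate k xs ! 0" and q: "q \<noteq> p" "par q = p" and off: "off = {p, q}"
      have R5: "length (rotate k xs) = 5" using 1 by simp
      have "distinct (rotate k xs @ [p, q])" using dist off_verts(2)[of p] off_verts(2)[of q] off q(1) by auto
      note emb = list_embedding[OF H(1) G7 this refl]
      have len: "length (rotate k xs @ [p, q]) = 7" using 1 by simp
      have "edges G = {{rotate k xs ! 0, rotate k xs ! 1}, {rotate k xs ! 1, rotate k xs ! 2},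
          {rotate k xs ! 2, rotate k xs ! 3}, {rotate k xs ! 3, rotate k xs ! 4}, {rotate k xs ! 4, rotate k xs ! 0},
          {rotate k xs ! 0, p}, {p, q}}"
        unfolding edges_eq off cycle_edges_rotate[of k xs, symmetric] cycle_edges_5[OF R5]
        using p q by (simp add: insert_commute)
      then have "always_exchange_closed (edges G)"
        using emb unfolding len by (simp add: pentagon_tail_def nth_append 1)
      moreover have "card (A \<inter> off) \<le> 1" if A: "independent G A" for A
      proof -
        have "{q, p} \<in> edges G" using q(2) off by (simp add: adj_iff)
        then have "\<not> (q \<in> A \<and> p \<in> A)" using independentD[OF G A] by blast
        then have "A \<inter> off \<subseteq> {p} \<or> A \<inter> off \<subseteq> {q}" unfolding off by blast
        then show ?thesis using card_mono[of "{p}"] card_mono[of "{q}"] by auto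
      qed
      then have "independence_number G \<le> 3" using 1 by (intro independence_bound[of 1]) simp_all
      ultimately show ?thesis by blast
    qed
  qed
qed

text \<open>The whole path that starts at \<open>v\<close> when \<open>v\<close> has at most one
  child and that child has none; the choice is meaningful under uniqueness of children.\<close>

definition hanging :: "'a \<Rightarrow> 'a list" where
  "hanging v = v # (if \<exists>u\<in>off. par u = v then [THE u. u \<in> off \<and> par u = v] else [])"

lemma hanging_cases:
  assumes uniq: "\<And>u w. u \<in> off \<Longrightarrow> w \<in> off \<Longrightarrow> par u = par w \<Longrightarrow> par u \<in> off \<Longrightarrow> u = w" and v: "v \<in> off"
  shows "(hanging v = [v] \<and> (\<forall>u\<in>off. par u \<noteq> v)) \<or> (\<exists>u\<in>off. par u = v \<and> hanging v = [v, u])"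
proof (cases "\<exists>u\<in>off. par u = v")
  case True
  then obtain u where u: "u \<in> off" "par u = v" by blast
  have "(THE u. u \<in> off \<and> par u = v) = u"
    using u uniq v by (intro the_equality) auto
  then have "hanging v = [v, u]" using True by (simp add: hanging_def)
  then show ?thesis using u by blast
qed (auto simp: hanging_def)

text \<open>Every vertex off the cycle has height one or is the only child of a vertex of height
  one, so the paths that start at height one exhaust the forest.\<close>

lemma hanging_attachment:
  assumes height: "\<And>v. v \<in> off \<Longrightarrow> h v \<le> 2"
    and uniq: "\<And>u w. u \<in> off \<Longrightarrow> w \<in> off \<Longrightarrow> par u = par w \<Longrightarrow> par u \<in> off \<Longrightarrow> u = w"
  shows "attachment (cycle_graph xs) ((\<lambda>v. (par v, hanging v)) ` {v \<in> off. h v = 1}) G"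
    and "v \<in> off \<Longrightarrow> length (hanging v) \<le> 2"
proof -
  let ?L = "{v \<in> off. h v = 1}"
  have hc: "(hanging v = [v] \<and> (\<forall>u\<in>off. par u \<noteq> v)) \<or> (\<exists>u\<in>off. par u = v \<and> hanging v = [v, u])"
    if "v \<in> off" for v using that uniq by (intro hanging_cases) blast+
  show "length (hanging v) \<le> 2" if "v \<in> off" using hc[OF that] by auto
  have hh: "h u = 2" if "u \<in> off" "par u = v" "v \<in> ?L" for u v using h_par[OF that(1)] that by simp
  have set_h: "w \<in> off \<and> (w = v \<or> par w = v)" if "v \<in> off" "w \<in> set (hanging v)" for v w
    using hc[OF that(1)] that by auto
  have 1: "v \<in> set xs \<and> ys \<noteq> [] \<and> distinct ys \<and> set ys \<inter> set xs = {}"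
    if "(v, ys) \<in> (\<lambda>v. (par v, hanging v)) ` ?L" for v ys
  proof -
    obtain w where w: "w \<in> off" "h w = 1" "v = par w" "ys = hanging w" using \<open>(v, ys) \<in> _\<close> by auto
    from hc[OF w(1)] have "distinct (hanging w)"
    proof (elim disjE conjE bexE)
      fix u assume u: "u \<in> off" "par u = w" "hanging w = [w, u]"
      have "u \<noteq> w" using h_par[OF u(1)] u(2) by (metis n_not_Suc_n)
      then show ?thesis using u(3) by simp
    qed simp
    moreover have "set (hanging w) \<inter> set xs = {}" using set_h[OF w(1)] off_verts(2) by auto
    moreover have "hanging w \<noteq> []" by (simp add: hanging_def)
    ultimately show ?thesis using w par_cycle[OF w(1,2)] by simp
  qed
  have 2: "set (hanging v) \<inter> set (hanging v') = {}" if v: "v \<in> ?L" "v' \<in> ?L" "v \<noteq> v'" for v v'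
  proof (rule ccontr)
    assume "\<not> ?thesis"
    then obtain w where w: "w \<in> set (hanging v)" "w \<in> set (hanging v')" by blast
    have w': "w \<in> off" "w = v \<or> par w = v" "w = v' \<or> par w = v'"
      using set_h[of v w] set_h[of v' w] v w by simp_all
    then show False using v hh[OF w'(1) _ v(1)] hh[OF w'(1) _ v(2)] by (elim disjE) simp_all
  qed
  have V: "verts G = set xs \<union> (\<Union>v\<in>?L. set (hanging v))"
  proof (intro equalityI subsetI)
    fix w assume w: "w \<in> verts G"
    show "w \<in> set xs \<union> (\<Union>v\<in>?L. set (hanging v))"
    proof (cases "w \<in> set xs")
      case False
      then have o: "w \<in> off" using w by (simp add: off_def)
      show ?thesis
      proof (cases "h w = 1")
        case True
        then show ?thesis using o by (auto simp: hanging_def)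
      next
        case False
        then have "h w = 2" using height[OF o] h_off[OF o] by simp
        then have p: "par w \<in> ?L" using par_off[OF o] h_par[OF o] by simp
        have "par w \<in> off" using p by simp
        from hc[OF this] have "w \<in> set (hanging (par w))"
        proof (elim disjE conjE bexE)
          fix u assume u: "u \<in> off" "par u = par w" "hanging (par w) = [par w, u]"
          then have "u = w" using uniq[OF u(1) o u(2)] p by simp
          then show ?thesis using u(3) by simp
        qed (use o in blast)
        then show ?thesis using p by blast
      qed
    qed simp
  next
    fix w assume "w \<in> set xs \<union> (\<Union>v\<in>?L. set (hanging v))"
    then show "w \<in> verts G"
    proof
      assume "w \<in> (\<Union>v\<in>?L. set (hanging v))"
      then obtain v where "v \<in> ?L" "w \<in> set (hanging v)" by blast
      then show ?thesis using set_h[of v w] off_verts(1)[of w] by simp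
    qed (use cycle_verts in auto)
  qed
  have pe: "path_edges (par v # hanging v) = {{par v, v}} \<union> (\<lambda>u. {u, par u}) ` {u \<in> off. par u = v}"
    if v: "v \<in> ?L" for v
  proof -
    have "v \<in> off" using v by simp
    from hc[OF this] show ?thesis
    proof (elim disjE conjE bexE)
      fix u assume u: "u \<in> off" "par u = v" "hanging v = [v, u]"
      have "u' = u" if "u' \<in> off" "par u' = v" for u'
        using uniq[OF that(1) u(1)] that(2) u(2) v by simp
      then have "{u' \<in> off. par u' = v} = {u}" using u(1,2) by blast
      then show ?thesis using u(2,3) by (simp add: insert_commute)
    next
      assume hang: "hanging v = [v]" and "\<forall>u\<in>off. par u \<noteq> v"
      then have "{u \<in> off. par u = v} = {}" by blast
      then show ?thesis unfolding hang by (simp only: image_empty) simp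
    qed
  qed
  have E: "edges G = cycle_edges xs \<union> (\<Union>v\<in>?L. path_edges (par v # hanging v))"
  proof -
    have "(\<lambda>v. {v, par v}) ` off = (\<Union>v\<in>?L. {{par v, v}} \<union> (\<lambda>u. {u, par u}) ` {u \<in> off. par u = v})"
    proof (intro equalityI subsetI)
      fix e assume "e \<in> (\<lambda>v. {v, par v}) ` off"
      then obtain w where w: "w \<in> off" "e = {w, par w}" by blast
      show "e \<in> (\<Union>v\<in>?L. {{par v, v}} \<union> (\<lambda>u. {u, par u}) ` {u \<in> off. par u = v})"
      proof (cases "h w = 1")
        case True
        then show ?thesis using w by (auto simp: insert_commute)
      next
        case False
        then have "h w = 2" using height[OF w(1)] h_off[OF w(1)] by simp
        then have "par w \<in> ?L" using par_off[OF w(1)] h_par[OF w(1)] by simp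
        then show ?thesis using w by blast
      qed
    qed (auto simp: insert_commute)
    then show ?thesis unfolding edges_eq using pe by simp
  qed
  show "attachment (cycle_graph xs) ((\<lambda>v. (par v, hanging v)) ` ?L) G"
    unfolding attachment_def
  proof (intro conjI)
    show "finite ((\<lambda>v. (par v, hanging v)) ` ?L)" using off_finite by simp
    show "\<forall>(v, ys)\<in>(\<lambda>v. (par v, hanging v)) ` ?L. v \<in> verts (cycle_graph xs) \<and> ys \<noteq> [] \<and> distinct ys
        \<and> set ys \<inter> verts (cycle_graph xs) = {}"
      using 1 by (auto simp: cycle_graph_def)
    show "\<forall>p\<in>(\<lambda>v. (par v, hanging v)) ` ?L. \<forall>q\<in>(\<lambda>v. (par v, hanging v)) ` ?L.
        p \<noteq> q \<longrightarrow> set (snd p) \<inter> set (snd q) = {}"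
    proof (intro ballI impI)
      fix p q assume "p \<in> (\<lambda>v. (par v, hanging v)) ` ?L" "q \<in> (\<lambda>v. (par v, hanging v)) ` ?L" "p \<noteq> q"
      then obtain v v' where v: "v \<in> ?L" "p = (par v, hanging v)" "v' \<in> ?L" "q = (par v', hanging v')"
        by (elim imageE)
      then have "v \<noteq> v'" using \<open>p \<noteq> q\<close> by metis
      then show "set (snd p) \<inter> set (snd q) = {}" using 2[OF v(1,3)] v(2,4) by simp
    qed
    show "G = (verts (cycle_graph xs) \<union> (\<Union>(v, ys)\<in>(\<lambda>v. (par v, hanging v)) ` ?L. set ys),
        edges (cycle_graph xs) \<union> (\<Union>(v, ys)\<in>(\<lambda>v. (par v, hanging v)) ` ?L. path_edges (v # ys)))"
      by (rule prod_eqI) (use V E in \<open>simp_all add: cycle_graph_def\<close>)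
  qed
qed

lemma one_pathI:
  assumes "ys \<noteq> []" "distinct ys" "set ys = off" "(\<lambda>v. {v, par v}) ` off = path_edges (v # ys)" "v \<in> set xs"
  shows "cycle_one_path (length xs) (length ys) G"
  unfolding cycle_one_path_def
proof (intro exI conjI)
  show "attachment (cycle_graph xs) {(v, ys)} G"
    unfolding attachment_def
  proof (intro conjI)
    show "G = (verts (cycle_graph xs) \<union> (\<Union>(v, ys)\<in>{(v, ys)}. set ys),
        edges (cycle_graph xs) \<union> (\<Union>(v, ys)\<in>{(v, ys)}. path_edges (v # ys)))"
      by (rule prod_eqI) (use assms cycle_verts in \<open>auto simp: cycle_graph_def edges_eq off_def\<close>)
  qed (use assms off_verts(2) in \<open>auto simp: cycle_graph_def\<close>)
qed (use dist in simp_all)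

text \<open>If all heights are at most one, uniqueness of children leaves pendant edges. If some
  \<open>q\<close> has height two, everything else is forbidden except a pendant vertex opposite to
  the foot of its branch.\<close>

lemma square_shape:
  assumes l: "length xs = 4" and no: "\<not> two_claws G"
  shows "C4_pendants G \<or> C4_seven_vertices G \<or> cycle_one_path 4 2 G"
proof -
  have l': "length xs = 4 \<or> length xs = 5" using l by simp
  note uniq = unique_child_4_5[OF l' no] and height = height_4_5[OF l' no]
  show ?thesis
  proof (cases "\<exists>q\<in>off. h q = 2")
    case False
    then have h1: "h v = 1" if "v \<in> off" for v
      using height[OF that] h_off[OF that] that by (metis One_nat_def Suc_leI le_antisym le_SucE numeral_2_eq_2)
    let ?P = "(\<lambda>v. (par v, hanging v)) ` {v \<in> off. h v = 1}"
    have "attachment (cycle_graph xs) ?P G" using height uniq by (intro hanging_attachment(1)) blast+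
    moreover have "inj_on fst ?P" using uniq by (auto simp: inj_on_def)
    moreover have "hanging v = [v]" if "v \<in> off" for v
    proof -
      have "par u \<noteq> v" if "u \<in> off" for u using h_par[OF that] h1[OF that] h1[OF \<open>v \<in> off\<close>] by auto
      then show ?thesis by (auto simp: hanging_def)
    qed
    then have "\<forall>(v, ys)\<in>?P. length ys = 1" by auto
    ultimately show ?thesis unfolding C4_pendants_def using l dist by blast
  next
    case True
    then obtain q where q: "q \<in> off" "h q = 2" by blast
    define p where "p = par q"
    have p: "p \<in> off" "h p = 1" using par_off[OF q(1)] h_par[OF q(1)] q(2) by (auto simp: p_def)
    obtain k where k: "rotate k xs ! 0 = par p" using rotate_to[OF par_cycle[OF p]] by metis
    let ?R = "rotate k xs"
    interpret R: rooted_graph G ?R par h by (rule rotated(1))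
    have off_R: "R.off = off" by (rule rotated(2))
    have R4: "length ?R = 4" using l by simp
    have br: False if "s \<in> off" "par s = ?R ! 1 \<or> par s = ?R ! 3 \<or> (par s = ?R ! 2 \<and> t \<in> off \<and> par t = s)" for s t
      using R.branches_4[OF R4, unfolded off_R, OF p(1) k[symmetric] q(1) p_def[symmetric] that] no
      by (rule notE[rotated])
    have one: "s = p \<or> par s = ?R ! 2" if s: "s \<in> off" "h s = 1" for s
    proof -
      have "par s \<in> set ?R" using par_cycle[OF s] by simp
      then obtain i where "i < length ?R" and i2: "?R ! i = par s" unfolding in_set_conv_nth by blast
      then have "i < 4" using l by simp
      then consider "i = 0" | "i = 1" | "i = 2" | "i = 3" by linarith
      then show ?thesis
      proof cases
        case 1
        then have "par s = par p" using k i2 by metis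
        then show ?thesis using uniq[OF s(1) p(1)] by blast
      next
        case 2
        then have "par s = ?R ! 1" using i2 by metis
        then show ?thesis using br[OF s(1)] by blast
      next
        case 3
        then have "par s = ?R ! 2" using i2 by metis
        then show ?thesis by blast
      next
        case 4
        then have "par s = ?R ! 3" using i2 by metis
        then show ?thesis using br[OF s(1)] by blast
      qed
    qed
    have two: "s = q" if s: "s \<in> off" "h s \<noteq> 1" for s
    proof -
      have s2: "h s = 2" using height[OF s(1)] h_off[OF s(1)] s(2) by simp
      have ps: "par s \<in> off" "h (par s) = 1" using par_off[OF s(1)] h_par[OF s(1)] s2 by auto
      have "par (par s) \<noteq> ?R ! 2" using br[OF ps(1), of s] s(1) by blast
      then have "par s = p" using one[OF ps] by blast
      then show ?thesis using uniq[OF s(1) q(1)] by (simp add: p_def)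
    qed
    have pq: "p \<noteq> q" using p q by auto
    show ?thesis
    proof (cases "\<exists>s\<in>off. par s = ?R ! 2")
      case False
      then have off: "off = {p, q}" using one two p(1) q(1) by blast
      have "cycle_one_path (length ?R) (length [p, q]) G"
      proof (rule R.one_pathI[of _ "?R ! 0"])
        show "(\<lambda>v. {v, par v}) ` R.off = path_edges (?R ! 0 # [p, q])"
          unfolding off_R off using k by (simp add: p_def[symmetric] insert_commute)
        show "?R ! 0 \<in> set ?R" using R4 by (intro nth_mem) simp
      qed (use pq off off_R in auto)
      then show ?thesis using R4 by (simp add: numeral_2_eq_2)
    next
      case True
      then obtain s where s: "s \<in> off" "par s = ?R ! 2" by blast
      have R2: "?R ! i \<in> set ?R" "?R ! i \<notin> off" if "i < 4" for i
        using R4 that off_verts(2)[of "?R ! i"] nth_mem[of i ?R] by auto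
      have "h s = 1" using h_par[OF s(1)] s(2) R.h_cycle[OF R2(1)[of 2]] by simp
      have neq: "?R ! i = ?R ! j \<longleftrightarrow> i = j" if "i < 4" "j < 4" for i j
        using R.dist R4 that by (simp add: nth_eq_iff_index_eq)
      have sp: "s \<noteq> p" "s \<noteq> q"
      proof -
        have "par s \<noteq> par p" unfolding s(2) k[symmetric] using neq[of 2 0] by simp
        then show "s \<noteq> p" by blast
        show "s \<noteq> q" using q(2) \<open>h s = 1\<close> by auto
      qed
      have off: "off = {p, q, s}"
      proof (intro equalityI subsetI)
        fix t assume t: "t \<in> off"
        show "t \<in> {p, q, s}"
        proof (cases "h t = 1")
          case True
          then show ?thesis using one[OF t] uniq[OF t s(1)] s(2) by auto
        qed (use two[OF t] in simp)
      qed (use p(1) q(1) s(1) in auto)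
      have set_4: "set ys = {ys ! 0, ys ! 1, ys ! 2, ys ! 3}" if "length ys = 4" for ys :: "'a list"
        using that by (auto simp: length_Suc_conv numeral_eq_Suc)
      have set_R: "set ?R = {?R ! 0, ?R ! 1, ?R ! 2, ?R ! 3}"
        using set_4 R4 by blast
      have "verts G = set ?R \<union> off" using R.cycle_verts unfolding off_R[symmetric] R.off_def by blast
      then have V: "verts G = {?R ! 0, ?R ! 1, ?R ! 2, ?R ! 3, p, q, s}"
        by (simp only: set_R off Un_insert_left Un_empty_left)
      have E: "edges G = {{?R ! 0, ?R ! 1}, {?R ! 1, ?R ! 2}, {?R ! 2, ?R ! 3}, {?R ! 3, ?R ! 0}}
          \<union> {{?R ! 0, p}, {p, q}, {?R ! 2, s}}"
        unfolding R.edges_eq off_R off cycle_edges_4[OF R4] using k s(2)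
        by (simp add: p_def[symmetric] insert_commute)
      have "distinct [?R ! 0, ?R ! 1, ?R ! 2, ?R ! 3, p, q, s]"
        using neq R2(2)[of 0] R2(2)[of 1] R2(2)[of 2] R2(2)[of 3] pq sp off by auto
      moreover have "G = ({?R ! 0, ?R ! 1, ?R ! 2, ?R ! 3, p, q, s},
          {{?R ! 0, ?R ! 1}, {?R ! 1, ?R ! 2}, {?R ! 2, ?R ! 3}, {?R ! 3, ?R ! 0}}
          \<union> {{?R ! 0, p}, {p, q}, {?R ! 2, s}})"
        by (rule prod_eqI) (simp_all only: fst_conv snd_conv V E)
      ultimately have "C4_seven_vertices G" unfolding C4_seven_vertices_def by blast
      then show ?thesis by blast
    qed
  qed
qed

text \<open>The claw away from the triangle forces vertices off the cycle to have at most one child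
  and height at most three. Two claws then limit how the branches are distributed over the
  triangle.\<close>

lemma triangle_shape:
  assumes l: "length xs = 3" and S: "enjoys_strong_exchange TYPE('k::field) G"
  shows "C3_short_paths G \<or> cycle_one_path 3 3 G \<or> C3_paths_at_vertex G"
proof -
  have no: "\<not> two_claws G" using two_claws_not_exchange[OF G] S by blast
  have claw: False if "y \<in> off" "s1 \<in> off" "s2 \<in> off" "s1 \<noteq> s2" "2 \<le> h s1" "2 \<le> h s2"
    "{y, s1} \<in> edges G" "{y, s2} \<in> edges G" "{s1, s2} \<notin> edges G" for y s1 s2
    using two_children_3[OF l that(2-6) that(1) that(7-9)] S by blast
  have uniq: "u = w" if u: "u \<in> off" and w: "w \<in> off" and eq: "par u = par w" and p: "par u \<in> off" for u w
  proof (rule ccontr)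
    assume ne: "u \<noteq> w"
    have hu: "h u = Suc (h (par u))" "h w = Suc (h (par u))" "0 < h (par u)"
      using h_par[OF u] h_par[OF w] eq h_off[OF p] by simp_all
    have "par u \<noteq> w" using hu(2) by (metis n_not_Suc_n)
    moreover have "par w \<noteq> u" using hu(1) eq by (metis n_not_Suc_n)
    ultimately have "{u, w} \<notin> edges G" using off_adj_off[OF u w] by simp
    moreover have "{par u, u} \<in> edges G" "{par u, w} \<in> edges G"
      using off_adj_off[OF p u] off_adj_off[OF p w] eq by simp_all
    ultimately show False using claw[OF p u w ne] hu by simp
  qed
  have height: "h v \<le> 3" if v: "v \<in> off" for v
  proof (rule ccontr)
    assume "\<not> h v \<le> 3"
    then obtain r where r: "r \<in> off" "h r = 4" using ancestor[OF v, of 4] by auto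
    define y where "y = par r"
    have y: "y \<in> off" "h y = 3" using par_off[OF r(1)] h_par[OF r(1)] r(2) by (auto simp: y_def)
    define s where "s = par y"
    have s: "s \<in> off" "h s = 2" using par_off[OF y(1)] h_par[OF y(1)] y(2) by (auto simp: s_def)
    have "par s \<noteq> r" using h_par[OF s(1)] s(2) r(2) by auto
    moreover have "par r \<noteq> s" using y(2) s(2) unfolding y_def by auto
    ultimately have "{s, r} \<notin> edges G" using off_adj_off[OF s(1) r(1)] by simp
    moreover have "{y, s} \<in> edges G" "{y, r} \<in> edges G"
      using off_adj_off[OF y(1) s(1)] off_adj_off[OF y(1) r(1)] by (simp_all add: s_def y_def)
    moreover have "s \<noteq> r" using s(2) r(2) by auto
    ultimately show False using claw[OF y(1) s(1) r(1)] s(2) r(2) by simp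
  qed
  show ?thesis
  proof (cases "\<exists>r\<in>off. h r = 3")
    case True
    then obtain r where r: "r \<in> off" "h r = 3" by blast
    define q where "q = par r"
    have q: "q \<in> off" "h q = 2" using par_off[OF r(1)] h_par[OF r(1)] r(2) by (auto simp: q_def)
    define p where "p = par q"
    have p: "p \<in> off" "h p = 1" using par_off[OF q(1)] h_par[OF q(1)] q(2) by (auto simp: p_def)
    obtain k where k: "rotate k xs ! 0 = par p" using rotate_to[OF par_cycle[OF p]] by metis
    let ?R = "rotate k xs"
    interpret R: rooted_graph G ?R par h by (rule rotated(1))
    have off_R: "R.off = off" by (rule rotated(2))
    have R3: "length ?R = 3" using l by simp
    have 1: "s = p" if s: "s \<in> off" "h s = 1" for s
    proof (rule ccontr)
      assume "s \<noteq> p"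
      moreover have "par s \<in> set ?R" using par_cycle[OF s] by simp
      ultimately have "two_claws G"
        using R.long_path_3[OF R3, unfolded off_R, OF p(1) k[symmetric] q(1) p_def[symmetric] r(1)
            q_def[symmetric] s(1)] by blast
      then show False using no by blast
    qed
    have 2: "s = q" if s: "s \<in> off" "h s = 2" for s
    proof -
      have ps: "par s \<in> off" "h (par s) = 1" using par_off[OF s(1)] h_par[OF s(1)] s(2) by auto
      then show ?thesis using 1[OF ps] uniq[OF s(1) q(1)] by (simp add: p_def)
    qed
    have 3: "s = r" if s: "s \<in> off" "h s = 3" for s
    proof -
      have ps: "par s \<in> off" "h (par s) = 2" using par_off[OF s(1)] h_par[OF s(1)] s(2) by auto
      then show ?thesis using 2[OF ps] uniq[OF s(1) r(1)] by (simp add: q_def)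
    qed
    have off: "off = {p, q, r}"
    proof (intro equalityI subsetI)
      fix s assume s: "s \<in> off"
      have "h s = 1 \<or> h s = 2 \<or> h s = 3" using height[OF s] h_off[OF s] by linarith
      then show "s \<in> {p, q, r}" using 1[OF s] 2[OF s] 3[OF s] by blast
    qed (use p q r in auto)
    have "cycle_one_path (length ?R) (length [p, q, r]) G"
    proof (rule R.one_pathI[of _ "?R ! 0"])
      show "distinct [p, q, r]" using p q r by auto
      show "(\<lambda>v. {v, par v}) ` R.off = path_edges (?R ! 0 # [p, q, r])"
        unfolding off_R off using k by (simp add: p_def[symmetric] q_def[symmetric] insert_commute)
      show "?R ! 0 \<in> set ?R" using R3 by (intro nth_mem) simp
    qed (use off off_R in auto)
    then show ?thesis using R3 by (simp add: numeral_3_eq_3)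
  next
    case False
    then have height2: "h v \<le> 2" if "v \<in> off" for v
      using height[OF that] that by (metis le_SucE numeral_2_eq_2 numeral_3_eq_3)
    let ?P = "(\<lambda>v. (par v, hanging v)) ` {v \<in> off. h v = 1}"
    have att: "attachment (cycle_graph xs) ?P G" using height2 uniq by (intro hanging_attachment(1)) blast+
    have len2: "length (hanging v) \<le> 2" if "v \<in> off" for v
      using height2 uniq that by (intro hanging_attachment(2)) blast+
    show ?thesis
    proof (cases "\<exists>p\<in>off. \<exists>p'\<in>off. p \<noteq> p' \<and> h p = 1 \<and> h p' = 1 \<and> par p = par p'")
      case True
      then obtain p p' where p: "p \<in> off" "p' \<in> off" "p \<noteq> p'" "par p = par p'" "h p = 1" by blast
      \<comment> \<open>Two branches at one triangle vertex exclude branches at the other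
        two.\<close>
      have "par r = par p" if r: "r \<in> off" "h r = 1" for r
        using branches_3[OF l p(1-4) par_cycle[OF p(1,5)] r(1) par_cycle[OF r]] no by blast
      then have "\<exists>v\<in>set xs. \<forall>(u, ys)\<in>?P. u = v \<and> length ys \<le> 2"
        using par_cycle[OF p(1,5)] len2 by (intro bexI[of _ "par p"]) auto
      then show ?thesis unfolding C3_paths_at_vertex_def using l dist att by blast
    next
      case False
      then have "inj_on fst ?P" by (auto simp: inj_on_def)
      moreover have "\<forall>(v, ys)\<in>?P. length ys \<le> 2" using len2 by auto
      ultimately show ?thesis unfolding C3_short_paths_def using l dist att by blast
    qed
  qed
qed

end

section \<open>The classification by the length of the cycle\<close>

theorem theorem5p23:
  fixes G :: "'a graph" and C :: "'a set set" and l :: nat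
  assumes "unicyclic G" and "C \<in> cycles G" and "l = card C"
  shows "(l \<ge> 8 \<longrightarrow> \<not> enjoys_strong_exchange TYPE('k::field) G)
    \<and> (l \<in> {5, 6, 7} \<longrightarrow>
        (enjoys_strong_exchange TYPE('k) G \<longleftrightarrow> independence_number G \<le> 3))
    \<and> (l = 4 \<longrightarrow>
        (enjoys_strong_exchange TYPE('k) G \<longleftrightarrow>
          C4_pendants G \<or> C4_seven_vertices G \<or> cycle_one_path 4 2 G))
    \<and> (l = 3 \<longrightarrow>
        (enjoys_strong_exchange TYPE('k) G \<longleftrightarrow>
          C3_short_paths G \<or> cycle_one_path 3 3 G \<or> C3_paths_at_vertex G))"
proof -
  obtain xs par h where R: "rooted G xs par h" "length xs = card C"
    using unicyclic_rooted[OF assms(1,2)] by metis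
  then interpret rooted_graph G xs par h by (simp add: rooted_graph_def)
  have l: "length xs = l" using R(2) assms(3) by simp
  have closed: "enjoys_strong_exchange TYPE('k) G" if "always_exchange_closed (edges G)"
    using that by (simp add: enjoys_strong_exchange_iff[OF G] always_exchange_closed_def)
  have claws: "\<not> enjoys_strong_exchange TYPE('k) G" "\<not> independence_number G \<le> 3" if "two_claws G"
    using two_claws_not_exchange[OF G that] two_claws_independence[OF G that] by blast+
  show ?thesis
  proof (intro conjI impI)
    assume "8 \<le> l"
    then show "\<not> enjoys_strong_exchange TYPE('k) G" using long_cycle claws(1) l by simp
  next
    assume "l \<in> {5, 6, 7}"
    then show "enjoys_strong_exchange TYPE('k) G \<longleftrightarrow> independence_number G \<le> 3"
      using long_5_6_7[OF _ _ pentagon_tail_exchange hexagon_exchange heptagon_exchange] closed claws l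
      by blast
  next
    assume "l = 4"
    then show "enjoys_strong_exchange TYPE('k) G \<longleftrightarrow>
        C4_pendants G \<or> C4_seven_vertices G \<or> cycle_one_path 4 2 G"
      using square_shape claws(1) closed C4_pendants_exchange C4_seven_vertices_exchange square_tail_exchange l
      by blast
  next
    assume "l = 3"
    then show "enjoys_strong_exchange TYPE('k) G \<longleftrightarrow>
        C3_short_paths G \<or> cycle_one_path 3 3 G \<or> C3_paths_at_vertex G"
      using triangle_shape closed C3_short_paths_exchange[OF triangle_paths_exchange]
        triangle_one_path_exchange C3_paths_at_vertex_exchange l
      by blast
  qed
qed

end
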